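(* Let $\theta>0$, let $m\ge1$ be an integer, and let the measurement error distribution $G$ have characteristic function $\widehat g(i\omega)=\int_{-\infty}^\infty e^{-i\omega t}\,dG(t)=[\sin(\theta\omega)/(\theta\omega)]^m$, $\omega\in\mathbb R$. Let $A>0$, $B>0$. (a) Let $\alpha>0$ and $x_0\in\mathbb R$. If $0<p<2m-2$, then $$\liminf_{n\to\infty}\Big\{n^{\alpha/(2\alpha+2m+1)}\,\inf_{\tilde f}\ \sup_{f\in\mathscr F_{\alpha,p}(A,B)}\big\{\mathbb E_f|\tilde f(x_0)-f(x_0)|^2\big\}^{1/2}\Big\}=\infty .$$ (b) Let $\alpha>1/2$. If $0<p<2m-1$, then $$\liminf_{n\to\infty}\Big\{n^{\alpha/(2\alpha+2m+1)}\,\inf_{\tilde f}\ \sup_{f\in\mathscr G_{\alpha,p}(A,B)}\big\{\mathbb E_f\|\tilde f-f\|_2^2\big\}^{1/2}\Big\}=\infty .$$ In both cases the infimum is over all possible estimators $\tilde f$, i.e. all measurable functions of the observations $(Y_1,\dots,Y_n)$.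
   Context: **Model.** One observes $Y_j=X_j+\epsilon_j$, $j=1,\dots,n$, where $X_1,\dots,X_n$ are i.i.d. real random variables with unknown density $f$, $\epsilon_1,\dots,\epsilon_n$ are i.i.d. with known distribution $G$, and the $\epsilon_j$ are independent of the $X_j$. $\mathbb E_f$ denotes expectation under the law of $(Y_1,\dots,Y_n)$ when the density of $X$ is $f$; $\|\cdot\|_2$ is the $L_2(\mathbb R)$ norm. **Functional classes.** Let $\lfloor\alpha\rfloor:=\max\{k\in\mathbb N\cup\{0\}:k<\alpha\}$. - $\mathscr H_\alpha(A)$: probability densities $f$ on $\mathbb R$ that are $\lfloor\alpha\rfloor$ times continuously differentiable with $|f^{(\lfloor\alpha\rfloor)}(x)-f^{(\lfloor\alpha\rfloor)}(x')|\le A|x-x'|^{\alpha-\lfloor\alpha\rfloor}$ for all $x,x'\in\mathbb R$. - $\mathscr S_\alpha(A)$ ($\alpha>1/2$): probability densities $f$ that are $\lfloor\alpha\rfloor$ times differentiable with $\|f^{(\lfloor\alpha\rfloor)}(\cdot+t)-f^{(\lfloor\alpha\rfloor)}(\cdot)\|_{2}\le A|t|^{\alpha-\lfloor\alpha\rfloor}$ for all $t\in\mathbb R$. - $\mathscr M_p(B)$ ($p>0$): probability densities $f$ with $\max\{\|f\|_\infty,\ \max_{0<r\le p}\int_{-\infty}^\infty|t|^rf(t)\,dt\}\le B$. - $\mathscr F_{\alpha,p}(A,B)=\mathscr H_\alpha(A)\cap\mathscr M_p(B)$ and $\mathscr G_{\alpha,p}(A,B)=\mathscr S_\alpha(A)\cap\mathscr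 M_p(B)$.
   Formalization: The claim is false for some A, B > 0 (for B < 1 the classes are empty), so each part additionally assumes that the class in question contains a density whose p-th absolute moment is strictly less than B. *)

theory Defs
  imports "HOL-Probability.Probability"
begin

section \<open>Norms and moments\<close>

text \<open>All norms, moments and risks take values in \<^typ>\<open>ennreal\<close>, so that a divergent integral
  counts as infinity and not as the junk value 0.\<close>

definition esqrt :: "ennreal \<Rightarrow> ennreal" where
  "esqrt x = (if x = \<infinity> then \<infinity> else ennreal (sqrt (enn2real x)))"

definition L2norm :: "(real \<Rightarrow> real) \<Rightarrow> ennreal" where
  "L2norm h = esqrt (\<integral>\<^sup>+ x. ennreal ((h x)\<^sup>2) \<partial>lborel)"

definition Linf_norm :: "(real \<Rightarrow> real) \<Rightarrow> ennreal" where
  "Linf_norm h = esssup lborel (\<lambda>x. ennreal \<bar>h x\<bar>)"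

definition abs_moment :: "real \<Rightarrow> (real \<Rightarrow> real) \<Rightarrow> ennreal" where
  "abs_moment r f = (\<integral>\<^sup>+ t. ennreal (\<bar>t\<bar> powr r * f t) \<partial>lborel)"

section \<open>Functional classes\<close>

definition prob_density :: "(real \<Rightarrow> real) \<Rightarrow> bool" where
  "prob_density f \<longleftrightarrow>
     f \<in> borel_measurable borel \<and> (\<forall>x. 0 \<le> f x) \<and> (\<integral>\<^sup>+ x. ennreal (f x) \<partial>lborel) = 1"

text \<open>The inequality is strict: an integer \<open>\<alpha> \<ge> 1\<close> is sent to \<open>\<alpha> - 1\<close>. Only \<open>\<alpha> > 0\<close> is meaningful.\<close>

definition strict_floor :: "real \<Rightarrow> nat" where
  "strict_floor \<alpha> = Max {k::nat. real k < \<alpha>}"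

definition times_differentiable :: "nat \<Rightarrow> (real \<Rightarrow> real) \<Rightarrow> bool" where
  "times_differentiable k f \<longleftrightarrow> (\<forall>i<k. \<forall>x. (deriv ^^ i) f field_differentiable (at x))"

definition holder_class :: "real \<Rightarrow> real \<Rightarrow> (real \<Rightarrow> real) set" where
  "holder_class \<alpha> A = {f. prob_density f \<and>
     times_differentiable (strict_floor \<alpha>) f \<and>
     continuous_on UNIV ((deriv ^^ strict_floor \<alpha>) f) \<and>
     (\<forall>x x'. \<bar>(deriv ^^ strict_floor \<alpha>) f x - (deriv ^^ strict_floor \<alpha>) f x'\<bar>
        \<le> A * \<bar>x - x'\<bar> powr (\<alpha> - real (strict_floor \<alpha>)))}"

definition sobolev_class :: "real \<Rightarrow> real \<Rightarrow> (real \<Rightarrow> real) set" where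
  "sobolev_class \<alpha> A = {f. prob_density f \<and>
     times_differentiable (strict_floor \<alpha>) f \<and>
     (\<forall>t. L2norm (\<lambda>x. (deriv ^^ strict_floor \<alpha>) f (x + t) - (deriv ^^ strict_floor \<alpha>) f x)
        \<le> ennreal (A * \<bar>t\<bar> powr (\<alpha> - real (strict_floor \<alpha>))))}"

definition moment_class :: "real \<Rightarrow> real \<Rightarrow> (real \<Rightarrow> real) set" where
  "moment_class p B = {f. prob_density f \<and>
     max (Linf_norm f) (SUP r\<in>{0<..p}. abs_moment r f) \<le> ennreal B}"

definition F_class :: "real \<Rightarrow> real \<Rightarrow> real \<Rightarrow> real \<Rightarrow> (real \<Rightarrow> real) set" where
  "F_class \<alpha> p A B = holder_class \<alpha> A \<inter> moment_class p B"

definition G_class :: "real \<Rightarrow> real \<Rightarrow> real \<Rightarrow> real \<Rightarrow> (real \<Rightarrow> real) set" where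
  "G_class \<alpha> p A B = sobolev_class \<alpha> A \<inter> moment_class p B"

text \<open>For some \<open>A, B > 0\<close> these classes are empty: always if \<open>B < 1\<close>, because \<open>abs_moment r f\<close> tends
  to at least 1 as \<open>r\<close> tends to 0, and for every \<open>B\<close> if \<open>A\<close> is too small. No minimax lower bound
  holds over an empty class, nor over one that consists of a single density. The following condition
  rules out such \<open>A, B\<close>: some member of the class \<open>K\<close> does not exhaust the bound on the
  \<open>p\<close>-th moment.\<close>

definition moment_slack :: "real \<Rightarrow> real \<Rightarrow> (real \<Rightarrow> real) set \<Rightarrow> bool" where
  "moment_slack p B K \<longleftrightarrow> (\<exists>f\<in>K. abs_moment p f < ennreal B)"

section \<open>Observations, estimators, minimax risks\<close>

text \<open>Joint law of \<open>Y\<^sub>j = X\<^sub>j + \<epsilon>\<^sub>j\<close>, \<open>j < n\<close>, all variables independent, \<open>X\<^sub>j\<close> with density \<open>f\<close>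
  and \<open>\<epsilon>\<^sub>j\<close> with law \<open>G\<close>.\<close>

definition obs_law :: "real measure \<Rightarrow> nat \<Rightarrow> (real \<Rightarrow> real) \<Rightarrow> (nat \<Rightarrow> real) measure" where
  "obs_law G n f = (\<Pi>\<^sub>M j\<in>{..<n}. convolution (density lborel (\<lambda>x. ennreal (f x))) G)"

text \<open>An estimator takes the observations \<open>y\<close> and a point \<open>x\<close>; joint measurability makes both
  the pointwise and the integrated loss measurable in \<open>y\<close>. For the pointwise risk at a fixed
  \<open>x\<^sub>0\<close> it is no restriction, since a measurable function of \<open>y\<close> alone is an estimator constant
  in \<open>x\<close>.\<close>

definition estimators :: "nat \<Rightarrow> ((nat \<Rightarrow> real) \<Rightarrow> real \<Rightarrow> real) set" where
  "estimators n = {T. (\<lambda>(y, x). T y x) \<in>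
     borel_measurable ((\<Pi>\<^sub>M j\<in>{..<n}. (borel :: real measure)) \<Otimes>\<^sub>M (borel :: real measure))}"

definition minimax_point ::
  "real measure \<Rightarrow> nat \<Rightarrow> (real \<Rightarrow> real) set \<Rightarrow> real \<Rightarrow> ennreal" where
  "minimax_point G n K x\<^sub>0 = (INF T\<in>estimators n. SUP f\<in>K.
     esqrt (\<integral>\<^sup>+ y. ennreal (\<bar>T y x\<^sub>0 - f x\<^sub>0\<bar>\<^sup>2) \<partial>obs_law G n f))"

definition minimax_L2 :: "real measure \<Rightarrow> nat \<Rightarrow> (real \<Rightarrow> real) set \<Rightarrow> ennreal" where
  "minimax_L2 G n K = (INF T\<in>estimators n. SUP f\<in>K.
     esqrt (\<integral>\<^sup>+ y. (L2norm (\<lambda>x. T y x - f x))\<^sup>2 \<partial>obs_law G n f))"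

end

(*
  The error law is the m-fold convolution of the uniform law on [-theta, theta], so convolution with
  it turns an m-th derivative into an m-th difference with step 2 theta. Perturb a base density by a
  comb: copies at distance 2 theta of an m-th derivative of a bump of width h, weighted by the
  coefficients of (1 + X + ... + X^(N-1))^(m+1) / N^m. The difference operator telescopes against
  the weights, so the observed perturbation is smaller by the factor N^(-m), while the comb has only
  of order N teeth. The moment condition allows a base density of order N^(-p-1) at distance N. The
  chi-square distance of the observation laws is then that of a standard deconvolution problem
  times N^(p+2-2m), respectively N^(p+1-2m) for the integrated risk, where the height of the comb
  is lowered by N^(-1/2). These powers are negative, hence a large N that does not depend on n
  allows h = D n^(-1/(2 alpha + 2m + 1)) for any D. Le Cam's two-point bound and Assouad's bound with
  theta/h shifts of the comb finish the proof.
*)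

theory Submission
  imports Defs "HOL-Computational_Algebra.Polynomial"
begin

text \<open>The error transform sin(theta w)^m / (theta w)^m vanishes to order m at every nonzero
  multiple of pi/theta. Its decay alone dictates the usual rate; the zeros make estimation harder if
  a perturbation can put its Fourier mass near them. An m-th derivative contributes w^m, cancels the
  denominator and leaves sin(theta w)^m, which vanishes at frequency 0 as well. Teeth at distance 2
  theta concentrate the spectrum within order 1/N of these zeros, whence N^(-m). Such a comb is of
  order N wide, and here the moment condition resists: the density has to be large enough under the
  whole comb. The exponent m + 1 of the weights is the smallest that attains N^(-m). With exponent m
  and weights still of order 1, telescoping would leave m + 1 teeth of relative size N^(1-m) instead
  of order N teeth of size N^(-m), and the squared norm would be larger by a factor N. For the
  integrated risk the height is lowered because the Sobolev norm of a comb grows like the square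
  root of the number of teeth. Its L2 norm grows in the same way, so the loss does not
  suffer.\<close>

section \<open>Iterated derivatives\<close>

lemma times_differentiable_DERIV:
  assumes "times_differentiable k f" "i < k"
  shows "((deriv ^^ i) f has_real_derivative (deriv ^^ Suc i) f x) (at x)"
  using assms by (auto simp: times_differentiable_def DERIV_deriv_iff_field_differentiable)

text \<open>\<open>deriv\<close> is a choice operator; an explicit chain \<open>d\<close> of
  derivatives pins down its iterates.\<close>

lemma iterated_deriv_unique:
  assumes "d 0 = f" and D: "\<And>i x. i < k \<Longrightarrow> (d i has_real_derivative d (Suc i) x) (at x)"
  shows "i \<le> k \<Longrightarrow> (deriv ^^ i) f = d i"
proof (induction i)
  case (Suc i)
  then have "(deriv ^^ Suc i) f = deriv (d i)" by simp
  also have "\<dots> = d (Suc i)"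
    using D[of i] Suc.prems by (auto intro!: ext DERIV_imp_deriv)
  finally show ?case .
qed (use assms in simp)

lemma times_differentiableI:
  assumes "d 0 = f" and D: "\<And>i x. i < k \<Longrightarrow> (d i has_real_derivative d (Suc i) x) (at x)"
  shows "times_differentiable k f"
  unfolding times_differentiable_def
proof (intro allI impI)
  fix i x assume "i < k"
  then show "(deriv ^^ i) f field_differentiable at x"
    using iterated_deriv_unique[of d f k i, OF assms] D[of i x]
    by (auto simp: field_differentiable_def)
qed

text \<open>A derivative is the pointwise limit of difference quotients with step 1/(n+1), so
  continuity does not enter. The Sobolev class asks only for differentiability, while the triangle
  inequality for its top derivatives needs measurability.\<close>

lemma iterated_deriv_measurable:
  assumes "times_differentiable k f" "f \<in> borel_measurable borel" "i \<le> k"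
  shows "(deriv ^^ i) f \<in> borel_measurable borel"
  using assms(3)
proof (induction i)
  case (Suc i)
  let ?g = "(deriv ^^ i) f" and ?g' = "(deriv ^^ Suc i) f"
  have [measurable]: "?g \<in> borel_measurable borel" using Suc by auto
  show ?case
  proof (rule borel_measurable_LIMSEQ_real)
    fix x :: real
    have "(?g has_real_derivative ?g' x) (at x)"
      using times_differentiable_DERIV assms(1) Suc.prems by (metis Suc_le_lessD)
    then have "((\<lambda>h. (?g (x + h) - ?g x) / h) \<longlongrightarrow> ?g' x) (at 0)"
      by (simp only: DERIV_def)
    moreover have "filterlim (\<lambda>n. inverse (real (Suc n))) (at 0) sequentially"
      by (auto simp: filterlim_at LIMSEQ_inverse_real_of_nat simp del: of_nat_Suc)
    ultimately show "(\<lambda>n. (?g (x + inverse (real (Suc n))) - ?g x) / inverse (real (Suc n)))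
        \<longlonglongrightarrow> ?g' x"
      by (rule filterlim_compose)
  qed measurable
qed (use assms in simp)

lemma times_differentiable_linear:
  assumes f: "times_differentiable k f" and g: "times_differentiable k g"
  shows "times_differentiable k (\<lambda>x. c * f x + d * g x)"
    and "i \<le> k \<Longrightarrow> (deriv ^^ i) (\<lambda>x. c * f x + d * g x)
          = (\<lambda>x. c * (deriv ^^ i) f x + d * (deriv ^^ i) g x)"
proof -
  let ?D = "\<lambda>i x. c * (deriv ^^ i) f x + d * (deriv ^^ i) g x"
  have D: "(?D i has_real_derivative ?D (Suc i) x) (at x)" if "i < k" for i x
    by (intro DERIV_add DERIV_cmult times_differentiable_DERIV[OF f that]
        times_differentiable_DERIV[OF g that])
  show "times_differentiable k (\<lambda>x. c * f x + d * g x)"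
    by (rule times_differentiableI[of ?D]) (use D in auto)
  show "i \<le> k \<Longrightarrow> (deriv ^^ i) (\<lambda>x. c * f x + d * g x) = ?D i"
    by (rule iterated_deriv_unique[of ?D]) (use D in auto)
qed

section \<open>A polynomial bump\<close>

text \<open>The l-th derivative of x^K (1 - x)^K on the unit interval, extended by 0. The smoothness
  is finite, but all derivatives are polynomials, so that boundedness, zeros and vanishing at the
  endpoints are algebra. With all orders in one family, differentiation just raises
  \<open>l\<close>.\<close>

definition bump :: "nat \<Rightarrow> nat \<Rightarrow> real \<Rightarrow> real" where
  "bump K l x = (if 0 < x \<and> x < 1 then poly ((pderiv ^^ l) (([:0, 1:] * [:1, -1:]) ^ K)) x else 0)"

lemma bump_eq_0: "\<not> (0 < x \<and> x < 1) \<Longrightarrow> bump K l x = 0"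
  by (auto simp: bump_def)

lemma bump_0: "0 < x \<Longrightarrow> x < 1 \<Longrightarrow> bump K 0 x = (x * (1 - x)) ^ K"
  by (simp add: bump_def poly_power algebra_simps)

lemma bump_0_nonneg: "0 \<le> bump K 0 x"
  using bump_0[of x K] bump_eq_0[of x K 0] by (cases "0 < x \<and> x < 1") auto

lemma bump_0_lower:
  assumes "1/4 \<le> x" "x \<le> 3/4"
  shows "(3/16) ^ K \<le> bump K 0 x"
proof -
  have "0 \<le> (x - 1/4) * (3/4 - x)" using assms by simp
  then have "3/16 \<le> x * (1 - x)" by (simp add: field_simps)
  then have "(3/16) ^ K \<le> (x * (1 - x)) ^ K" by (intro power_mono) auto
  then show ?thesis using bump_0[of x K] assms by simp
qed

text \<open>Each differentiation costs one factor: the derivative of R^(j+1) S is R^j (R S' + (j+1)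
  S R').\<close>

lemma power_dvd_iterated_pderiv:
  fixes R :: "real poly"
  assumes "l \<le> K"
  shows "R ^ (K - l) dvd (pderiv ^^ l) (R ^ K)"
  using assms
proof (induction l)
  case (Suc l)
  then obtain S where S: "(pderiv ^^ l) (R ^ K) = R ^ Suc (K - Suc l) * S"
    by (auto simp: dvd_def Suc_diff_Suc)
  have "pderiv (R ^ Suc j * S) = R ^ j * (R * pderiv S + S * smult (of_nat (Suc j)) (pderiv R))" for j
    by (simp add: pderiv_mult pderiv_power_Suc algebra_simps del: of_nat_Suc power_Suc) (simp add: algebra_simps)
  then show ?case by (simp add: S)
qed simp

lemma bump_poly_vanishes:
  assumes "l < K" "a = 0 \<or> a = 1"
  shows "poly ((pderiv ^^ l) (([:0, 1:] * [:1, -1:]) ^ K)) (a::real) = 0"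
proof -
  obtain S where S: "(pderiv ^^ l) (([:0, 1:] * [:1, -1:]) ^ K) = ([:0, 1:] * [:1, -1:]) ^ (K - l) * (S :: real poly)"
    using power_dvd_iterated_pderiv[of l K] assms(1) by (auto simp: dvd_def)
  show ?thesis unfolding S using assms by (auto simp: poly_power)
qed

text \<open>For the two points where the bump is glued to 0: there it is dominated by its
  polynomial, which vanishes together with its derivative.\<close>

lemma DERIV_0_dominated:
  fixes f g :: "real \<Rightarrow> real"
  assumes "(g has_real_derivative 0) (at a)" "f a = 0" "g a = 0" "\<And>x. \<bar>f x\<bar> \<le> \<bar>g x\<bar>"
  shows "(f has_real_derivative 0) (at a)"
proof -
  have "((\<lambda>h. g (a + h) / h) \<longlongrightarrow> 0) (at 0)" using assms by (simp add: DERIV_def)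
  then have "((\<lambda>h. \<bar>g (a + h) / h\<bar>) \<longlongrightarrow> 0) (at 0)" using tendsto_rabs_zero by blast
  then have "((\<lambda>h. f (a + h) / h) \<longlongrightarrow> 0) (at 0)"
    by (rule Lim_null_comparison[rotated]) (auto intro!: always_eventually divide_right_mono assms)
  then show ?thesis using assms by (simp add: DERIV_def)
qed

lemma bump_DERIV:
  assumes "Suc l < K"
  shows "(bump K l has_real_derivative bump K (Suc l) x) (at x)"
proof -
  define p :: "real poly" where "p = (pderiv ^^ l) (([:0, 1:] * [:1, -1:]) ^ K)"
  define f where "f = bump K l"
  have f: "f x = (if 0 < x \<and> x < 1 then poly p x else 0)" for x
    by (simp add: f_def bump_def p_def)
  have f': "bump K (Suc l) x = (if 0 < x \<and> x < 1 then poly (pderiv p) x else 0)" for x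
    by (simp add: bump_def p_def)
  consider "x < 0" | "x = 0" | "0 < x" "x < 1" | "x = 1" | "1 < x" by linarith
  then have "(f has_real_derivative bump K (Suc l) x) (at x)"
  proof cases
    case 1
    show ?thesis
      by (rule DERIV_cong_ev[THEN iffD1, of x x "\<lambda>_. 0" f 0])
        (use 1 in \<open>auto simp: f f' intro!: eventually_mono[OF eventually_nhds_in_open[of "{..<0}" x]]\<close>)
  next
    case 3
    show ?thesis
      by (rule DERIV_cong_ev[THEN iffD1, of x x "poly p" f "poly (pderiv p) x"])
        (use 3 in \<open>auto simp: f f' poly_DERIV intro!: eventually_mono[OF eventually_nhds_in_open[of "{0<..<1}" x]]\<close>)
  next
    case 5
    show ?thesis
      by (rule DERIV_cong_ev[THEN iffD1, of x x "\<lambda>_. 0" f 0])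
        (use 5 in \<open>auto simp: f f' intro!: eventually_mono[OF eventually_nhds_in_open[of "{1<..}" x]]\<close>)
  next
    case 2
    have "poly p x = 0" "poly (pderiv p) x = 0"
      using bump_poly_vanishes[of l K x] bump_poly_vanishes[of "Suc l" K x] assms 2 by (auto simp: p_def)
    then show ?thesis using poly_DERIV[of p x] 2
      by (auto simp: f f' intro!: DERIV_0_dominated[where g = "poly p"])
  next
    case 4
    have "poly p x = 0" "poly (pderiv p) x = 0"
      using bump_poly_vanishes[of l K x] bump_poly_vanishes[of "Suc l" K x] assms 4 by (auto simp: p_def)
    then show ?thesis using poly_DERIV[of p x] 4
      by (auto simp: f f' intro!: DERIV_0_dominated[where g = "poly p"])
  qed
  then show ?thesis by (simp add: f_def)
qed

lemma bump_continuous: "Suc l < K \<Longrightarrow> continuous_on UNIV (bump K l)"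
  by (meson DERIV_continuous_on bump_DERIV has_field_derivative_at_within)

lemma bump_measurable [measurable]: "bump K l \<in> borel_measurable borel"
proof -
  have [measurable]: "poly p \<in> borel_measurable borel" for p :: "real poly"
    by (intro borel_measurable_continuous_onI continuous_intros)
  show ?thesis unfolding bump_def by measurable
qed

lemma bump_bounded: "\<exists>C. \<forall>x. \<bar>bump K l x\<bar> \<le> C"
proof -
  define p :: "real poly" where "p = (pderiv ^^ l) (([:0, 1:] * [:1, -1:]) ^ K)"
  have "bounded (poly p ` {0..1::real})"
    by (intro compact_imp_bounded compact_continuous_image continuous_intros) auto
  then obtain C where C: "\<And>x. x \<in> {0..1} \<Longrightarrow> \<bar>poly p x\<bar> \<le> C"
    unfolding bounded_iff real_norm_def by (metis imageI)
  then have "0 \<le> C" by (rule order_trans[OF abs_ge_zero, of "poly p 0"]) simp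
  with C show ?thesis by (auto simp: bump_def p_def intro!: exI[of _ C])
qed

lemma bump_bounded_upto: "\<exists>C>0. \<forall>l\<le>k. \<forall>x. \<bar>bump K l x\<bar> \<le> C"
proof -
  obtain C where C: "\<And>l x. \<bar>bump K l x\<bar> \<le> C l" using bump_bounded[of K] by metis
  have C0: "0 \<le> C l" for l using C[of l 0] by linarith
  have "\<bar>bump K l x\<bar> \<le> 1 + sum C {..k}" if "l \<le> k" for l x
    using C[of l x] member_le_sum[of l "{..k}" C] C0 that by auto
  moreover have "0 < 1 + sum C {..k}" using sum_nonneg[of "{..k}" C] C0 by fastforce
  ultimately show ?thesis by blast
qed

text \<open>At distance at most 1, the mean value theorem and |x - y| <= |x - y|^beta suffice, as
  beta <= 1; at larger distance twice the supremum does. The mean value theorem uses the bound on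
  the next derivative, hence the two orders to spare.\<close>

lemma bump_holder_upto:
  assumes "0 < \<beta>" "\<beta> \<le> 1" "k + 2 \<le> K"
  shows "\<exists>C>0. \<forall>l\<le>k. (\<forall>x. \<bar>bump K l x\<bar> \<le> C) \<and>
           (\<forall>x y. \<bar>bump K l x - bump K l y\<bar> \<le> C * \<bar>x - y\<bar> powr \<beta>)"
proof -
  obtain C where C: "0 < C" "\<And>l x. l \<le> Suc k \<Longrightarrow> \<bar>bump K l x\<bar> \<le> C"
    using bump_bounded_upto[of "Suc k" K] by blast
  have "\<bar>bump K l x - bump K l y\<bar> \<le> 2 * C * \<bar>x - y\<bar> powr \<beta>" if l: "l \<le> k" for l x y
  proof (cases "\<bar>x - y\<bar> \<le> 1")
    case True
    have "\<bar>bump K l x - bump K l y\<bar> \<le> C * \<bar>x - y\<bar>"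
      using field_differentiable_bound[of UNIV "bump K l" "bump K (Suc l)" C x y]
        bump_DERIV[of l K] C(2)[of "Suc l"] l assms(3) by (auto intro: has_field_derivative_at_within)
    also have "\<bar>x - y\<bar> \<le> \<bar>x - y\<bar> powr \<beta>"
    proof (cases "x = y")
      case False
      then show ?thesis using powr_mono'[of \<beta> 1 "\<bar>x - y\<bar>"] True assms by auto
    qed simp
    finally show ?thesis using C(1) by (smt (verit) mult_left_mono mult_right_mono powr_ge_zero)
  next
    case False
    have "\<bar>bump K l x - bump K l y\<bar> \<le> 2 * C * 1"
      using C(2)[of l x] C(2)[of l y] l by linarith
    also have "1 \<le> \<bar>x - y\<bar> powr \<beta>" using False assms by (intro ge_one_powr_ge_zero) auto
    finally show ?thesis using C(1) by (auto simp: mult_left_mono)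
  qed
  moreover have "\<bar>bump K l x\<bar> \<le> 2 * C" if "l \<le> k" for l x
    using C(2)[of l x] that C(1) by linarith
  ultimately show ?thesis using C(1) by (intro exI[of _ "2 * C"]) auto
qed

text \<open>The polynomial has degree 2K, so its l-th derivative is not the zero polynomial, and
  finitely many roots cannot fill the unit interval.\<close>

lemma bump_nonzero:
  assumes "l \<le> K"
  shows "\<exists>t. 0 < t \<and> t < 1 \<and> bump K l t \<noteq> 0"
proof -
  have deg: "degree ((pderiv ^^ i) p) = degree p - i \<and> (i \<le> degree p \<longrightarrow> p \<noteq> 0 \<longrightarrow> (pderiv ^^ i) p \<noteq> 0)"
    for i and p :: "real poly"
  proof (induction i)
    case (Suc i)
    then show ?case by (auto simp: degree_pderiv pderiv_eq_0_iff)
  qed simp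
  define P :: "real poly" where "P = ([:0, 1:] * [:1, -1:]) ^ K"
  have "P \<noteq> 0" by (simp add: P_def)
  moreover have "l \<le> degree P" using assms by (simp add: P_def degree_power_eq)
  ultimately have "(pderiv ^^ l) P \<noteq> 0" using deg by blast
  then have "finite {x. poly ((pderiv ^^ l) P) x = 0}" by (rule poly_roots_finite)
  moreover have "infinite {0<..<1::real}" by simp
  ultimately have "\<not> {0<..<1} \<subseteq> {x. poly ((pderiv ^^ l) P) x = 0}" using finite_subset by blast
  then obtain t where "t \<in> {0<..<1}" "t \<notin> {x. poly ((pderiv ^^ l) P) x = 0}" by blast
  then have "0 < t" "t < 1" "poly ((pderiv ^^ l) P) t \<noteq> 0" by simp_all
  then show ?thesis unfolding bump_def P_def[symmetric] by auto
qed

section \<open>Polynomials acting by shifts\<close>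

text \<open>\<open>X\<close> acts as translation by \<open>\<tau>\<close>, so multiplication of
  polynomials becomes composition of difference operators. The telescoping can then be done in the
  polynomial ring.\<close>

definition shift_action :: "real \<Rightarrow> real poly \<Rightarrow> (real \<Rightarrow> real) \<Rightarrow> real \<Rightarrow> real" where
  "shift_action \<tau> P F x = (\<Sum>i\<le>degree P. coeff P i * F (x - \<tau> * real i))"

lemma shift_action_eq:
  assumes "\<And>i. M \<le> i \<Longrightarrow> coeff P i = 0"
  shows "shift_action \<tau> P F x = (\<Sum>i<M. coeff P i * F (x - \<tau> * real i))"
proof -
  have "shift_action \<tau> P F x = (\<Sum>i<max M (Suc (degree P)). coeff P i * F (x - \<tau> * real i))"
    unfolding shift_action_def by (rule sum.mono_neutral_left) (auto simp: coeff_eq_0)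
  also have "\<dots> = (\<Sum>i<M. coeff P i * F (x - \<tau> * real i))"
    by (rule sum.mono_neutral_right) (auto simp: assms)
  finally show ?thesis .
qed

lemma shift_action_0 [simp]: "shift_action \<tau> 0 F x = 0"
  by (simp add: shift_action_def)

lemma shift_action_add: "shift_action \<tau> (P + Q) F x = shift_action \<tau> P F x + shift_action \<tau> Q F x"
proof -
  define M where "M = Suc (max (degree P) (degree Q))"
  have "degree (P + Q) < M" "degree P < M" "degree Q < M"
    by (auto simp: M_def less_Suc_eq_le degree_add_le_max)
  then have "shift_action \<tau> R F x = (\<Sum>i<M. coeff R i * F (x - \<tau> * real i))"
    if "R \<in> {P + Q, P, Q}" for R
    using that by (intro shift_action_eq) (auto simp: coeff_eq_0 simp del: coeff_add)
  then show ?thesis by (simp add: sum.distrib distrib_right)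
qed

lemma shift_action_smult: "shift_action \<tau> (smult c P) F x = c * shift_action \<tau> P F x"
  by (subst (1 2) shift_action_eq[where M = "Suc (degree P)"])
    (auto simp: coeff_eq_0 sum_distrib_left algebra_simps)

lemma shift_action_pCons:
  "shift_action \<tau> (pCons a P) F x = a * F x + shift_action \<tau> P F (x - \<tau>)"
proof -
  have "shift_action \<tau> (pCons a P) F x
      = (\<Sum>i<Suc (Suc (degree P)). coeff (pCons a P) i * F (x - \<tau> * real i))"
    by (rule shift_action_eq) (auto simp: coeff_pCons coeff_eq_0 split: nat.splits)
  also have "\<dots> = a * F x + (\<Sum>i<Suc (degree P). coeff P i * F (x - \<tau> - \<tau> * real i))"
    by (subst sum.lessThan_Suc_shift) (simp add: algebra_simps del: sum.lessThan_Suc)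
  also have "\<dots> = a * F x + shift_action \<tau> P F (x - \<tau>)"
    by (subst shift_action_eq[where M = "Suc (degree P)"]) (auto simp: coeff_eq_0)
  finally show ?thesis .
qed

lemma shift_action_mult:
  "shift_action \<tau> (P * Q) F x = shift_action \<tau> P (shift_action \<tau> Q F) x"
  by (induction P arbitrary: x)
    (auto simp: shift_action_add shift_action_smult shift_action_pCons)

lemma shift_action_power_Suc:
  "shift_action \<tau> ([:1, -1:] ^ Suc k) F x
    = shift_action \<tau> ([:1, -1:] ^ k) (\<lambda>y. F y - F (y - \<tau>)) x"
proof -
  have "shift_action \<tau> [:1, -1:] F = (\<lambda>y. F y - F (y - \<tau>))"
    by (auto simp: shift_action_pCons)
  then show ?thesis
    by (simp only: power_Suc2 shift_action_mult)
qed

lemma shift_action_translate: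
  "shift_action \<tau> P (\<lambda>y. F (y + c)) x = shift_action \<tau> P F (x + c)"
  by (simp add: shift_action_def algebra_simps)

section \<open>Powers of the geometric polynomial: size, mass and telescoping\<close>

definition geom_poly :: "nat \<Rightarrow> real poly" where
  "geom_poly N = (\<Sum>l<N. monom 1 l)"

lemma coeff_geom_poly: "coeff (geom_poly N) i = (if i < N then 1 else 0)"
  by (simp add: geom_poly_def coeff_sum)

lemma poly_geom_poly_1: "poly (geom_poly N) 1 = real N"
  by (simp add: geom_poly_def poly_sum poly_monom)

lemma degree_geom_poly_less: "N \<ge> 1 \<Longrightarrow> degree (geom_poly N) \<le> N - 1"
  by (rule degree_le) (auto simp: coeff_geom_poly)

lemma geom_poly_telescope: "[:1, -1:] * geom_poly N = 1 - monom 1 N"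
proof (induction N)
  case (Suc N)
  have "[:1, -1:] * geom_poly (Suc N) = [:1, -1:] * geom_poly N + [:1, -1:] * monom 1 N"
    unfolding geom_poly_def by (simp add: distrib_left del: mult_pCons_left)
  also have "[:1, -1:] * monom 1 N = monom (1::real) N - monom 1 (Suc N)"
    by (simp add: monom_Suc)
  finally show ?case using Suc by simp
qed (simp add: geom_poly_def)

text \<open>A coefficient of the next power is a sum of at most \<open>N\<close> coefficients of the
  previous one. Division by \<open>N ^ k\<close> therefore brings all weights into [0, 1].\<close>

lemma coeff_geom_power: "0 \<le> coeff (geom_poly N ^ Suc k) i \<and> coeff (geom_poly N ^ Suc k) i \<le> real N ^ k"
proof (induction k arbitrary: i)
  case (Suc k)
  define p where "p = geom_poly N ^ Suc k"
  have "geom_poly N ^ Suc (Suc k) = (\<Sum>l<N. monom 1 l * p)"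
    unfolding p_def by (subst power_Suc) (simp add: geom_poly_def sum_distrib_right)
  then have c: "coeff (geom_poly N ^ Suc (Suc k)) i = (\<Sum>l<N. if l \<le> i then coeff p (i - l) else 0)"
    by (simp only: coeff_sum coeff_monom_mult)
      (auto intro!: sum.cong)
  have "0 \<le> (\<Sum>l<N. if l \<le> i then coeff p (i - l) else 0)"
    using Suc by (intro sum_nonneg) (auto simp: p_def)
  moreover have "(\<Sum>l<N. if l \<le> i then coeff p (i - l) else 0) \<le> (\<Sum>l<N. real N ^ k)"
    using Suc by (intro sum_mono) (auto simp: p_def)
  ultimately show ?case unfolding c by simp
qed (simp add: coeff_geom_poly)

lemma coeff_geom_power_eq_0:
  assumes "N \<ge> 1" "Suc k * N \<le> i"
  shows "coeff (geom_poly N ^ Suc k) i = 0"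
proof (rule coeff_eq_0)
  have "degree (geom_poly N ^ Suc k) \<le> (N - 1) * Suc k"
    using degree_power_le[of "geom_poly N" "Suc k"] degree_geom_poly_less[OF assms(1)]
    by (meson mult_le_mono1 order_trans)
  also have "\<dots> < Suc k * N" using assms(1) by (cases N) auto
  finally show "degree (geom_poly N ^ Suc k) < i" using assms(2) by simp
qed

lemma sum_coeff_geom_power:
  assumes "N \<ge> 1"
  shows "(\<Sum>i<Suc k * N. coeff (geom_poly N ^ Suc k) i) = real N ^ Suc k"
proof -
  \<comment> \<open>A shift by 0 acting on the constant 1 evaluates the polynomial at 1.\<close>
  have "(\<Sum>i<Suc k * N. coeff (geom_poly N ^ Suc k) i) = shift_action 0 (geom_poly N ^ Suc k) (\<lambda>_. 1) 0"
    by (subst shift_action_eq[where M = "Suc k * N"], erule coeff_geom_power_eq_0[OF assms]) (simp only: mult_1_right)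
  also have "\<dots> = poly (geom_poly N ^ Suc k) 1" by (simp add: shift_action_def poly_altdef)
  finally show ?thesis by (simp only: poly_power poly_geom_poly_1)
qed

text \<open>The m differences consume m of the m + 1 factors. The surviving one spreads each
  coefficient of (1 - X^N)^m over a block of N equal ones.\<close>

lemma diff_geom_poly: "[:1, -1:] ^ m * geom_poly N ^ Suc m = (1 - monom 1 N) ^ m * geom_poly N"
  by (simp only: power_Suc2 geom_poly_telescope[symmetric] power_mult_distrib mult.assoc)

text \<open>Multiplication by 1 - X^N subtracts a copy shifted by N, so the bound at most doubles
  each time. It does not depend on N: this is the whole gain of the comb.\<close>

lemma coeff_diff_geom_poly: "\<bar>coeff ([:1, -1:] ^ m * geom_poly N ^ Suc m) i\<bar> \<le> 2 ^ m"
  unfolding diff_geom_poly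
proof (induction m arbitrary: i)
  case (Suc m)
  define p where "p = (1 - monom 1 N) ^ m * geom_poly N"
  have "(1 - monom 1 N) ^ Suc m * geom_poly N = p - monom 1 N * p"
    by (simp add: p_def algebra_simps)
  then have "\<bar>coeff ((1 - monom 1 N) ^ Suc m * geom_poly N) i\<bar>
      \<le> \<bar>coeff p i\<bar> + (if N \<le> i then \<bar>coeff p (i - N)\<bar> else 0)"
    by (auto simp: coeff_monom_mult)
  also have "\<dots> \<le> 2 ^ m + 2 ^ m" using Suc by (intro add_mono) (auto simp: p_def)
  finally show ?case by simp
qed (simp add: coeff_geom_poly)

lemma coeff_diff_geom_poly_eq_0:
  assumes "N \<ge> 1" "Suc m * N \<le> i"
  shows "coeff ([:1, -1:] ^ m * geom_poly N ^ Suc m) i = 0"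
  unfolding diff_geom_poly
proof (rule coeff_eq_0)
  have "degree (1 - monom 1 N :: real poly) \<le> N"
    by (intro degree_diff_le) (auto simp: degree_monom_eq)
  then have "degree ((1 - monom 1 N :: real poly) ^ m) \<le> N * m"
    by (meson degree_power_le mult_le_mono1 order_trans)
  then have "degree ((1 - monom 1 N) ^ m * geom_poly N) \<le> N * m + (N - 1)"
    using degree_geom_poly_less[OF assms(1)] degree_mult_le by (meson add_mono order_trans)
  also have "\<dots> < Suc m * N" using assms(1) by (simp add: algebra_simps)
  finally show "degree ((1 - monom 1 N) ^ m * geom_poly N) < i" using assms(2) by simp
qed

section \<open>The error distribution and convolution with it\<close>

lemma convolution_density_left:
  fixes G :: "real measure"
  assumes "finite_measure G" and [measurable_cong]: "sets G = sets borel"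
    and [measurable]: "f \<in> borel_measurable borel"
    and "finite_measure (density lborel f)"
  shows "convolution (density lborel f) G = density lborel (\<lambda>y. \<integral>\<^sup>+t. f (y - t) \<partial>G)"
proof (rule measure_eqI)
  interpret G: finite_measure G by fact
  interpret D: finite_measure "density lborel f" by fact
  interpret P: pair_sigma_finite G lborel
    by (simp add: G.sigma_finite_measure_axioms lborel.sigma_finite_measure_axioms pair_sigma_finite_def)
  fix A assume "A \<in> sets (convolution (density lborel f) G)"
  then have [measurable]: "A \<in> sets borel" by simp
  have "emeasure (convolution (density lborel f) G) A
      = (\<integral>\<^sup>+x. \<integral>\<^sup>+y. indicator A (x + y) \<partial>G \<partial>density lborel f)"
    by (subst convolution_emeasure'[OF _ D.finite_measure_axioms G.finite_measure_axioms]) (auto simp: assms)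
  also have "\<dots> = (\<integral>\<^sup>+x. f x * (\<integral>\<^sup>+t. indicator A (x + t) \<partial>G) \<partial>lborel)"
    by (subst nn_integral_density) auto
  also have "\<dots> = (\<integral>\<^sup>+x. \<integral>\<^sup>+t. f x * indicator A (x + t) \<partial>G \<partial>lborel)"
    by (subst nn_integral_cmult) auto
  also have "\<dots> = (\<integral>\<^sup>+t. \<integral>\<^sup>+x. f x * indicator A (x + t) \<partial>lborel \<partial>G)"
    by (rule P.Fubini') measurable
  also have "\<dots> = (\<integral>\<^sup>+t. \<integral>\<^sup>+y. f (y - t) * indicator A y \<partial>lborel \<partial>G)"
  proof (rule nn_integral_cong)
    fix t
    show "(\<integral>\<^sup>+x. f x * indicator A (x + t) \<partial>lborel) = (\<integral>\<^sup>+y. f (y - t) * indicator A y \<partial>lborel)"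
      using nn_integral_real_affine[of "\<lambda>y. f (y - t) * indicator A y" 1 t]
      by (simp add: algebra_simps)
  qed
  also have "\<dots> = (\<integral>\<^sup>+y. \<integral>\<^sup>+t. f (y - t) * indicator A y \<partial>G \<partial>lborel)"
    by (rule P.Fubini'[symmetric]) measurable
  also have "\<dots> = (\<integral>\<^sup>+y. (\<integral>\<^sup>+t. f (y - t) \<partial>G) * indicator A y \<partial>lborel)"
    by (subst nn_integral_multc) auto
  also have "\<dots> = emeasure (density lborel (\<lambda>y. \<integral>\<^sup>+t. f (y - t) \<partial>G)) A"
    by (subst emeasure_density) auto
  finally show "emeasure (convolution (density lborel f) G) A
      = emeasure (density lborel (\<lambda>y. \<integral>\<^sup>+t. f (y - t) \<partial>G)) A" .
qed simp

definition symmetric_uniform :: "real \<Rightarrow> real measure" where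
  "symmetric_uniform \<theta> = density lborel (\<lambda>x. ennreal (indicator {-\<theta>..\<theta>} x / (2 * \<theta>)))"

lemma real_distribution_symmetric_uniform:
  assumes "\<theta> > 0"
  shows "real_distribution (symmetric_uniform \<theta>)"
proof -
  have "emeasure (symmetric_uniform \<theta>) UNIV = (\<integral>\<^sup>+x. ennreal (1 / (2 * \<theta>)) * indicator {-\<theta>..\<theta>} x \<partial>lborel)"
    unfolding symmetric_uniform_def
    by (subst emeasure_density) (auto intro!: nn_integral_cong split: split_indicator)
  also have "\<dots> = 1"
    using assms by (simp add: nn_integral_cmult_indicator flip: ennreal_mult)
  finally have "prob_space (symmetric_uniform \<theta>)"
    by (intro prob_spaceI) (simp add: symmetric_uniform_def)
  then show ?thesis
    by (simp add: real_distribution_def real_distribution_axioms_def symmetric_uniform_def)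
qed

text \<open>The fundamental theorem of calculus: averaging a derivative gives a difference quotient
  with step 2 theta. Values in a Euclidean space cover both the complex exponentials of the
  characteristic function and the real functions that are convolved.\<close>

lemma integral_symmetric_uniform:
  fixes F :: "real \<Rightarrow> 'b :: euclidean_space"
  assumes "\<theta> > 0" and F: "\<And>x. (F has_vector_derivative f x) (at x)" and "continuous_on UNIV f"
  shows "(\<integral>x. f x \<partial>symmetric_uniform \<theta>) = (1 / (2 * \<theta>)) *\<^sub>R (F \<theta> - F (-\<theta>))"
proof -
  have [measurable]: "f \<in> borel_measurable borel"
    by (intro borel_measurable_continuous_onI assms)
  have "(\<integral>x. f x \<partial>symmetric_uniform \<theta>)
      = (\<integral>x. (indicator {-\<theta>..\<theta>} x / (2 * \<theta>)) *\<^sub>R f x \<partial>lborel)"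
    unfolding symmetric_uniform_def using assms(1) by (intro integral_density) auto
  also have "\<dots> = (1 / (2 * \<theta>)) *\<^sub>R (\<integral>x. indicator {-\<theta>..\<theta>} x *\<^sub>R f x \<partial>lborel)"
    by (subst integral_scaleR_right[symmetric]) (simp add: field_simps)
  also have "(\<integral>x. indicator {-\<theta>..\<theta>} x *\<^sub>R f x \<partial>lborel) = F \<theta> - F (-\<theta>)"
    using assms by (intro integral_FTC_Icc) (auto intro: has_vector_derivative_at_within continuous_on_subset)
  finally show ?thesis .
qed

lemma char_symmetric_uniform:
  assumes "\<theta> > 0"
  shows "char (symmetric_uniform \<theta>) \<omega> = complex_of_real (sinc (\<theta> * \<omega>))"
proof (cases "\<omega> = 0")
  case True
  interpret real_distribution "symmetric_uniform \<theta>"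
    by (rule real_distribution_symmetric_uniform[OF assms])
  show ?thesis using True char_zero by simp
next
  case False
  have [simp]: "- (\<i> * (z * \<i>)) = z" for z by (simp add: complex_eq_iff)
  have "char (symmetric_uniform \<theta>) \<omega>
      = (1 / (2 * \<theta>)) *\<^sub>R (iexp (\<omega> * \<theta>) / (\<i> * \<omega>) - iexp (\<omega> * - \<theta>) / (\<i> * \<omega>))"
    unfolding char_def
    by (rule integral_symmetric_uniform[OF assms])
      (use False in \<open>auto intro!: continuous_intros derivative_eq_intros has_vector_derivative_real_field\<close>)
  also have "\<dots> = complex_of_real (sinc (\<theta> * \<omega>))"
    using False assms
    by (auto simp: complex_eq_iff Re_divide Im_divide Re_exp Im_exp scaleR_conv_of_real field_simps power2_eq_square)
  finally show ?thesis .
qed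

lemma real_distribution_convolution:
  assumes "real_distribution M" "real_distribution N"
  shows "real_distribution (convolution M N)"
proof -
  interpret M: real_distribution M by fact
  interpret N: real_distribution N by fact
  interpret P: pair_prob_space M N ..
  have "prob_space (convolution M N)"
    unfolding convolution_def by (intro P.prob_space_distr) measurable
  then show ?thesis by (simp add: real_distribution_def real_distribution_axioms_def)
qed

lemma integral_convolution:
  fixes F :: "real \<Rightarrow> 'b :: {banach, second_countable_topology}"
  assumes "real_distribution M" "real_distribution N"
    and [measurable]: "F \<in> borel_measurable borel" and "\<And>x. norm (F x) \<le> C"
  shows "(\<integral>z. F z \<partial>convolution M N) = (\<integral>x. \<integral>y. F (x + y) \<partial>N \<partial>M)"
proof -
  interpret M: real_distribution M by fact
  interpret N: real_distribution N by fact
  interpret P: pair_prob_space M N ..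
  have "integrable (M \<Otimes>\<^sub>M N) (\<lambda>z. F (fst z + snd z))"
    by (rule P.integrable_const_bound[of _ C]) (auto simp: assms)
  then have "(\<integral>x. \<integral>y. F (x + y) \<partial>N \<partial>M) = (\<integral>z. F (fst z + snd z) \<partial>(M \<Otimes>\<^sub>M N))"
    by (subst P.integral_fst'[symmetric]) auto
  also have "\<dots> = (\<integral>z. F z \<partial>convolution M N)"
    unfolding convolution_def by (subst integral_distr) (auto simp: case_prod_beta)
  finally show ?thesis by simp
qed

lemma char_convolution:
  assumes "real_distribution M" "real_distribution N"
  shows "char (convolution M N) t = char M t * char N t"
  unfolding char_def
  by (subst integral_convolution[OF assms, where C = 1])
    (auto simp: algebra_simps exp_add)

text \<open>\<open>G\<close> is known only through its characteristic function. Given a law for the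
  next lower power, Levy's uniqueness theorem factors \<open>G\<close> as the convolution of that
  law with one uniform law.\<close>

lemma sinc_power_distribution_exists:
  assumes "\<theta> > 0"
  shows "\<exists>G. real_distribution G \<and> (\<forall>\<omega>. char G \<omega> = complex_of_real (sinc (\<theta> * \<omega>) ^ m))"
proof (induction m)
  case 0
  have "prob_space (return borel (0::real))" by (rule prob_space_return) simp
  then have "real_distribution (return borel 0)"
    by (simp add: real_distribution_def real_distribution_axioms_def)
  moreover have "char (return borel 0) \<omega> = 1" for \<omega>
    unfolding char_def by (subst integral_return) auto
  ultimately show ?case by auto
next
  case (Suc m)
  then obtain G where G: "real_distribution G" "\<And>\<omega>. char G \<omega> = complex_of_real (sinc (\<theta> * \<omega>) ^ m)"
    by blast
  note U = real_distribution_symmetric_uniform[OF assms]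
  show ?case
    by (rule exI[of _ "convolution G (symmetric_uniform \<theta>)"])
      (simp add: real_distribution_convolution[OF G(1) U] char_convolution[OF G(1) U] G(2)
        char_symmetric_uniform[OF assms] mult.commute)
qed

text \<open>Induction on \<open>m\<close>: each uniform factor turns one derivative into a symmetric
  difference quotient. A symmetric difference is a backward difference read theta further to the
  right, and these translations add up to m theta. All lower derivatives are carried along because
  the induction hypothesis is applied to the difference quotients of each of them.\<close>

lemma sinc_power_convolution_derivative:
  fixes F :: "nat \<Rightarrow> real \<Rightarrow> real"
  assumes "\<theta> > 0" "real_distribution G"
    and "\<And>\<omega>. char G \<omega> = complex_of_real (sinc (\<theta> * \<omega>) ^ m)"
    and "\<And>l x. l < m \<Longrightarrow> (F l has_real_derivative F (Suc l) x) (at x)"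
    and "\<And>l. l \<le> m \<Longrightarrow> continuous_on UNIV (F l)"
    and "\<And>l x. l \<le> m \<Longrightarrow> \<bar>F l x\<bar> \<le> C"
  shows "(\<integral>t. F m (y - t) \<partial>G)
    = shift_action (2 * \<theta>) ([:1, -1:] ^ m) (F 0) (y + real m * \<theta>) / (2 * \<theta>) ^ m"
  using assms(2-)
proof (induction m arbitrary: G F y C)
  case 0
  have R: "real_distribution (return borel (0::real))"
    by (simp add: real_distribution_def real_distribution_axioms_def prob_space_return)
  have "char (return borel 0) \<omega> = 1" for \<omega>
    unfolding char_def by (subst integral_return) auto
  then have "G = return borel 0"
    using 0 R by (intro Levy_uniqueness) auto
  moreover have [measurable]: "F 0 \<in> borel_measurable borel"
    using 0 by (intro borel_measurable_continuous_onI) auto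
  ultimately have "(\<integral>t. F 0 (y - t) \<partial>G) = F 0 y"
    by (simp add: integral_return)
  then show ?case by (simp add: shift_action_def)
next
  case (Suc m)
  define U where "U = symmetric_uniform \<theta>"
  note U = real_distribution_symmetric_uniform[OF \<open>\<theta> > 0\<close>, folded U_def]
  obtain G' where G': "real_distribution G'" "\<And>\<omega>. char G' \<omega> = complex_of_real (sinc (\<theta> * \<omega>) ^ m)"
    using sinc_power_distribution_exists[OF \<open>\<theta> > 0\<close>] by blast
  have G: "G = convolution G' U"
  proof (rule Levy_uniqueness[OF Suc.prems(1) real_distribution_convolution[OF G'(1) U]], rule ext)
    fix \<omega> show "char G \<omega> = char (convolution G' U) \<omega>"
      unfolding char_convolution[OF G'(1) U] unfolding U_def char_symmetric_uniform[OF \<open>\<theta> > 0\<close>] G'(2) Suc.prems(2)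
      by (simp add: mult.commute)
  qed
  have [measurable]: "F l \<in> borel_measurable borel" if "l \<le> Suc m" for l
    using Suc.prems(4) that by (intro borel_measurable_continuous_onI) auto
  define F' where "F' l x = (F l (x + \<theta>) - F l (x - \<theta>)) / (2 * \<theta>)" for l x
  have cont: "continuous_on UNIV (\<lambda>x. F l (g x))" if "l \<le> Suc m" "continuous_on UNIV g" for l g
    using Suc.prems(4)[OF that(1)] that(2) continuous_on_compose2 by blast
  have "(\<integral>t. F (Suc m) (y - t) \<partial>G) = (\<integral>x. \<integral>u. F (Suc m) (y - (x + u)) \<partial>U \<partial>G')"
    unfolding G by (rule integral_convolution[OF G'(1) U, where C = C]) (use Suc.prems(5) in auto)
  also have "\<dots> = (\<integral>x. F' m (y - x) \<partial>G')"
  proof (rule Bochner_Integration.integral_cong[OF refl])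
    fix x
    have "(\<integral>u. F (Suc m) (y - (x + u)) \<partial>U)
        = (1 / (2 * \<theta>)) *\<^sub>R ((- F m (y - (x + \<theta>))) - (- F m (y - (x + - \<theta>))))"
      unfolding U_def
    proof (rule integral_symmetric_uniform[OF \<open>\<theta> > 0\<close>])
      fix u
      have "(F m has_real_derivative F (Suc m) (y - (x + u))) (at (y - (x + u)))"
        using Suc.prems(3)[of m] by simp
      then have "((\<lambda>u. F m (y - (x + u))) has_real_derivative F (Suc m) (y - (x + u)) * (-1)) (at u)"
        by (rule DERIV_chain2) (auto intro!: derivative_eq_intros)
      then have "((\<lambda>u. - F m (y - (x + u))) has_real_derivative F (Suc m) (y - (x + u))) (at u)"
        using DERIV_minus by fastforce
      then show "((\<lambda>u. - F m (y - (x + u))) has_vector_derivative F (Suc m) (y - (x + u))) (at u)"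
        by (rule has_real_derivative_iff_has_vector_derivative[THEN iffD1])
    qed (intro cont continuous_intros, simp)
    then show "(\<integral>u. F (Suc m) (y - (x + u)) \<partial>U) = F' m (y - x)"
      by (simp add: F'_def diff_divide_distrib algebra_simps)
  qed
  also have "\<dots> = shift_action (2 * \<theta>) ([:1, -1:] ^ m) (F' 0) (y + real m * \<theta>) / (2 * \<theta>) ^ m"
  proof (rule Suc.IH[OF G', where C = "2 * C / (2 * \<theta>)"])
    fix l x assume "l < m"
    then have D: "(F l has_real_derivative F (Suc l) z) (at z)" for z using Suc.prems(3) by simp
    show "(F' l has_real_derivative F' (Suc l) x) (at x)"
      unfolding F'_def using \<open>\<theta> > 0\<close>
      by (auto intro!: derivative_eq_intros DERIV_chain2[OF D]) (simp add: field_simps)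
  next
    fix l assume "l \<le> m"
    then show "continuous_on UNIV (F' l)"
      unfolding F'_def using \<open>\<theta> > 0\<close> by (intro continuous_intros cont) auto
  next
    fix l x assume "l \<le> m"
    then have "\<bar>F l (x + \<theta>)\<bar> \<le> C" "\<bar>F l (x - \<theta>)\<bar> \<le> C" using Suc.prems(5) by auto
    then have "\<bar>F l (x + \<theta>) - F l (x - \<theta>)\<bar> \<le> 2 * C" by linarith
    then have "\<bar>F l (x + \<theta>) - F l (x - \<theta>)\<bar> / (2 * \<theta>) \<le> 2 * C / (2 * \<theta>)"
      using \<open>\<theta> > 0\<close> by (intro divide_right_mono) auto
    then show "\<bar>F' l x\<bar> \<le> 2 * C / (2 * \<theta>)"
      unfolding F'_def abs_divide using \<open>\<theta> > 0\<close> by simp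
  qed
  \<comment> \<open>The quotient becomes a constant polynomial acting on a backward difference at
    the translated point, so that the new difference can be absorbed into the operator.\<close>
  also have "F' 0 = (\<lambda>x. (\<lambda>z. shift_action (2 * \<theta>) [:1 / (2 * \<theta>):] (\<lambda>z. F 0 z - F 0 (z - 2 * \<theta>)) z) (x + \<theta>))"
    by (auto simp: F'_def shift_action_pCons algebra_simps diff_divide_distrib)
  also have "shift_action (2 * \<theta>) ([:1, -1:] ^ m) \<dots> (y + real m * \<theta>)
      = shift_action (2 * \<theta>) ([:1, -1:] ^ Suc m) (F 0) (y + real (Suc m) * \<theta>) / (2 * \<theta>)"
    unfolding shift_action_translate
    by (subst shift_action_power_Suc, subst shift_action_mult[symmetric])
      (simp add: shift_action_smult algebra_simps)
  finally show ?case by (simp add: field_simps del: power_Suc) (simp add: field_simps)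
qed

section \<open>Two-point lower bounds\<close>

text \<open>The second moment of q/p is 1 plus the chi-square distance. The latter sees only points
  where q differs from p; there p is at least kappa, so it is at most the squared L2 distance
  divided by kappa.\<close>

lemma likelihood_ratio_second_moment:
  fixes p q :: "real \<Rightarrow> real"
  assumes [measurable]: "p \<in> borel_measurable borel" "q \<in> borel_measurable borel"
    and nonneg: "\<And>y. 0 \<le> p y" "\<And>y. 0 \<le> q y"
    and int: "(\<integral>\<^sup>+y. p y \<partial>lborel) = 1" "(\<integral>\<^sup>+y. q y \<partial>lborel) = 1"
    and "\<kappa> > 0" "\<eta> \<ge> 0" and lower: "AE y in lborel. q y = p y \<or> \<kappa> \<le> p y"
    and chi: "(\<integral>\<^sup>+y. ennreal ((q y - p y)\<^sup>2) \<partial>lborel) \<le> ennreal (\<kappa> * \<eta>)"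
  shows "density lborel q = density (density lborel p) (\<lambda>y. ennreal (q y / p y))"
    and "(\<integral>\<^sup>+y. (ennreal (q y / p y))\<^sup>2 \<partial>density lborel p) \<le> ennreal (1 + \<eta>)"
proof -
  have "density (density lborel p) (\<lambda>y. ennreal (q y / p y))
      = density lborel (\<lambda>y. ennreal (p y) * ennreal (q y / p y))"
    by (subst density_density_eq) auto
  also have "\<dots> = density lborel q"
  proof (rule density_cong)
    show "AE y in lborel. ennreal (p y) * ennreal (q y / p y) = ennreal (q y)"
      using lower
    proof eventually_elim
      case (elim y)
      then show ?case using \<open>\<kappa> > 0\<close> nonneg by (auto simp flip: ennreal_mult)
    qed
  qed auto
  finally show "density lborel q = density (density lborel p) (\<lambda>y. ennreal (q y / p y))" ..
  \<comment> \<open>The identity p (q/p)^2 + p = 2 q + (q - p)^2 / p keeps p on the left, since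
    cancelling a finite summand at the end is safer in \<open>ennreal\<close> than subtracting 2 q.
    Where p is 0, the lower bound forces q = 0, and q/p is 0 by convention.\<close>
  have "(\<integral>\<^sup>+y. (ennreal (q y / p y))\<^sup>2 \<partial>density lborel p) + 1
      = (\<integral>\<^sup>+y. ennreal (p y) * (ennreal (q y / p y))\<^sup>2 \<partial>lborel) + (\<integral>\<^sup>+y. p y \<partial>lborel)"
    by (subst nn_integral_density) (auto simp: int)
  also have "\<dots> = (\<integral>\<^sup>+y. ennreal (p y) * (ennreal (q y / p y))\<^sup>2 + ennreal (p y) \<partial>lborel)"
    by (rule nn_integral_add[symmetric]) auto
  also have "\<dots> \<le> (\<integral>\<^sup>+y. 2 * ennreal (q y) + ennreal (1 / \<kappa>) * ennreal ((q y - p y)\<^sup>2) \<partial>lborel)"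
  proof (rule nn_integral_mono_AE, use lower in eventually_elim)
    case (elim y)
    have "p y * (q y / p y)\<^sup>2 + p y \<le> 2 * q y + 1 / \<kappa> * (q y - p y)\<^sup>2"
    proof (cases "p y = 0")
      case True
      then show ?thesis using elim \<open>\<kappa> > 0\<close> by auto
    next
      case False
      then have p: "p y > 0" using nonneg(1)[of y] by simp
      then have "p y * (q y / p y)\<^sup>2 + p y = 2 * q y + 1 / p y * (q y - p y)\<^sup>2"
        by (simp add: power2_eq_square field_simps)
      also have "1 / p y * (q y - p y)\<^sup>2 \<le> 1 / \<kappa> * (q y - p y)\<^sup>2"
        using elim p \<open>\<kappa> > 0\<close>
        by (cases "q y = p y") (auto intro!: mult_right_mono divide_left_mono)
      finally show ?thesis by simp
    qed
    then have "ennreal (p y * (q y / p y)\<^sup>2 + p y) \<le> ennreal (2 * q y + 1 / \<kappa> * (q y - p y)\<^sup>2)"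
      by (rule ennreal_leI)
    also have "ennreal (2 * q y + 1 / \<kappa> * (q y - p y)\<^sup>2)
        = 2 * ennreal (q y) + ennreal (1 / \<kappa>) * ennreal ((q y - p y)\<^sup>2)"
      using nonneg \<open>\<kappa> > 0\<close> ennreal_mult[of "1 / \<kappa>" "(q y - p y)\<^sup>2"] ennreal_mult[of 2 "q y"]
      by (subst ennreal_plus) auto
    also have "ennreal (p y * (q y / p y)\<^sup>2 + p y) = ennreal (p y) * (ennreal (q y / p y))\<^sup>2 + ennreal (p y)"
      using nonneg by (simp add: ennreal_plus ennreal_mult' ennreal_power)
    finally show ?case .
  qed
  also have "\<dots> = 2 + ennreal (1 / \<kappa>) * (\<integral>\<^sup>+y. ennreal ((q y - p y)\<^sup>2) \<partial>lborel)"
    by (simp add: nn_integral_add nn_integral_cmult int)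
  also have "\<dots> \<le> 2 + ennreal (1 / \<kappa>) * ennreal (\<kappa> * \<eta>)"
    by (intro add_left_mono mult_left_mono chi) simp
  also have "\<dots> = ennreal (1 + \<eta>) + 1"
  proof -
    have "ennreal (1 / \<kappa>) * ennreal (\<kappa> * \<eta>) = ennreal \<eta>"
      using assms by (simp flip: ennreal_mult)
    moreover have "ennreal (1 + \<eta>) = 1 + ennreal \<eta>" using assms by (simp add: ennreal_plus)
    ultimately show ?thesis by (simp add: one_add_one[symmetric] ac_simps del: one_add_one)
  qed
  finally show "(\<integral>\<^sup>+y. (ennreal (q y / p y))\<^sup>2 \<partial>density lborel p) \<le> ennreal (1 + \<eta>)"
    by (subst (asm) (1 2) add.commute) (simp add: ennreal_add_left_cancel_le)
qed

section \<open>Le Cam's two-point bound for product measures\<close>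

lemma PiM_density:
  assumes "finite I" "prob_space M" "prob_space (density M L)" and [measurable]: "L \<in> borel_measurable M"
  shows "PiM I (\<lambda>_. density M L) = density (PiM I (\<lambda>_. M)) (\<lambda>y. \<Prod>i\<in>I. L (y i))"
proof -
  interpret M: prob_space M by fact
  interpret D: prob_space "density M L" by fact
  interpret PM: product_sigma_finite "\<lambda>_. M" ..
  interpret PD: product_sigma_finite "\<lambda>_. density M L" ..
  show ?thesis
  proof (rule PD.PiM_eqI[OF \<open>finite I\<close>, symmetric])
    show "sets (density (PiM I (\<lambda>_. M)) (\<lambda>y. \<Prod>i\<in>I. L (y i))) = sets (PiM I (\<lambda>_. density M L))"
      by (simp cong: sets_PiM_cong)
    fix A assume "\<And>i. i \<in> I \<Longrightarrow> A i \<in> sets (density M L)"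
    then have A [measurable]: "\<And>i. i \<in> I \<Longrightarrow> A i \<in> sets M" by simp
    have "emeasure (density (PiM I (\<lambda>_. M)) (\<lambda>y. \<Prod>i\<in>I. L (y i))) (PiE I A)
        = (\<integral>\<^sup>+y. (\<Prod>i\<in>I. L (y i)) * indicator (PiE I A) y \<partial>PiM I (\<lambda>_. M))"
      using \<open>finite I\<close> by (intro emeasure_density) (auto intro!: sets_PiM_I_finite)
    also have "\<dots> = (\<integral>\<^sup>+y. (\<Prod>i\<in>I. L (y i) * indicator (A i) (y i)) \<partial>PiM I (\<lambda>_. M))"
    proof (rule nn_integral_cong)
      fix y assume "y \<in> space (PiM I (\<lambda>_. M))"
      then have "(\<Prod>i\<in>I. indicator (A i) (y i)) = (indicator (PiE I A) y :: ennreal)"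
        using \<open>finite I\<close> by (auto simp: space_PiM indicator_def PiE_iff prod_zero_iff)
      then show "(\<Prod>i\<in>I. L (y i)) * indicator (PiE I A) y = (\<Prod>i\<in>I. L (y i) * indicator (A i) (y i))"
        by (simp add: prod.distrib)
    qed
    also have "\<dots> = (\<Prod>i\<in>I. \<integral>\<^sup>+x. L x * indicator (A i) x \<partial>M)"
      using \<open>finite I\<close> by (intro PM.product_nn_integral_prod) auto
    also have "\<dots> = (\<Prod>i\<in>I. emeasure (density M L) (A i))"
      by (intro prod.cong) (auto simp: emeasure_density)
    finally show "emeasure (density (PiM I (\<lambda>_. M)) (\<lambda>y. \<Prod>i\<in>I. L (y i))) (PiE I A)
        = (\<Prod>i\<in>I. emeasure (density M L) (A i))" .
  qed
qed

text \<open>Uses \<open>min 1 l \<ge> l - l\<^sup>2 / 4\<close>: the second moment of the likelihood ratio bounds the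
  affinity of the two measures from below.\<close>

lemma two_point_lower_bound:
  assumes "prob_space (density P L)" and [measurable]: "L \<in> borel_measurable P"
    "a \<in> borel_measurable P" "b \<in> borel_measurable P"
    and L2: "(\<integral>\<^sup>+y. (L y)\<^sup>2 \<partial>P) \<le> 2" and c: "\<And>y. y \<in> space P \<Longrightarrow> c \<le> a y + b y"
  shows "c / 2 \<le> (\<integral>\<^sup>+y. a y \<partial>P) + (\<integral>\<^sup>+y. b y \<partial>density P L)"
proof -
  interpret Q: prob_space "density P L" by fact
  have min: "l \<le> min 1 l + l\<^sup>2 / 4" for l :: ennreal
  proof (cases l)
    case (real r)
    have "r \<le> min 1 r + r\<^sup>2 / 4"
      using zero_le_power2[of "r / 2 - 1"] by (auto simp: min_def power2_eq_square field_simps)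
    then have "ennreal r \<le> ennreal (min 1 r + r\<^sup>2 / 4)" by (rule ennreal_leI)
    also have "\<dots> = min 1 l + l\<^sup>2 / 4"
      using real by (auto simp: ennreal_plus ennreal_power divide_ennreal min_def simp flip: ennreal_numeral)
    finally show ?thesis using real by simp
  qed (simp add: ennreal_top_divide)
  have "1 = (\<integral>\<^sup>+y. L y \<partial>P)"
    using Q.emeasure_space_1 by (simp add: emeasure_density cong: nn_integral_cong)
  also have "\<dots> \<le> (\<integral>\<^sup>+y. min 1 (L y) + (L y)\<^sup>2 / 4 \<partial>P)"
    by (intro nn_integral_mono min)
  also have "\<dots> = (\<integral>\<^sup>+y. min 1 (L y) \<partial>P) + (\<integral>\<^sup>+y. (L y)\<^sup>2 \<partial>P) / 4"
    by (simp add: nn_integral_add nn_integral_divide)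
  also have "\<dots> \<le> (\<integral>\<^sup>+y. min 1 (L y) \<partial>P) + 2 / 4"
    by (intro add_left_mono divide_right_mono_ennreal L2)
  finally have *: "1 \<le> (\<integral>\<^sup>+y. min 1 (L y) \<partial>P) + 2 / 4" .
  have half: "ennreal (1/2) \<le> X" if "1 \<le> X + 2 / 4" for X
  proof (cases X)
    case (real x)
    have "(2::ennreal) / 4 = ennreal (1/2)" using divide_ennreal[of 2 4] by simp
    then have "ennreal 1 \<le> ennreal (x + 1/2)" using that real by (subst ennreal_plus) auto
    then have "1/2 \<le> x" using real by (subst (asm) ennreal_le_iff) auto
    then show ?thesis using real by (simp only: ennreal_leI)
  qed simp
  have "ennreal (1/2) \<le> (\<integral>\<^sup>+y. min 1 (L y) \<partial>P)" by (rule half[OF *])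
  then have "c * ennreal (1/2) \<le> c * (\<integral>\<^sup>+y. min 1 (L y) \<partial>P)" by (intro mult_left_mono) auto
  also have "\<dots> = (\<integral>\<^sup>+y. c * min 1 (L y) \<partial>P)" by (rule nn_integral_cmult[symmetric]) simp
  also have "\<dots> \<le> (\<integral>\<^sup>+y. a y + L y * b y \<partial>P)"
  proof (rule nn_integral_mono)
    fix y assume "y \<in> space P"
    \<comment> \<open>Pointwise, (a + b) min(1, L) <= a + L b: the smaller of the two densities
      charges both losses.\<close>
    then have "c * min 1 (L y) \<le> (a y + b y) * min 1 (L y)" by (intro mult_right_mono c) auto
    also have "\<dots> = a y * min 1 (L y) + b y * min 1 (L y)" by (simp add: distrib_right)
    also have "\<dots> \<le> a y * 1 + b y * L y" by (intro add_mono mult_left_mono) auto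
    finally show "c * min 1 (L y) \<le> a y + L y * b y" by (simp add: mult.commute)
  qed
  also have "\<dots> = (\<integral>\<^sup>+y. a y \<partial>P) + (\<integral>\<^sup>+y. L y * b y \<partial>P)"
    by (rule nn_integral_add) auto
  also have "(\<integral>\<^sup>+y. L y * b y \<partial>P) = (\<integral>\<^sup>+y. b y \<partial>density P L)"
    by (subst nn_integral_density) auto
  also have "c * ennreal (1/2) = c / 2"
    by (simp add: divide_ennreal_def flip: ennreal_numeral)
  finally show ?thesis .
qed

text \<open>Second moments of likelihood ratios multiply over independent observations: (1 + eta)^n
  <= exp(n eta) <= exp(1/2) <= 2, the bound that the two-point argument asks for.\<close>

lemma iid_two_point_lower_bound:
  assumes "prob_space M" "prob_space (density M L)" and [measurable]: "L \<in> borel_measurable M"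
    and "(\<integral>\<^sup>+y. (L y)\<^sup>2 \<partial>M) \<le> ennreal (1 + \<eta>)" "\<eta> \<ge> 0" "real n * \<eta> \<le> 1 / 2"
    and [measurable]: "a \<in> borel_measurable (PiM {..<n} (\<lambda>_. M))"
      "b \<in> borel_measurable (PiM {..<n} (\<lambda>_. M))"
    and "\<And>y. y \<in> space (PiM {..<n} (\<lambda>_. M)) \<Longrightarrow> c \<le> a y + b y"
  shows "c / 2 \<le> (\<integral>\<^sup>+y. a y \<partial>PiM {..<n} (\<lambda>_. M)) + (\<integral>\<^sup>+y. b y \<partial>PiM {..<n} (\<lambda>_. density M L))"
proof -
  interpret M: prob_space M by fact
  interpret D: prob_space "density M L" by fact
  interpret PM: product_sigma_finite "\<lambda>_. M" ..
  have power_mono': "u \<le> v \<Longrightarrow> u ^ k \<le> v ^ k" for u v :: ennreal and k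
    by (induction k) (auto intro: mult_mono)
  have prod: "PiM {..<n} (\<lambda>_. density M L) = density (PiM {..<n} (\<lambda>_. M)) (\<lambda>y. \<Prod>i<n. L (y i))"
    by (rule PiM_density) (auto simp: assms)
  have "(\<integral>\<^sup>+y. (\<Prod>i<n. L (y i))\<^sup>2 \<partial>PiM {..<n} (\<lambda>_. M)) = (\<integral>\<^sup>+y. (\<Prod>i<n. (L (y i))\<^sup>2) \<partial>PiM {..<n} (\<lambda>_. M))"
    by (simp add: prod_power_distrib)
  also have "\<dots> = (\<Prod>i<n. \<integral>\<^sup>+x. (L x)\<^sup>2 \<partial>M)" by (intro PM.product_nn_integral_prod) auto
  also have "\<dots> \<le> (\<Prod>i<n. ennreal (1 + \<eta>))" using power_mono'[OF assms(4), of n] by simp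
  also have "\<dots> = ennreal ((1 + \<eta>) ^ n)"
    using assms(5) by (simp add: ennreal_power del: ennreal_plus)
  also have "(1 + \<eta>) ^ n \<le> exp \<eta> ^ n" using assms by (intro power_mono exp_ge_add_one_self) auto
  also have "exp \<eta> ^ n = exp (real n * \<eta>)" by (simp add: exp_of_nat_mult)
  also have "\<dots> \<le> exp (1/2)" using assms by simp
  also have "exp (1/2 :: real) \<le> 2" using exp_half_le2 by simp
  finally have "(\<integral>\<^sup>+y. (\<Prod>i<n. L (y i))\<^sup>2 \<partial>PiM {..<n} (\<lambda>_. M)) \<le> 2" by (simp add: ennreal_leI)
  moreover have "prob_space (density (PiM {..<n} (\<lambda>_. M)) (\<lambda>y. \<Prod>i<n. L (y i)))"
    unfolding prod[symmetric] by (rule prob_space_PiM) (rule assms(2))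
  ultimately show ?thesis
    unfolding prod using assms by (intro two_point_lower_bound) auto
qed

section \<open>Perturbed densities and the density of one observation\<close>

lemma prob_density_perturb:
  assumes f: "prob_density f" and [measurable]: "v \<in> borel_measurable borel"
    and "\<And>x. 0 \<le> f x + v x" and v: "integrable lborel v" "(\<integral>x. v x \<partial>lborel) = 0"
  shows "prob_density (\<lambda>x. f x + v x)"
proof -
  have [measurable]: "f \<in> borel_measurable borel" using f by (simp add: prob_density_def)
  have f1: "integrable lborel f" "(\<integral>x. f x \<partial>lborel) = 1"
    using f by (auto simp: prob_density_def integral_eq_nn_integral intro!: integrableI_nonneg)
  have "(\<integral>\<^sup>+x. ennreal (f x + v x) \<partial>lborel) = ennreal (\<integral>x. f x + v x \<partial>lborel)"
    using assms f1 by (intro nn_integral_eq_integral) auto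
  also have "\<dots> = 1" using f1 v by simp
  finally show ?thesis using assms by (simp add: prob_density_def)
qed

text \<open>A Bochner integral, so that it applies to signed perturbations too. It takes the default
  value 0 where the integrand is not integrable; for a probability density \<open>f\<close> this is
  a null set, hence the almost-everywhere statements below.\<close>

definition conv_density :: "real measure \<Rightarrow> (real \<Rightarrow> real) \<Rightarrow> real \<Rightarrow> real" where
  "conv_density G f y = (\<integral>t. f (y - t) \<partial>G)"

lemma conv_density_measurable:
  assumes "real_distribution G" and [measurable]: "f \<in> borel_measurable borel"
  shows "conv_density G f \<in> borel_measurable borel"
proof -
  interpret real_distribution G by fact
  show ?thesis unfolding conv_density_def by measurable
qed

lemma conv_density_facts:
  assumes "real_distribution G" and f: "prob_density f"
  shows "convolution (density lborel f) G = density lborel (conv_density G f)"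
    and "(\<integral>\<^sup>+y. conv_density G f y \<partial>lborel) = 1"
    and "AE y in lborel. integrable G (\<lambda>t. f (y - t))"
    and "0 \<le> conv_density G f y"
proof -
  interpret G: real_distribution G by fact
  have [measurable]: "f \<in> borel_measurable borel" and f0: "\<And>x. 0 \<le> f x"
    and f1: "(\<integral>\<^sup>+x. f x \<partial>lborel) = 1"
    using f by (auto simp: prob_density_def)
  note [measurable] = conv_density_measurable[OF assms(1)]
  have D: "prob_space (density lborel f)"
    by (intro prob_spaceI) (simp add: emeasure_density f1)
  then have RD: "real_distribution (density lborel f)"
    by (simp add: real_distribution_def real_distribution_axioms_def)
  interpret D: prob_space "density lborel f" by fact
  have conv: "convolution (density lborel f) G = density lborel (\<lambda>y. \<integral>\<^sup>+t. f (y - t) \<partial>G)"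
    by (rule convolution_density_left) (auto simp: G.finite_measure_axioms D.finite_measure_axioms)
  interpret C: real_distribution "convolution (density lborel f) G"
    by (rule real_distribution_convolution[OF RD assms(1)])
  have one: "(\<integral>\<^sup>+y. \<integral>\<^sup>+t. f (y - t) \<partial>G \<partial>lborel) = 1"
    using C.emeasure_space_1 unfolding conv by (simp add: emeasure_density)
  then have "AE y in lborel. (\<integral>\<^sup>+t. f (y - t) \<partial>G) \<noteq> \<infinity>"
    by (intro nn_integral_noteq_infinite) auto
  then show AE: "AE y in lborel. integrable G (\<lambda>t. f (y - t))"
    by eventually_elim (auto intro!: integrableI_nonneg simp: f0 less_top)
  have eq: "AE y in lborel. (\<integral>\<^sup>+t. f (y - t) \<partial>G) = ennreal (conv_density G f y)"
    using AE by eventually_elim (auto simp: conv_density_def nn_integral_eq_integral f0)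
  show "convolution (density lborel f) G = density lborel (conv_density G f)"
    unfolding conv by (rule density_cong) (use eq in auto)
  show "(\<integral>\<^sup>+y. conv_density G f y \<partial>lborel) = 1"
    using one nn_integral_cong_AE[OF eq] by simp
  show "0 \<le> conv_density G f y" by (simp add: conv_density_def f0)
qed

text \<open>At least half of the error mass lies in [-r, r]. If f is at least kappa within distance
  r of y, the observation density at y is therefore at least kappa / 2; this is demanded only where
  the observed perturbation is nonzero.\<close>

lemma deconvolution_two_point:
  assumes G: "real_distribution G" and f: "prob_density f" and g: "prob_density (\<lambda>x. f x + v x)"
    and [measurable]: "v \<in> borel_measurable borel" and vC: "\<And>x. \<bar>v x\<bar> \<le> C"
    and half: "1 / 2 \<le> measure G {-r..r}" and "\<kappa> > 0"
    and lower: "\<And>x y. conv_density G v y \<noteq> 0 \<Longrightarrow> \<bar>x - y\<bar> \<le> r \<Longrightarrow> \<kappa> \<le> f x"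
    and chi: "(\<integral>\<^sup>+y. ennreal ((conv_density G v y)\<^sup>2) \<partial>lborel) \<le> ennreal (\<kappa> / 2 * \<eta>)"
    and "\<eta> \<ge> 0" "real n * \<eta> \<le> 1 / 2"
    and [measurable]: "a \<in> borel_measurable (PiM {..<n} (\<lambda>_. borel))"
      "b \<in> borel_measurable (PiM {..<n} (\<lambda>_. borel))"
    and c: "\<And>y. y \<in> space (PiM {..<n} (\<lambda>_. borel)) \<Longrightarrow> c \<le> a y + b y"
  shows "c / 2 \<le> (\<integral>\<^sup>+y. a y \<partial>obs_law G n f) + (\<integral>\<^sup>+y. b y \<partial>obs_law G n (\<lambda>x. f x + v x))"
proof -
  interpret G: real_distribution G by fact
  have fm [measurable]: "f \<in> borel_measurable borel" and f0: "\<And>x. 0 \<le> f x"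
    using f by (auto simp: prob_density_def)
  define p where "p = conv_density G f"
  define q where "q = conv_density G (\<lambda>x. f x + v x)"
  define w where "w = conv_density G v"
  note P = conv_density_facts[OF G f, folded p_def] and Q = conv_density_facts[OF G g, folded q_def]
  have [measurable]: "p \<in> borel_measurable borel" "q \<in> borel_measurable borel"
    by (auto simp: p_def q_def intro!: conv_density_measurable[OF G])
  have AE: "AE y in lborel. q y = p y + w y \<and> (w y \<noteq> 0 \<longrightarrow> \<kappa> / 2 \<le> p y)"
    using P(3)
  proof eventually_elim
    case (elim y)
    have "integrable G (\<lambda>t. v (y - t))"
      by (rule G.integrable_const_bound[of _ C]) (auto simp: vC)
    with elim have "q y = p y + w y" by (simp add: p_def q_def w_def conv_density_def)
    moreover have "\<kappa> / 2 \<le> p y" if "w y \<noteq> 0"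
    proof -
      have [simp]: "integrable G (\<lambda>t. indicat_real {-r..r} t)"
        by (rule G.integrable_const_bound[of _ 1]) auto
      have "\<kappa> / 2 \<le> \<kappa> * measure G {-r..r}" using half \<open>\<kappa> > 0\<close> by simp
      also have "\<dots> = (\<integral>t. \<kappa> * indicator {-r..r} t \<partial>G)" by simp
      also have "\<dots> \<le> p y" unfolding p_def conv_density_def
      proof (rule integral_mono[OF _ elim])
        show "\<kappa> * indicator {-r..r} t \<le> f (y - t)" for t
          using lower[of y "y - t"] that f0[of "y - t"] by (auto simp: w_def indicator_def)
      qed auto
      finally show ?thesis .
    qed
    ultimately show ?case by blast
  qed
  have chi': "(\<integral>\<^sup>+y. ennreal ((q y - p y)\<^sup>2) \<partial>lborel) \<le> ennreal (\<kappa> / 2 * \<eta>)"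
  proof -
    have "(\<integral>\<^sup>+y. ennreal ((q y - p y)\<^sup>2) \<partial>lborel) = (\<integral>\<^sup>+y. ennreal ((w y)\<^sup>2) \<partial>lborel)"
      by (rule nn_integral_cong_AE, use AE in eventually_elim) auto
    then show ?thesis using chi by (simp add: w_def)
  qed
  have "AE y in lborel. q y = p y \<or> \<kappa> / 2 \<le> p y" using AE by eventually_elim auto
  note L = likelihood_ratio_second_moment[OF \<open>p \<in> _\<close> \<open>q \<in> _\<close> P(4) Q(4) P(2) Q(2) _ \<open>\<eta> \<ge> 0\<close> this chi']
  have PP: "prob_space (density lborel p)" and QP: "prob_space (density lborel q)"
    using P(2) Q(2) by (auto intro!: prob_spaceI simp: emeasure_density)
  have laws: "obs_law G n f = PiM {..<n} (\<lambda>_. density lborel p)"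
    "obs_law G n (\<lambda>x. f x + v x) = PiM {..<n} (\<lambda>_. density (density lborel p) (\<lambda>y. ennreal (q y / p y)))"
    unfolding obs_law_def P(1) Q(1) using L(1) \<open>\<kappa> > 0\<close> by simp_all
  have sets: "sets (PiM {..<n} (\<lambda>_. density lborel p)) = sets (PiM {..<n} (\<lambda>_. borel :: real measure))"
    by (intro sets_PiM_cong) auto
  have space: "space (PiM {..<n} (\<lambda>_. density lborel p)) = space (PiM {..<n} (\<lambda>_. borel :: real measure))"
    using sets by (rule sets_eq_imp_space_eq)
  have meas: "h \<in> borel_measurable (PiM {..<n} (\<lambda>_. density lborel p))"
    if "h \<in> borel_measurable (PiM {..<n} (\<lambda>_. borel :: real measure))" for h :: "(nat \<Rightarrow> real) \<Rightarrow> ennreal"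
    using that measurable_cong_sets[OF sets refl] by blast
  show ?thesis
    unfolding laws
    by (rule iid_two_point_lower_bound[where \<eta> = \<eta>])
      (use PP QP L \<open>\<kappa> > 0\<close> \<open>real n * \<eta> \<le> 1 / 2\<close> in \<open>auto intro: meas c simp: assms space simp flip: ennreal_plus\<close>)
qed

section \<open>From the minimax risk to one bad density for every estimator\<close>

lemma esqrt_mono: "x \<le> y \<Longrightarrow> esqrt x \<le> esqrt y"
  unfolding esqrt_def by (auto simp: top_unique less_top[symmetric] intro!: ennreal_leI real_sqrt_le_mono enn2real_mono)

lemma esqrt_power2: "(esqrt x)\<^sup>2 = x"
  by (cases x) (auto simp: esqrt_def ennreal_power)

lemma esqrt_ennreal: "0 \<le> x \<Longrightarrow> esqrt (ennreal x) = ennreal (sqrt x)"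
  by (simp add: esqrt_def)

lemma ennreal_half_cancel: "r + r \<le> x + y \<Longrightarrow> r \<le> x \<or> (r::ennreal) \<le> y"
  by (metis add_strict_mono ennreal_add_less_top not_le)

lemma minimax_point_ge:
  assumes "\<And>T. T \<in> estimators n \<Longrightarrow> \<exists>f\<in>K. r \<le> (\<integral>\<^sup>+y. ennreal (\<bar>T y x\<^sub>0 - f x\<^sub>0\<bar>\<^sup>2) \<partial>obs_law G n f)"
  shows "esqrt r \<le> minimax_point G n K x\<^sub>0"
  unfolding minimax_point_def
proof (rule INF_greatest)
  fix T assume "T \<in> estimators n"
  from assms[OF this] obtain f where "f \<in> K" "r \<le> (\<integral>\<^sup>+y. ennreal (\<bar>T y x\<^sub>0 - f x\<^sub>0\<bar>\<^sup>2) \<partial>obs_law G n f)"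
    by blast
  then show "esqrt r \<le> (SUP f\<in>K. esqrt (\<integral>\<^sup>+y. ennreal (\<bar>T y x\<^sub>0 - f x\<^sub>0\<bar>\<^sup>2) \<partial>obs_law G n f))"
    by (auto intro!: SUP_upper2 esqrt_mono)
qed

lemma minimax_L2_ge:
  assumes "\<And>T. T \<in> estimators n \<Longrightarrow>
    \<exists>f\<in>K. r \<le> (\<integral>\<^sup>+y. \<integral>\<^sup>+x. ennreal ((T y x - f x)\<^sup>2) \<partial>lborel \<partial>obs_law G n f)"
  shows "esqrt r \<le> minimax_L2 G n K"
  unfolding minimax_L2_def L2norm_def esqrt_power2
proof (rule INF_greatest)
  fix T assume "T \<in> estimators n"
  from assms[OF this] obtain f where "f \<in> K"
    "r \<le> (\<integral>\<^sup>+y. \<integral>\<^sup>+x. ennreal ((T y x - f x)\<^sup>2) \<partial>lborel \<partial>obs_law G n f)"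
    by blast
  then show "esqrt r \<le> (SUP f\<in>K. esqrt (\<integral>\<^sup>+y. \<integral>\<^sup>+x. ennreal ((T y x - f x)\<^sup>2) \<partial>lborel \<partial>obs_law G n f))"
    by (auto intro!: SUP_upper2 esqrt_mono)
qed

lemma estimators_measurable:
  assumes "T \<in> estimators n"
  shows "(\<lambda>y. T y x) \<in> borel_measurable (PiM {..<n} (\<lambda>_. borel))"
proof -
  have "case_prod T \<in> borel_measurable ((PiM {..<n} (\<lambda>_. borel)) \<Otimes>\<^sub>M borel)"
    using assms by (simp add: estimators_def)
  from measurable_compose[OF _ this, of "\<lambda>y. (y, x)" "PiM {..<n} (\<lambda>_. borel)"] show ?thesis by simp
qed

lemma ennreal_half_plus_half: "c / 2 + c / 2 = (c::ennreal)"
  using mult_divide_eq_ennreal[of 2 c] by (simp add: mult_2_right add_divide_distrib_ennreal)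

text \<open>Assouad's averaging: for fixed k the subsets come in pairs \<open>S\<close>,
  \<open>insert k S\<close> that share a loss c, so the mean over all subsets is at least c / 2 in
  each of the K coordinates.\<close>

lemma sum_Pow_pairs:
  fixes R :: "nat set \<Rightarrow> nat \<Rightarrow> ennreal"
  assumes "\<And>S k. k < K \<Longrightarrow> S \<subseteq> {..<K} - {k} \<Longrightarrow> c \<le> R S k + R (insert k S) k"
  shows "(\<Sum>S\<in>Pow {..<K}. of_nat K * c / 2) \<le> (\<Sum>S\<in>Pow {..<K}. \<Sum>k<K. R S k)"
proof -
  have "(\<Sum>S\<in>Pow {..<K}. c / 2) \<le> (\<Sum>S\<in>Pow {..<K}. R S k)" if k: "k < K" for k
  proof -
    define A where "A = {..<K} - {k}"
    have A: "{..<K} = insert k A" "k \<notin> A" "finite A" using k by (auto simp: A_def)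
    have split: "sum h (Pow {..<K}) = sum h (Pow A) + sum (h \<circ> insert k) (Pow A)"
      for h :: "nat set \<Rightarrow> ennreal"
    proof -
      have "inj_on (insert k) (Pow A)" using A(2) by (auto simp: inj_on_def)
      then show ?thesis unfolding A(1) Pow_insert using A
        by (subst sum.union_disjoint) (auto simp: sum.reindex)
    qed
    have "(\<Sum>S\<in>Pow {..<K}. c / 2) = (\<Sum>S\<in>Pow A. c)"
      unfolding split sum.distrib[symmetric] comp_def
      by (intro sum.cong refl) (simp add: ennreal_half_plus_half)
    also have "\<dots> \<le> (\<Sum>S\<in>Pow A. R S k + R (insert k S) k)"
      using assms[OF k] by (intro sum_mono) (auto simp: A_def)
    also have "\<dots> = (\<Sum>S\<in>Pow {..<K}. R S k)" by (simp add: split sum.distrib comp_def)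
    finally show ?thesis .
  qed
  then have "(\<Sum>k<K. \<Sum>S\<in>Pow {..<K}. c / 2) \<le> (\<Sum>k<K. \<Sum>S\<in>Pow {..<K}. R S k)"
    by (rule sum_mono) (simp only: lessThan_iff)
  also have "\<dots> = (\<Sum>S\<in>Pow {..<K}. \<Sum>k<K. R S k)" by (rule sum.swap)
  finally show ?thesis
    by (subst (asm) sum.swap) (simp add: ennreal_times_divide mult.assoc)
qed

lemma ex_ge_average:
  fixes \<rho> :: "'a \<Rightarrow> ennreal"
  assumes "finite A" "A \<noteq> {}" "(\<Sum>S\<in>A. c) \<le> (\<Sum>S\<in>A. \<rho> S)"
  shows "\<exists>S\<in>A. c \<le> \<rho> S"
proof -
  define M where "M = Max (\<rho> ` A)"
  have "(\<Sum>S\<in>A. \<rho> S) \<le> (\<Sum>S\<in>A. M)"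
    unfolding M_def using assms by (intro sum_mono) auto
  with assms(3) have "of_nat (card A) * c \<le> of_nat (card A) * M" by simp
  then have "c \<le> M"
    using assms by (subst (asm) ennreal_mult_le_mult_iff) auto
  moreover have "M \<in> \<rho> ` A" unfolding M_def using assms by (intro Max_in) auto
  ultimately show ?thesis by auto
qed

text \<open>As the supports of the \<open>v k\<close> are disjoint, the integrated loss dominates
  the sum of the losses on the supports. On the support of \<open>v k\<close> the estimator faces a
  two-point problem between \<open>S\<close> and \<open>insert k S\<close>; averaging over the
  hypercube yields a bad vertex.\<close>

lemma assouad_deconvolution_L2:
  fixes f0 :: "real \<Rightarrow> real" and v :: "nat \<Rightarrow> real \<Rightarrow> real"
  defines "f S x \<equiv> f0 x + (\<Sum>k\<in>S. v k x)"
  assumes G: "real_distribution G"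
    and cls: "\<And>S. S \<subseteq> {..<K} \<Longrightarrow> f S \<in> \<F>" and dens: "\<And>h. h \<in> \<F> \<Longrightarrow> prob_density h"
    and vm [measurable]: "\<And>k. v k \<in> borel_measurable borel" and vC: "\<And>k x. \<bar>v k x\<bar> \<le> C"
    and disj: "\<And>k l x. k < K \<Longrightarrow> l < K \<Longrightarrow> k \<noteq> l \<Longrightarrow> v k x = 0 \<or> v l x = 0"
    and half: "1 / 2 \<le> measure G {-r..r}" and "\<kappa> > 0"
    and lower: "\<And>S k x y. S \<subseteq> {..<K} \<Longrightarrow> k < K \<Longrightarrow> conv_density G (v k) y \<noteq> 0 \<Longrightarrow>
      \<bar>x - y\<bar> \<le> r \<Longrightarrow> \<kappa> \<le> f S x"
    and chi: "\<And>k. k < K \<Longrightarrow>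
      (\<integral>\<^sup>+y. ennreal ((conv_density G (v k) y)\<^sup>2) \<partial>lborel) \<le> ennreal (\<kappa> / 2 * \<eta>)"
    and \<eta>: "\<eta> \<ge> 0" "real n * \<eta> \<le> 1 / 2"
    and \<delta>: "\<And>k. k < K \<Longrightarrow> ennreal \<delta> \<le> (\<integral>\<^sup>+x. ennreal ((v k x)\<^sup>2) \<partial>lborel)" "\<delta> \<ge> 0"
  shows "ennreal (sqrt (real K * \<delta> / 8)) \<le> minimax_L2 G n \<F>"
proof -
  have "esqrt (ennreal (real K * \<delta> / 8)) \<le> minimax_L2 G n \<F>"
  proof (rule minimax_L2_ge)
    fix T assume T: "T \<in> estimators n"
    have Tm [measurable]: "case_prod T \<in> borel_measurable ((PiM {..<n} (\<lambda>_. borel)) \<Otimes>\<^sub>M borel)"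
      using T by (simp add: estimators_def)
    have Tym: "T y \<in> borel_measurable borel" if "y \<in> space (PiM {..<n} (\<lambda>_. borel :: real measure))" for y
      using measurable_compose[OF _ Tm, of "Pair y" borel] that by simp
    have fm: "f S \<in> borel_measurable borel" if "S \<subseteq> {..<K}" for S
      using dens[OF cls[OF that]] by (simp add: prob_density_def)
    define I where "I k = {x. v k x \<noteq> 0}" for k
    have [measurable]: "I k \<in> sets borel" for k unfolding I_def by measurable
    define loss where "loss S k y = (\<integral>\<^sup>+x. indicator (I k) x * ennreal ((T y x - f S x)\<^sup>2) \<partial>lborel)" for S k y
    define R where "R S k = (\<integral>\<^sup>+y. loss S k y \<partial>obs_law G n (f S))" for S k
    have loss_m [measurable]: "loss S k \<in> borel_measurable (PiM {..<n} (\<lambda>_. borel))" if "S \<subseteq> {..<K}" for S k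
      unfolding loss_def using fm[OF that] by measurable
    have pair: "ennreal (\<delta> / 4) \<le> R S k + R (insert k S) k" if k: "k < K" and S: "S \<subseteq> {..<K} - {k}" for S k
    proof -
      have S': "S \<subseteq> {..<K}" "insert k S \<subseteq> {..<K}" "k \<notin> S" "finite S"
        using S k by (auto intro: finite_subset[of _ "{..<K}"])
      have fi: "f (insert k S) = (\<lambda>x. f S x + v k x)" using S' by (auto simp: f_def)
      \<comment> \<open>Constants: (T - f)^2 + (T - f - v)^2 >= v^2 / 2 gives delta / 2, the
        two-point bound halves it to delta / 4, and averaging over pairs leaves delta / 8 per
        coordinate.\<close>
      have "ennreal (\<delta> / 2) / 2 \<le> R S k + R (insert k S) k"
        unfolding R_def fi[symmetric]
      proof (subst fi, rule deconvolution_two_point[OF G _ _ vm vC half \<open>\<kappa> > 0\<close> _ chi[OF k] \<eta>])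
        fix y assume y: "y \<in> space (PiM {..<n} (\<lambda>_. borel :: real measure))"
        note Ty [measurable] = Tym[OF y]
        have "ennreal (\<delta> / 2) = ennreal (1/2) * ennreal \<delta>" using \<delta>(2) ennreal_mult[of "1/2" \<delta>] by simp
        also have "\<dots> \<le> ennreal (1/2) * (\<integral>\<^sup>+x. ennreal ((v k x)\<^sup>2) \<partial>lborel)"
          by (intro mult_left_mono \<delta>(1) k) simp
        also have "\<dots> = (\<integral>\<^sup>+x. ennreal (1/2) * ennreal ((v k x)\<^sup>2) \<partial>lborel)"
          by (rule nn_integral_cmult[symmetric]) measurable
        also have "\<dots> \<le> (\<integral>\<^sup>+x. indicator (I k) x * ennreal ((T y x - f S x)\<^sup>2)
            + indicator (I k) x * ennreal ((T y x - f (insert k S) x)\<^sup>2) \<partial>lborel)"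
        proof (rule nn_integral_mono)
          fix x
          have "1/2 * (v k x)\<^sup>2 \<le> (T y x - f S x)\<^sup>2 + (T y x - f (insert k S) x)\<^sup>2"
            using zero_le_power2[of "2 * (T y x - f S x) - v k x"]
            by (simp add: fi power2_eq_square algebra_simps)
          then have "ennreal (1/2 * (v k x)\<^sup>2)
              \<le> ennreal ((T y x - f S x)\<^sup>2 + (T y x - f (insert k S) x)\<^sup>2)" by (rule ennreal_leI)
          then show "ennreal (1/2) * ennreal ((v k x)\<^sup>2) \<le> indicator (I k) x * ennreal ((T y x - f S x)\<^sup>2)
            + indicator (I k) x * ennreal ((T y x - f (insert k S) x)\<^sup>2)"
            using ennreal_mult[of "1/2" "(v k x)\<^sup>2"] by (auto simp: I_def indicator_def ennreal_mult'[symmetric])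
        qed
        also have "\<dots> = loss S k y + loss (insert k S) k y"
        proof -
          define g where "g = T y"
          have [measurable]: "g \<in> borel_measurable borel" "f S \<in> borel_measurable borel"
            "f (insert k S) \<in> borel_measurable borel"
            using Ty fm S' by (auto simp: g_def)
          show ?thesis unfolding loss_def g_def[symmetric] by (rule nn_integral_add) measurable
        qed
        finally show "ennreal (\<delta> / 2) \<le> loss S k y + loss (insert k S) k y" .
      qed (use S' k lower[OF S'(1) k] dens[OF cls] fi dens[OF cls[OF S'(2)], unfolded fi] in \<open>auto intro!: loss_m\<close>)
      then show ?thesis using \<delta>(2) by (simp add: divide_ennreal flip: ennreal_numeral)
    qed
    have "\<exists>S\<in>Pow {..<K}. of_nat K * ennreal (\<delta> / 4) / 2 \<le> (\<Sum>k<K. R S k)"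
      by (intro ex_ge_average sum_Pow_pairs pair) auto
    then obtain S where S: "S \<subseteq> {..<K}" "of_nat K * ennreal (\<delta> / 4) / 2 \<le> (\<Sum>k<K. R S k)" by auto
    have "of_nat K * ennreal (\<delta> / 4) / 2 = ennreal (real K * \<delta> / 8)"
      using \<delta>(2) by (simp add: ennreal_of_nat_eq_real_of_nat divide_ennreal flip: ennreal_mult ennreal_numeral)
    note bound = S(2)[unfolded this]
    have sets: "sets (obs_law G n (f S)) = sets (PiM {..<n} (\<lambda>_. borel :: real measure))"
      unfolding obs_law_def by (intro sets_PiM_cong) auto
    note bound
    also have "(\<Sum>k<K. R S k) = (\<integral>\<^sup>+y. (\<Sum>k<K. loss S k y) \<partial>obs_law G n (f S))"
      unfolding R_def
    proof (rule nn_integral_sum[symmetric])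
      show "loss S k \<in> borel_measurable (obs_law G n (f S))" for k
        using loss_m[OF S(1)] measurable_cong_sets[OF sets refl] by blast
    qed
    also have "\<dots> \<le> (\<integral>\<^sup>+y. \<integral>\<^sup>+x. ennreal ((T y x - f S x)\<^sup>2) \<partial>lborel \<partial>obs_law G n (f S))"
    proof (rule nn_integral_mono)
      fix y assume "y \<in> space (obs_law G n (f S))"
      then have "y \<in> space (PiM {..<n} (\<lambda>_. borel :: real measure))"
        using sets_eq_imp_space_eq[OF sets] by simp
      note [measurable] = Tym[OF this] fm[OF S(1)]
      have "(\<Sum>k<K. loss S k y) = (\<integral>\<^sup>+x. (\<Sum>k<K. indicator (I k) x) * ennreal ((T y x - f S x)\<^sup>2) \<partial>lborel)"
        unfolding loss_def by (subst nn_integral_sum[symmetric]) (auto simp: sum_distrib_right)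
      also have "\<dots> \<le> (\<integral>\<^sup>+x. 1 * ennreal ((T y x - f S x)\<^sup>2) \<partial>lborel)"
      proof (intro nn_integral_mono mult_right_mono)
        fix x
        have "(\<Sum>k<K. indicator (I k) x) = (indicator (\<Union>k<K. I k) x :: ennreal)"
          using disj by (intro indicator_UN_disjoint[symmetric]) (fastforce simp: disjoint_family_on_def I_def)+
        then show "(\<Sum>k<K. indicator (I k) x) \<le> (1 :: ennreal)" by (simp add: indicator_def)
      qed simp
      finally show "(\<Sum>k<K. loss S k y) \<le> (\<integral>\<^sup>+x. ennreal ((T y x - f S x)\<^sup>2) \<partial>lborel)" by simp
    qed
    finally show "\<exists>h\<in>\<F>. ennreal (real K * \<delta> / 8)
        \<le> (\<integral>\<^sup>+y. \<integral>\<^sup>+x. ennreal ((T y x - h x)\<^sup>2) \<partial>lborel \<partial>obs_law G n h)"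
      using cls[OF S(1)] by blast
  qed
  then show ?thesis using \<delta>(2) by (subst (asm) esqrt_ennreal) auto
qed

section \<open>Smoothness classes\<close>

text \<open>The exponent left for the Holder condition thus lies in (0, 1], with value 1 at integer
  alpha.\<close>

lemma strict_floor_bounds:
  assumes "\<alpha> > 0"
  shows "real (strict_floor \<alpha>) < \<alpha>" "\<alpha> \<le> real (strict_floor \<alpha>) + 1"
proof -
  have fin: "finite {k::nat. real k < \<alpha>}"
  proof (rule finite_subset[of _ "{..nat \<lceil>\<alpha>\<rceil>}"])
    show "{k::nat. real k < \<alpha>} \<subseteq> {..nat \<lceil>\<alpha>\<rceil>}" by (auto simp: le_nat_iff) linarith
  qed simp
  have "0 \<in> {k::nat. real k < \<alpha>}" using assms by simp
  then have "strict_floor \<alpha> \<in> {k::nat. real k < \<alpha>}"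
    unfolding strict_floor_def using Max_in[OF fin] by blast
  then show "real (strict_floor \<alpha>) < \<alpha>" by simp
  have "Suc (strict_floor \<alpha>) \<notin> {k::nat. real k < \<alpha>}"
    using Max_ge[OF fin, of "Suc (strict_floor \<alpha>)"] unfolding strict_floor_def by auto
  then show "\<alpha> \<le> real (strict_floor \<alpha>) + 1" by simp
qed

text \<open>The class condition without \<open>prob_density\<close>, so that it applies to signed
  perturbations and can be combined linearly.\<close>

definition holder_smooth :: "real \<Rightarrow> real \<Rightarrow> (real \<Rightarrow> real) \<Rightarrow> bool" where
  "holder_smooth \<alpha> a f \<longleftrightarrow> times_differentiable (strict_floor \<alpha>) f \<and>
     continuous_on UNIV ((deriv ^^ strict_floor \<alpha>) f) \<and>
     (\<forall>x x'. \<bar>(deriv ^^ strict_floor \<alpha>) f x - (deriv ^^ strict_floor \<alpha>) f x'\<bar>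
        \<le> a * \<bar>x - x'\<bar> powr (\<alpha> - real (strict_floor \<alpha>)))"

text \<open>Measurability is included because a signed perturbation cannot inherit it from
  \<open>prob_density\<close>.\<close>

definition sobolev_smooth :: "real \<Rightarrow> real \<Rightarrow> (real \<Rightarrow> real) \<Rightarrow> bool" where
  "sobolev_smooth \<alpha> a f \<longleftrightarrow> f \<in> borel_measurable borel \<and> times_differentiable (strict_floor \<alpha>) f \<and>
     (\<forall>t. L2norm (\<lambda>x. (deriv ^^ strict_floor \<alpha>) f (x + t) - (deriv ^^ strict_floor \<alpha>) f x)
        \<le> ennreal (a * \<bar>t\<bar> powr (\<alpha> - real (strict_floor \<alpha>))))"

lemma F_class_eq: "F_class \<alpha> p A B = {f. prob_density f \<and> holder_smooth \<alpha> A f} \<inter> moment_class p B"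
  by (auto simp: F_class_def holder_class_def holder_smooth_def)

lemma G_class_eq: "G_class \<alpha> p A B = {f. prob_density f \<and> sobolev_smooth \<alpha> A f} \<inter> moment_class p B"
  by (auto simp: G_class_def sobolev_class_def sobolev_smooth_def prob_density_def)

lemma L2norm_le_iff:
  assumes "0 \<le> s"
  shows "L2norm h \<le> ennreal s \<longleftrightarrow> (\<integral>\<^sup>+x. ennreal ((h x)\<^sup>2) \<partial>lborel) \<le> ennreal (s\<^sup>2)"
proof (cases "\<integral>\<^sup>+x. ennreal ((h x)\<^sup>2) \<partial>lborel")
  case (real r)
  then show ?thesis using assms
    by (auto simp: L2norm_def esqrt_def ennreal_le_iff real_sqrt_le_iff' real_le_lsqrt real_sqrt_le_iff sqrt_le_D)
qed (auto simp: L2norm_def esqrt_def top_unique)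

text \<open>Minkowski's inequality from (u + v)^2 <= (1 + t/s) u^2 + (1 + s/t) v^2. These weights
  give exactly (s + t)^2; a worse constant would not keep the perturbed density within the bound
  \<open>A\<close> of the class.\<close>

lemma L2norm_add_le:
  assumes [measurable]: "u \<in> borel_measurable borel" "v \<in> borel_measurable borel"
    and "L2norm u \<le> ennreal s" "L2norm v \<le> ennreal t" "s > 0" "t > 0"
  shows "L2norm (\<lambda>x. u x + v x) \<le> ennreal (s + t)"
proof -
  have "(\<integral>\<^sup>+x. ennreal ((u x + v x)\<^sup>2) \<partial>lborel)
      \<le> (\<integral>\<^sup>+x. ennreal (1 + t / s) * ennreal ((u x)\<^sup>2) + ennreal (1 + s / t) * ennreal ((v x)\<^sup>2) \<partial>lborel)"
  proof (rule nn_integral_mono)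
    fix x
    have "(1 + t / s) * (u x)\<^sup>2 + (1 + s / t) * (v x)\<^sup>2 - (u x + v x)\<^sup>2 = (t * u x - s * v x)\<^sup>2 / (s * t)"
      using assms by (simp add: power2_eq_square field_simps)
    moreover have "\<dots> \<ge> 0" using assms by simp
    ultimately have "(u x + v x)\<^sup>2 \<le> (1 + t / s) * (u x)\<^sup>2 + (1 + s / t) * (v x)\<^sup>2" by linarith
    then have "ennreal ((u x + v x)\<^sup>2) \<le> ennreal ((1 + t / s) * (u x)\<^sup>2 + (1 + s / t) * (v x)\<^sup>2)"
      by (rule ennreal_leI)
    also have "\<dots> = ennreal (1 + t / s) * ennreal ((u x)\<^sup>2) + ennreal (1 + s / t) * ennreal ((v x)\<^sup>2)"
      using assms(5,6) by (subst ennreal_plus) (auto simp: ennreal_mult simp del: ennreal_plus)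
    finally show "ennreal ((u x + v x)\<^sup>2)
        \<le> ennreal (1 + t / s) * ennreal ((u x)\<^sup>2) + ennreal (1 + s / t) * ennreal ((v x)\<^sup>2)" .
  qed
  also have "\<dots> = ennreal (1 + t / s) * (\<integral>\<^sup>+x. ennreal ((u x)\<^sup>2) \<partial>lborel)
      + ennreal (1 + s / t) * (\<integral>\<^sup>+x. ennreal ((v x)\<^sup>2) \<partial>lborel)"
    by (subst nn_integral_add) (auto simp: nn_integral_cmult)
  also have "\<dots> \<le> ennreal (1 + t / s) * ennreal (s\<^sup>2) + ennreal (1 + s / t) * ennreal (t\<^sup>2)"
    using assms by (intro add_mono mult_left_mono) (auto simp: L2norm_le_iff)
  also have "\<dots> = ennreal ((1 + t / s) * s\<^sup>2 + (1 + s / t) * t\<^sup>2)"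
    using assms by (subst ennreal_plus) (auto simp: ennreal_mult simp del: ennreal_plus)
  also have "(1 + t / s) * s\<^sup>2 + (1 + s / t) * t\<^sup>2 = (s + t)\<^sup>2"
    using assms by (simp add: power2_eq_square field_simps)
  finally show ?thesis using assms by (subst L2norm_le_iff) auto
qed

lemma L2norm_scale_le:
  assumes [measurable]: "u \<in> borel_measurable borel" and "L2norm u \<le> ennreal s" "s \<ge> 0" "c \<ge> 0"
  shows "L2norm (\<lambda>x. c * u x) \<le> ennreal (c * s)"
proof -
  have "(\<integral>\<^sup>+x. ennreal ((c * u x)\<^sup>2) \<partial>lborel) = ennreal (c\<^sup>2) * (\<integral>\<^sup>+x. ennreal ((u x)\<^sup>2) \<partial>lborel)"
    by (subst nn_integral_cmult[symmetric]) (auto simp: power_mult_distrib ennreal_mult)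
  also have "\<dots> \<le> ennreal (c\<^sup>2) * ennreal (s\<^sup>2)"
    using assms by (intro mult_left_mono) (auto simp: L2norm_le_iff)
  finally show ?thesis using assms
    by (subst L2norm_le_iff) (auto simp: power_mult_distrib ennreal_mult)
qed

lemma holder_smooth_mono: "holder_smooth \<alpha> a f \<Longrightarrow> a \<le> b \<Longrightarrow> holder_smooth \<alpha> b f"
  unfolding holder_smooth_def by (meson mult_right_mono order_trans powr_ge_zero)

lemma sobolev_smooth_mono: "sobolev_smooth \<alpha> a f \<Longrightarrow> a \<le> b \<Longrightarrow> sobolev_smooth \<alpha> b f"
  unfolding sobolev_smooth_def by (meson ennreal_leI mult_right_mono order_trans powr_ge_zero)

lemma holder_smooth_linear:
  assumes f: "holder_smooth \<alpha> a f" and g: "holder_smooth \<alpha> b g" and "0 < c" "0 < d"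
  shows "holder_smooth \<alpha> (c * a + d * b) (\<lambda>x. c * f x + d * g x)"
proof -
  define k where "k = strict_floor \<alpha>"
  let ?f = "(deriv ^^ k) f" and ?g = "(deriv ^^ k) g"
  have T: "times_differentiable k f" "times_differentiable k g"
    using f g by (auto simp: holder_smooth_def k_def)
  note L = times_differentiable_linear[OF T, where c = c and d = d]
  have "\<bar>(c * ?f x + d * ?g x) - (c * ?f y + d * ?g y)\<bar> \<le> (c * a + d * b) * \<bar>x - y\<bar> powr (\<alpha> - real k)" for x y
  proof -
    have "\<bar>?f x - ?f y\<bar> \<le> a * \<bar>x - y\<bar> powr (\<alpha> - real k)" "\<bar>?g x - ?g y\<bar> \<le> b * \<bar>x - y\<bar> powr (\<alpha> - real k)"
      using f g by (auto simp: holder_smooth_def k_def)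
    then have "c * \<bar>?f x - ?f y\<bar> + d * \<bar>?g x - ?g y\<bar>
        \<le> c * (a * \<bar>x - y\<bar> powr (\<alpha> - real k)) + d * (b * \<bar>x - y\<bar> powr (\<alpha> - real k))"
      using assms by (intro add_mono mult_left_mono) auto
    moreover have "\<bar>(c * ?f x + d * ?g x) - (c * ?f y + d * ?g y)\<bar> \<le> c * \<bar>?f x - ?f y\<bar> + d * \<bar>?g x - ?g y\<bar>"
    proof -
      have "(c * ?f x + d * ?g x) - (c * ?f y + d * ?g y) = c * (?f x - ?f y) + d * (?g x - ?g y)"
        by (simp add: algebra_simps)
      then show ?thesis using abs_triangle_ineq[of "c * (?f x - ?f y)" "d * (?g x - ?g y)"] assms
        by (simp add: abs_mult)
    qed
    ultimately show ?thesis by (simp add: algebra_simps)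
  qed
  moreover have "continuous_on UNIV ?f" "continuous_on UNIV ?g"
    using f g by (auto simp: holder_smooth_def k_def)
  ultimately show ?thesis
    unfolding holder_smooth_def k_def[symmetric] L(2)[OF order_refl]
    using L(1) by (auto intro!: continuous_intros)
qed

lemma sobolev_smooth_linear:
  assumes f: "sobolev_smooth \<alpha> a f" and g: "sobolev_smooth \<alpha> b g" and "0 < c" "0 < d" "0 < a" "0 < b"
  shows "sobolev_smooth \<alpha> (c * a + d * b) (\<lambda>x. c * f x + d * g x)"
proof -
  define k where "k = strict_floor \<alpha>"
  let ?f = "(deriv ^^ k) f" and ?g = "(deriv ^^ k) g"
  have T: "times_differentiable k f" "times_differentiable k g"
    and [measurable]: "f \<in> borel_measurable borel" "g \<in> borel_measurable borel"
    using f g by (auto simp: sobolev_smooth_def k_def)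
  note L = times_differentiable_linear[OF T, where c = c and d = d]
  have [measurable]: "?f \<in> borel_measurable borel" "?g \<in> borel_measurable borel"
    by (auto intro!: iterated_deriv_measurable T)
  have "L2norm (\<lambda>x. (c * ?f (x + t) + d * ?g (x + t)) - (c * ?f x + d * ?g x))
      \<le> ennreal ((c * a + d * b) * \<bar>t\<bar> powr (\<alpha> - real k))" for t
  \<comment> \<open>At t = 0 the bounds are 0, whereas \<open>L2norm_add_le\<close> asks for
    positive ones; there the difference itself vanishes.\<close>
  proof (cases "t = 0")
    case False
    have "L2norm (\<lambda>x. ?f (x + t) - ?f x) \<le> ennreal (a * \<bar>t\<bar> powr (\<alpha> - real k))"
      "L2norm (\<lambda>x. ?g (x + t) - ?g x) \<le> ennreal (b * \<bar>t\<bar> powr (\<alpha> - real k))"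
      using f g by (auto simp: sobolev_smooth_def k_def)
    then have "L2norm (\<lambda>x. c * (?f (x + t) - ?f x)) \<le> ennreal (c * (a * \<bar>t\<bar> powr (\<alpha> - real k)))"
      "L2norm (\<lambda>x. d * (?g (x + t) - ?g x)) \<le> ennreal (d * (b * \<bar>t\<bar> powr (\<alpha> - real k)))"
      using assms by (auto intro!: L2norm_scale_le)
    then have "L2norm (\<lambda>x. c * (?f (x + t) - ?f x) + d * (?g (x + t) - ?g x))
        \<le> ennreal (c * (a * \<bar>t\<bar> powr (\<alpha> - real k)) + d * (b * \<bar>t\<bar> powr (\<alpha> - real k)))"
      using assms False by (intro L2norm_add_le) auto
    then show ?thesis by (simp add: algebra_simps)
  qed (simp add: L2norm_def esqrt_def)
  then show ?thesis
    unfolding sobolev_smooth_def k_def[symmetric] L(2)[OF order_refl]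
    using L(1) by auto
qed

section \<open>Trains of disjoint bumps\<close>

text \<open>The index type is left open: the teeth of one comb are indexed by numbers, those of a
  superposition of shifted combs by pairs.\<close>

definition bump_train :: "nat \<Rightarrow> nat \<Rightarrow> real \<Rightarrow> 'i set \<Rightarrow> ('i \<Rightarrow> real) \<Rightarrow> ('i \<Rightarrow> real) \<Rightarrow> real \<Rightarrow> real" where
  "bump_train K l h I z a x = (\<Sum>i\<in>I. a i * bump K l ((x - z i) / h))"

text \<open>Tooth i lives on the open interval from z i to z i + h, so distance h between left
  endpoints already makes the teeth disjoint.\<close>

definition separated :: "real \<Rightarrow> 'i set \<Rightarrow> ('i \<Rightarrow> real) \<Rightarrow> bool" where
  "separated h I z \<longleftrightarrow> finite I \<and> 0 < h \<and> (\<forall>i\<in>I. \<forall>j\<in>I. i \<noteq> j \<longrightarrow> h \<le> \<bar>z i - z j\<bar>)"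

lemma bump_scaled_nonzero:
  assumes "0 < h" "bump K l ((x - z) / h) \<noteq> 0"
  shows "z < x \<and> x < z + h"
  using assms bump_eq_0[of "(x - z) / h" K l] by (force simp: field_simps)

lemma separated_unique:
  assumes "separated h I z" "i \<in> I" "j \<in> I"
    and "bump K l ((x - z i) / h) \<noteq> 0" "bump K' l' ((x - z j) / h) \<noteq> 0"
  shows "i = j"
proof (rule ccontr)
  assume "i \<noteq> j"
  then have "0 < h" "h \<le> \<bar>z i - z j\<bar>" using assms by (auto simp: separated_def)
  then show False using bump_scaled_nonzero[OF _ assms(4)] bump_scaled_nonzero[OF _ assms(5)] by linarith
qed

lemma sum_at_most_one:
  fixes t :: "'i \<Rightarrow> real"
  assumes "finite I" "\<And>i j. i \<in> I \<Longrightarrow> j \<in> I \<Longrightarrow> t i \<noteq> 0 \<Longrightarrow> t j \<noteq> 0 \<Longrightarrow> i = j"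
  obtains "\<And>i. i \<in> I \<Longrightarrow> t i = 0" "sum t I = 0" "(\<Sum>i\<in>I. (t i)\<^sup>2) = 0"
  | i where "i \<in> I" "sum t I = t i" "(\<Sum>i\<in>I. (t i)\<^sup>2) = (t i)\<^sup>2"
proof (cases "\<exists>i\<in>I. t i \<noteq> 0")
  case True
  then obtain i where i: "i \<in> I" "t i \<noteq> 0" by blast
  then have z: "t j = 0" if "j \<in> I - {i}" for j using assms that by blast
  have "sum t I = t i" "(\<Sum>i\<in>I. (t i)\<^sup>2) = (t i)\<^sup>2"
    by (subst sum.remove[OF assms(1) i(1)], simp add: z)+
  with i show thesis using that(2) by blast
qed (use that(1) in auto)

lemma bump_train_unique:
  assumes "separated h I z" "i \<in> I" "j \<in> I"
    and "a i * bump K l ((x - z i) / h) \<noteq> 0" "a j * bump K l ((x - z j) / h) \<noteq> 0"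
  shows "i = j"
  using separated_unique[OF assms(1-3), where K = K and l = l and x = x and K' = K and l' = l] assms(4,5) by auto

lemma bump_train_bound:
  assumes "separated h I z" "\<And>i. i \<in> I \<Longrightarrow> \<bar>a i\<bar> \<le> b" "\<And>x. \<bar>bump K l x\<bar> \<le> C" "b \<ge> 0"
  shows "\<bar>bump_train K l h I z a x\<bar> \<le> b * C"
proof -
  have "0 \<le> C" using assms(3)[of 0] by linarith
  have fin: "finite I" using assms(1) by (simp add: separated_def)
  show ?thesis
  proof (rule sum_at_most_one[OF fin bump_train_unique[OF assms(1), where a = a and K = K and l = l and x = x]])
    fix i assume "i \<in> I" "(\<Sum>i\<in>I. a i * bump K l ((x - z i) / h)) = a i * bump K l ((x - z i) / h)"
    then show ?thesis unfolding bump_train_def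
      using assms(2-4) by (auto simp: abs_mult intro!: mult_mono)
  qed (use \<open>0 \<le> C\<close> \<open>b \<ge> 0\<close> in \<open>auto simp: bump_train_def\<close>)
qed

lemma bump_train_square:
  assumes "separated h I z"
  shows "(bump_train K l h I z a x)\<^sup>2 = (\<Sum>i\<in>I. (a i)\<^sup>2 * (bump K l ((x - z i) / h))\<^sup>2)"
proof -
  have fin: "finite I" using assms by (simp add: separated_def)
  have "(sum (\<lambda>i. a i * bump K l ((x - z i) / h)) I)\<^sup>2 = (\<Sum>i\<in>I. (a i * bump K l ((x - z i) / h))\<^sup>2)"
    by (rule sum_at_most_one[where t = "\<lambda>i. a i * bump K l ((x - z i) / h)",
          OF fin bump_train_unique[OF assms, where a = a and K = K and l = l and x = x]]) auto
  then show ?thesis by (simp add: bump_train_def power_mult_distrib)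
qed

lemma bump_train_support:
  assumes "0 < h" "bump_train K l h I z a x \<noteq> 0"
  shows "\<exists>i\<in>I. z i < x \<and> x < z i + h"
  using assms bump_scaled_nonzero by (metis (no_types, lifting) bump_train_def mult_zero_right sum.neutral)

lemma bump_train_measurable [measurable]: "bump_train K l h I z a \<in> borel_measurable borel"
  unfolding bump_train_def by measurable

lemma nn_integral_bump_train_square:
  assumes "separated h I z"
  shows "(\<integral>\<^sup>+x. ennreal ((bump_train K l h I z a x)\<^sup>2) \<partial>lborel)
    = ennreal (h * (\<Sum>i\<in>I. (a i)\<^sup>2)) * (\<integral>\<^sup>+x. ennreal ((bump K l x)\<^sup>2) \<partial>lborel)"
proof -
  have h: "0 < h" and "finite I" using assms by (auto simp: separated_def)
  have scale: "(\<integral>\<^sup>+x. ennreal ((bump K l ((x - c) / h))\<^sup>2) \<partial>lborel)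
      = ennreal h * (\<integral>\<^sup>+x. ennreal ((bump K l x)\<^sup>2) \<partial>lborel)" for c
    using nn_integral_real_affine[of "\<lambda>x. ennreal ((bump K l ((x - c) / h))\<^sup>2)" h c] h by simp
  have "(\<integral>\<^sup>+x. ennreal ((bump_train K l h I z a x)\<^sup>2) \<partial>lborel)
      = (\<integral>\<^sup>+x. (\<Sum>i\<in>I. ennreal ((a i)\<^sup>2) * ennreal ((bump K l ((x - z i) / h))\<^sup>2)) \<partial>lborel)"
    by (simp add: bump_train_square[OF assms] sum_ennreal[symmetric] ennreal_mult)
  also have "\<dots> = (\<Sum>i\<in>I. ennreal ((a i)\<^sup>2) * (ennreal h * (\<integral>\<^sup>+x. ennreal ((bump K l x)\<^sup>2) \<partial>lborel)))"
    by (simp add: nn_integral_sum nn_integral_cmult scale)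
  also have "\<dots> = ennreal (h * (\<Sum>i\<in>I. (a i)\<^sup>2)) * (\<integral>\<^sup>+x. ennreal ((bump K l x)\<^sup>2) \<partial>lborel)"
    unfolding sum_distrib_right[symmetric] using h
    by (subst sum_ennreal) (auto simp: ennreal_mult sum_nonneg ac_simps)
  finally show ?thesis .
qed

lemma bump_integrable: "integrable lborel (bump K l)"
proof -
  obtain C where C: "\<And>x. \<bar>bump K l x\<bar> \<le> C" using bump_bounded by blast
  have i: "integrable lborel (\<lambda>x. C * indicator {0..1::real} x)" by simp
  have b: "norm (bump K l x) \<le> norm (C * indicator {0..1::real} x)" for x
    using C[of x] bump_eq_0[of x K l] by (cases "0 < x \<and> x < 1") auto
  show ?thesis
    by (rule Bochner_Integration.integrable_bound[OF i]) (measurable, rule AE_I2, rule b)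
qed

text \<open>The derivative of a compactly supported function has mean 0, as a perturbation of a
  density must have.\<close>

lemma bump_integral_0:
  assumes "Suc (Suc l) < K"
  shows "(\<integral>x. bump K (Suc l) x \<partial>lborel) = 0"
proof -
  have "(\<integral>x. bump K (Suc l) x \<partial>lborel) = (\<integral>x. indicator {0..1} x *\<^sub>R bump K (Suc l) x \<partial>lborel)"
  proof (intro Bochner_Integration.integral_cong refl)
    show "bump K (Suc l) x = indicator {0..1} x *\<^sub>R bump K (Suc l) x" for x
      using bump_eq_0[of x K "Suc l"] by (cases "0 < x \<and> x < 1") auto
  qed
  also have "\<dots> = bump K l 1 - bump K l 0"
  proof (rule integral_FTC_Icc)
    show "continuous_on {0..1} (bump K (Suc l))"
      using bump_continuous[OF assms] continuous_on_subset by blast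
    show "(bump K l has_vector_derivative bump K (Suc l) x) (at x within {0..1})" for x
      using has_field_derivative_at_within[OF bump_DERIV[of l K x]] assms
      by (simp add: has_real_derivative_iff_has_vector_derivative)
  qed simp
  finally show ?thesis by (simp add: bump_eq_0)
qed

lemma bump_train_integral:
  assumes "Suc (Suc l) < K" "0 < h" "finite I"
  shows "integrable lborel (bump_train K (Suc l) h I z a)"
    and "(\<integral>x. bump_train K (Suc l) h I z a x \<partial>lborel) = 0"
proof -
  have i: "integrable lborel (\<lambda>x. bump K (Suc l) ((x - c) / h))" for c
    using lborel_integrable_real_affine[OF bump_integrable, of "1 / h" K "Suc l" "- c / h"] assms
    by (simp add: diff_divide_distrib)
  have "(\<integral>x. bump K (Suc l) ((x - c) / h) \<partial>lborel) = 0" for c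
    using lborel_integral_real_affine[of "1 / h" "bump K (Suc l)" "- c / h"] assms bump_integral_0[OF assms(1)]
    by (simp add: diff_divide_distrib)
  with i show "integrable lborel (bump_train K (Suc l) h I z a)"
    "(\<integral>x. bump_train K (Suc l) h I z a x \<partial>lborel) = 0"
    unfolding bump_train_def by simp_all
qed

text \<open>With \<open>s\<close> and \<open>t\<close> the teeth of a train evaluated at two points,
  each family has at most one nonzero term and the difference at most two. The constants are
  therefore independent of the number of teeth.\<close>

lemma sum_two_nonzero:
  fixes s t :: "'i \<Rightarrow> real"
  assumes "finite I"
    and "\<And>i j. i \<in> I \<Longrightarrow> j \<in> I \<Longrightarrow> s i \<noteq> 0 \<Longrightarrow> s j \<noteq> 0 \<Longrightarrow> i = j"
    and "\<And>i j. i \<in> I \<Longrightarrow> j \<in> I \<Longrightarrow> t i \<noteq> 0 \<Longrightarrow> t j \<noteq> 0 \<Longrightarrow> i = j"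
  shows "(\<Sum>i\<in>I. s i - t i)\<^sup>2 \<le> 2 * (\<Sum>i\<in>I. (s i - t i)\<^sup>2)"
    and "(\<And>i. i \<in> I \<Longrightarrow> \<bar>s i - t i\<bar> \<le> D) \<Longrightarrow> D \<ge> 0 \<Longrightarrow> \<bar>\<Sum>i\<in>I. s i - t i\<bar> \<le> 2 * D"
proof -
  define J where "J = {i\<in>I. s i \<noteq> 0} \<union> {i\<in>I. t i \<noteq> 0}"
  have "card {i\<in>I. s i \<noteq> 0} \<le> Suc 0" "card {i\<in>I. t i \<noteq> 0} \<le> Suc 0"
    using assms by (subst card_le_Suc0_iff_eq; force)+
  then have J: "card J \<le> 2" "J \<subseteq> I" "finite J"
    using card_Un_le[of "{i\<in>I. s i \<noteq> 0}" "{i\<in>I. t i \<noteq> 0}"] assms(1) by (auto simp: J_def)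
  have e: "(\<Sum>i\<in>I. s i - t i) = (\<Sum>i\<in>J. s i - t i)"
    by (rule sum.mono_neutral_right) (auto simp: J_def assms(1))
  have "(\<Sum>i\<in>J. s i - t i)\<^sup>2 \<le> (\<Sum>i\<in>J. (s i - t i)\<^sup>2) * real (card J)"
    by (rule sum_squared_le_sum_of_squares)
  also have "\<dots> \<le> (\<Sum>i\<in>I. (s i - t i)\<^sup>2) * 2"
    using J assms(1) by (intro mult_mono sum_mono2 sum_nonneg) auto
  finally show "(\<Sum>i\<in>I. s i - t i)\<^sup>2 \<le> 2 * (\<Sum>i\<in>I. (s i - t i)\<^sup>2)" by (simp add: e mult.commute)
  assume D: "\<And>i. i \<in> I \<Longrightarrow> \<bar>s i - t i\<bar> \<le> D" "D \<ge> 0"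
  have "\<bar>\<Sum>i\<in>J. s i - t i\<bar> \<le> (\<Sum>i\<in>J. D)"
    using D J by (intro order_trans[OF sum_abs] sum_mono) auto
  also have "\<dots> \<le> 2 * D" using J D(2) by (auto intro!: mult_right_mono)
  finally show "\<bar>\<Sum>i\<in>I. s i - t i\<bar> \<le> 2 * D" by (simp add: e)
qed

lemma bump_train_DERIV:
  assumes "Suc l < K" "0 < h"
  shows "(bump_train K l h I z a has_real_derivative bump_train K (Suc l) h I z a x / h) (at x)"
proof -
  have "((\<lambda>x. bump K l ((x - c) / h)) has_real_derivative bump K (Suc l) ((x - c) / h) * (1 / h)) (at x)" for c
    by (rule DERIV_chain2[OF bump_DERIV[OF assms(1)]]) (use assms(2) in \<open>auto intro!: derivative_eq_intros\<close>)
  then show ?thesis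
    unfolding bump_train_def sum_divide_distrib
    by (auto intro!: derivative_eq_intros sum.cong)
qed

lemma bump_train_iterated_deriv:
  assumes "m + k < K" "0 < h"
  shows "times_differentiable k (bump_train K m h I z a)"
    and "(deriv ^^ k) (bump_train K m h I z a) = (\<lambda>x. bump_train K (m + k) h I z a x / h ^ k)"
proof -
  let ?d = "\<lambda>i x. bump_train K (m + i) h I z a x / h ^ i"
  have D: "(?d i has_real_derivative ?d (Suc i) x) (at x)" if "i < k" for i x
    using DERIV_cdivide[OF bump_train_DERIV[of "m + i" K h I z a x], of "h ^ i"] assms that
    by (simp add: field_simps)
  show "times_differentiable k (bump_train K m h I z a)"
    by (rule times_differentiableI[of ?d]) (use D in auto)
  show "(deriv ^^ k) (bump_train K m h I z a) = ?d k"
    by (rule iterated_deriv_unique[of ?d _ k]) (use D in auto)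
qed

text \<open>Each of the k derivatives costs 1/h, and the Holder modulus the remaining h^(k - alpha).
  By disjointness the number of teeth does not enter.\<close>

lemma bump_train_holder_smooth:
  assumes "\<alpha> > 0" "k = strict_floor \<alpha>" "m + k + 1 < K" and sep: "separated h I z"
    and a: "\<And>i. i \<in> I \<Longrightarrow> \<bar>a i\<bar> \<le> b" "b \<ge> 0"
    and C: "\<And>x y. \<bar>bump K (m + k) x - bump K (m + k) y\<bar> \<le> C * \<bar>x - y\<bar> powr (\<alpha> - real k)" "C \<ge> 0"
  shows "holder_smooth \<alpha> (2 * b * C * h powr - \<alpha>) (bump_train K m h I z a)"
proof -
  have h: "0 < h" and fin: "finite I" using sep by (auto simp: separated_def)
  let ?t = "\<lambda>x i. a i * bump K (m + k) ((x - z i) / h)"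
  have scale: "(\<bar>x - y\<bar> / h) powr (\<alpha> - real k) / h ^ k = h powr - \<alpha> * \<bar>x - y\<bar> powr (\<alpha> - real k)" for x y
    using h by (simp add: powr_divide powr_diff powr_minus powr_realpow field_simps)
  have "\<bar>bump_train K (m + k) h I z a x / h ^ k - bump_train K (m + k) h I z a y / h ^ k\<bar>
      \<le> 2 * b * C * h powr - \<alpha> * \<bar>x - y\<bar> powr (\<alpha> - real k)" for x y
  proof -
    have "\<bar>\<Sum>i\<in>I. ?t x i - ?t y i\<bar> \<le> 2 * (b * (C * (\<bar>x - y\<bar> / h) powr (\<alpha> - real k)))"
    proof (rule sum_two_nonzero(2)[OF fin])
      fix i assume i: "i \<in> I"
      have "\<bar>?t x i - ?t y i\<bar> = \<bar>a i\<bar> * \<bar>bump K (m + k) ((x - z i) / h) - bump K (m + k) ((y - z i) / h)\<bar>"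
        by (simp add: abs_mult[symmetric] right_diff_distrib)
      also have "\<dots> \<le> b * (C * \<bar>(x - z i) / h - (y - z i) / h\<bar> powr (\<alpha> - real k))"
        using a i C by (intro mult_mono) auto
      also have "\<bar>(x - z i) / h - (y - z i) / h\<bar> = \<bar>x - y\<bar> / h"
        using h by (simp add: diff_divide_distrib[symmetric] abs_divide)
      finally show "\<bar>?t x i - ?t y i\<bar> \<le> b * (C * (\<bar>x - y\<bar> / h) powr (\<alpha> - real k))" .
    qed (use a C bump_train_unique[OF sep] in auto)
    then have "\<bar>bump_train K (m + k) h I z a x - bump_train K (m + k) h I z a y\<bar> / h ^ k
        \<le> 2 * (b * (C * (\<bar>x - y\<bar> / h) powr (\<alpha> - real k))) / h ^ k"
      using h by (intro divide_right_mono) (auto simp: bump_train_def sum_subtractf)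
    also have "\<dots> = 2 * b * C * ((\<bar>x - y\<bar> / h) powr (\<alpha> - real k) / h ^ k)" by simp
    also have "\<dots> = 2 * b * C * h powr - \<alpha> * \<bar>x - y\<bar> powr (\<alpha> - real k)" by (simp add: scale)
    finally show ?thesis using h by (simp add: diff_divide_distrib[symmetric] abs_divide)
  qed
  moreover have "continuous_on UNIV (\<lambda>x. bump_train K (m + k) h I z a x / h ^ k)"
  proof -
    have "continuous_on UNIV (\<lambda>x. bump K (m + k) ((x - c) / h))" for c
      by (rule continuous_on_compose2[OF bump_continuous]) (use assms h in \<open>auto intro!: continuous_intros\<close>)
    then show ?thesis unfolding bump_train_def using h by (intro continuous_intros) auto
  qed
  ultimately show ?thesis
    unfolding holder_smooth_def assms(2)[symmetric]
    using bump_train_iterated_deriv[of m k K h I z a] assms h by auto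
qed

text \<open>The difference lives on two intervals of length h, however far apart; integrating over
  one interval that contains both would let the bound grow with t.\<close>

lemma nn_integral_bump_shift_diff:
  assumes C: "\<And>x y. \<bar>bump K l x - bump K l y\<bar> \<le> C * \<bar>x - y\<bar> powr \<beta>" "C \<ge> 0" and h: "0 < h"
  shows "(\<integral>\<^sup>+x. ennreal ((bump K l ((x + t - c) / h) - bump K l ((x - c) / h))\<^sup>2) \<partial>lborel)
    \<le> ennreal (2 * h * (C * (\<bar>t\<bar> / h) powr \<beta>)\<^sup>2)"
proof -
  let ?D = "C * (\<bar>t\<bar> / h) powr \<beta>"
  have "(\<integral>\<^sup>+x. ennreal ((bump K l ((x + t - c) / h) - bump K l ((x - c) / h))\<^sup>2) \<partial>lborel)
      \<le> (\<integral>\<^sup>+x. ennreal (?D\<^sup>2) * indicator {c..c+h} x + ennreal (?D\<^sup>2) * indicator {c-t..c-t+h} x \<partial>lborel)"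
  proof (rule nn_integral_mono)
    fix x
    have "\<bar>bump K l ((x + t - c) / h) - bump K l ((x - c) / h)\<bar> \<le> ?D"
      using C(1)[of "(x + t - c) / h" "(x - c) / h"] h by (simp add: diff_divide_distrib[symmetric] abs_divide)
    then have "\<bar>bump K l ((x + t - c) / h) - bump K l ((x - c) / h)\<bar>\<^sup>2 \<le> ?D\<^sup>2"
      by (intro power_mono) auto
    then have D: "ennreal ((bump K l ((x + t - c) / h) - bump K l ((x - c) / h))\<^sup>2) \<le> ennreal (?D\<^sup>2)"
      by (intro ennreal_leI) simp
    show "ennreal ((bump K l ((x + t - c) / h) - bump K l ((x - c) / h))\<^sup>2)
        \<le> ennreal (?D\<^sup>2) * indicator {c..c+h} x + ennreal (?D\<^sup>2) * indicator {c-t..c-t+h} x"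
    proof (cases "x \<in> {c..c+h} \<or> x \<in> {c-t..c-t+h}")
      case True
      then show ?thesis
      proof
        assume "x \<in> {c..c+h}"
        then show ?thesis using D by (intro order_trans[OF D]) simp
      next
        assume "x \<in> {c-t..c-t+h}"
        then show ?thesis using D by (intro order_trans[OF D]) (simp add: add_increasing)
      qed
    next
      case False
      then have "bump K l ((x + t - c) / h) = 0" "bump K l ((x - c) / h) = 0"
        using bump_scaled_nonzero[OF h, of K l "x + t" c] bump_scaled_nonzero[OF h, of K l x c] by force+
      then show ?thesis by simp
    qed
  qed
  also have "\<dots> = ennreal (?D\<^sup>2) * ennreal h + ennreal (?D\<^sup>2) * ennreal h"
    using h by (subst nn_integral_add) (auto simp: nn_integral_cmult_indicator)
  also have "\<dots> = ennreal (2 * h * ?D\<^sup>2)"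
    using h by (simp add: ennreal_mult[symmetric] ennreal_plus[symmetric] algebra_simps del: ennreal_plus)
  finally show ?thesis .
qed

text \<open>Squared L2 norms of the teeth add up, so compared with the Holder case there is an
  additional square root of the total length of the supports.\<close>

lemma bump_train_sobolev_smooth:
  assumes "\<alpha> > 0" "k = strict_floor \<alpha>" "m + k + 1 < K" and sep: "separated h I z"
    and a: "\<And>i. i \<in> I \<Longrightarrow> \<bar>a i\<bar> \<le> b" "b \<ge> 0"
    and C: "\<And>x y. \<bar>bump K (m + k) x - bump K (m + k) y\<bar> \<le> C * \<bar>x - y\<bar> powr (\<alpha> - real k)" "C \<ge> 0"
  shows "sobolev_smooth \<alpha> (2 * b * C * sqrt (real (card I) * h) * h powr - \<alpha>) (bump_train K m h I z a)"
proof -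
  have h: "0 < h" and fin: "finite I" using sep by (auto simp: separated_def)
  let ?g = "\<lambda>x. bump_train K (m + k) h I z a x / h ^ k"
  let ?t = "\<lambda>x i. a i * bump K (m + k) ((x - z i) / h)"
  have "L2norm (\<lambda>x. ?g (x + t) - ?g x)
      \<le> ennreal (2 * b * C * sqrt (real (card I) * h) * h powr - \<alpha> * \<bar>t\<bar> powr (\<alpha> - real k))" for t
  proof -
    let ?D = "C * (\<bar>t\<bar> / h) powr (\<alpha> - real k)"
    let ?\<Delta> = "\<lambda>i x. (bump K (m + k) ((x + t - z i) / h) - bump K (m + k) ((x - z i) / h))\<^sup>2"
    let ?d = "\<lambda>x. (bump_train K (m + k) h I z a (x + t) - bump_train K (m + k) h I z a x)\<^sup>2"
    let ?S = "\<lambda>x. \<Sum>i\<in>I. ennreal (2 * b\<^sup>2 / (h ^ k)\<^sup>2) * ennreal (?\<Delta> i x)"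
    have scale: "?D / h ^ k = C * (h powr - \<alpha> * \<bar>t\<bar> powr (\<alpha> - real k))"
      using h by (simp add: powr_divide powr_diff powr_minus powr_realpow field_simps)
    have "(\<integral>\<^sup>+x. ennreal ((?g (x + t) - ?g x)\<^sup>2) \<partial>lborel)
        \<le> (\<integral>\<^sup>+x. ?S x \<partial>lborel)"
    proof (rule nn_integral_mono)
      fix x
      have "(\<Sum>i\<in>I. ?t (x + t) i - ?t x i)\<^sup>2 \<le> 2 * (\<Sum>i\<in>I. (?t (x + t) i - ?t x i)\<^sup>2)"
        by (rule sum_two_nonzero(1)[OF fin]) (use bump_train_unique[OF sep] in auto)
      also have "(\<Sum>i\<in>I. (?t (x + t) i - ?t x i)\<^sup>2) \<le> (\<Sum>i\<in>I. b\<^sup>2 * ?\<Delta> i x)"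
      proof (rule sum_mono)
        fix i assume "i \<in> I"
        then have "(a i)\<^sup>2 \<le> b\<^sup>2" using a abs_le_square_iff[of "a i" b] by force
        then show "(?t (x + t) i - ?t x i)\<^sup>2 \<le> b\<^sup>2 * ?\<Delta> i x"
          by (simp add: right_diff_distrib[symmetric] power_mult_distrib mult_right_mono)
      qed
      finally have "?d x
          \<le> 2 * (\<Sum>i\<in>I. b\<^sup>2 * ?\<Delta> i x)"
        by (simp add: bump_train_def sum_subtractf)
      then have "?d x / (h ^ k)\<^sup>2
          \<le> 2 * (\<Sum>i\<in>I. b\<^sup>2 * ?\<Delta> i x) / (h ^ k)\<^sup>2"
        by (rule divide_right_mono) simp
      also have "\<dots> = (\<Sum>i\<in>I. (2 * b\<^sup>2 / (h ^ k)\<^sup>2) * ?\<Delta> i x)"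
        by (simp add: sum_distrib_left sum_divide_distrib mult.assoc)
      finally have "(?g (x + t) - ?g x)\<^sup>2
          \<le> (\<Sum>i\<in>I. (2 * b\<^sup>2 / (h ^ k)\<^sup>2) * ?\<Delta> i x)"
        by (simp add: diff_divide_distrib[symmetric] power_divide)
      then have "ennreal ((?g (x + t) - ?g x)\<^sup>2)
          \<le> ennreal (\<Sum>i\<in>I. (2 * b\<^sup>2 / (h ^ k)\<^sup>2) * ?\<Delta> i x)" by (rule ennreal_leI)
      also have "\<dots> = ?S x"
        by (subst sum_ennreal[symmetric], simp, intro sum.cong refl ennreal_mult) simp_all
      finally show "ennreal ((?g (x + t) - ?g x)\<^sup>2)
          \<le> ?S x" .
    qed
    also have "\<dots> = (\<Sum>i\<in>I. ennreal (2 * b\<^sup>2 / (h ^ k)\<^sup>2) * (\<integral>\<^sup>+x. ennreal (?\<Delta> i x) \<partial>lborel))"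
      by (subst nn_integral_sum) (auto simp: nn_integral_cmult)
    also have "\<dots> \<le> (\<Sum>i\<in>I. ennreal (2 * b\<^sup>2 / (h ^ k)\<^sup>2) * ennreal (2 * h * ?D\<^sup>2))"
      using C h by (intro sum_mono mult_left_mono nn_integral_bump_shift_diff) auto
    also have "\<dots> = (\<Sum>i\<in>I. ennreal (2 * b\<^sup>2 / (h ^ k)\<^sup>2 * (2 * h * ?D\<^sup>2)))"
      using h by (intro sum.cong refl ennreal_mult[symmetric]) auto
    also have "\<dots> = ennreal (\<Sum>i\<in>I. 2 * b\<^sup>2 / (h ^ k)\<^sup>2 * (2 * h * ?D\<^sup>2))"
      using h by (intro sum_ennreal) auto
    also have "(\<Sum>i\<in>I. 2 * b\<^sup>2 / (h ^ k)\<^sup>2 * (2 * h * ?D\<^sup>2))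
        = real (card I) * (2 * b\<^sup>2 / (h ^ k)\<^sup>2 * (2 * h * ?D\<^sup>2))" by simp
    also have "real (card I) * (2 * b\<^sup>2 / (h ^ k)\<^sup>2 * (2 * h * ?D\<^sup>2)) = (2 * b * sqrt (real (card I) * h) * (?D / h ^ k))\<^sup>2"
      using h by (simp add: power_mult_distrib power_divide field_simps)
    finally show ?thesis using h a C unfolding scale
      by (subst L2norm_le_iff) (auto simp: ac_simps)
  qed
  then show ?thesis
    unfolding sobolev_smooth_def assms(2)[symmetric]
    using bump_train_iterated_deriv[of m k K h I z a] assms h by auto
qed

section \<open>Moments and the base density\<close>

text \<open>Weighted arithmetic-geometric mean of 1 and |t|^p, from convexity of exp.\<close>

lemma abs_powr_le_interpolation:
  fixes t r p :: real
  assumes "0 < r" "r \<le> p"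
  shows "\<bar>t\<bar> powr r \<le> (1 - r / p) + r / p * \<bar>t\<bar> powr p"
proof (cases "t = 0")
  case False
  define L where "L = p * ln \<bar>t\<bar>"
  have "exp ((1 - r / p) *\<^sub>R 0 + (r / p) *\<^sub>R L) \<le> (1 - r / p) * exp 0 + (r / p) * exp L"
    by (rule convex_onD[OF exp_convex]) (use assms in auto)
  moreover have "r / p * L = r * ln \<bar>t\<bar>" using assms by (simp add: L_def)
  ultimately show ?thesis using False by (simp add: powr_def L_def)
qed (use assms in auto)

text \<open>A lower moment is at most a convex combination of the total mass 1 and the p-th moment.
  As B >= 1, only the p-th moment has to be controlled from here on.\<close>

lemma abs_moment_le_of_le:
  assumes f: "prob_density f" and "0 < r" "r \<le> p" "1 \<le> B" "abs_moment p f \<le> ennreal B"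
  shows "abs_moment r f \<le> ennreal B"
proof -
  have [measurable]: "f \<in> borel_measurable borel" and f0: "\<And>x. 0 \<le> f x"
    and f1: "(\<integral>\<^sup>+x. f x \<partial>lborel) = 1"
    using f by (auto simp: prob_density_def)
  define q where "q = r / p"
  have q: "0 \<le> q" "q \<le> 1" using assms by (auto simp: q_def)
  have "abs_moment r f \<le> (\<integral>\<^sup>+t. ennreal (1 - q) * ennreal (f t)
      + ennreal (q) * ennreal (\<bar>t\<bar> powr p * f t) \<partial>lborel)"
    unfolding abs_moment_def
  proof (rule nn_integral_mono)
    fix t
    have "\<bar>t\<bar> powr r * f t \<le> ((1 - q) + q * \<bar>t\<bar> powr p) * f t"
      by (intro mult_right_mono abs_powr_le_interpolation[of r p, folded q_def] assms f0)
    also have "\<dots> = (1 - q) * f t + q * (\<bar>t\<bar> powr p * f t)" by (simp add: algebra_simps)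
    finally have "ennreal (\<bar>t\<bar> powr r * f t) \<le> ennreal ((1 - q) * f t + q * (\<bar>t\<bar> powr p * f t))"
      by (rule ennreal_leI)
    also have "\<dots> = ennreal (1 - q) * ennreal (f t) + ennreal (q) * ennreal (\<bar>t\<bar> powr p * f t)"
      using q f0 by (subst ennreal_plus) (auto simp: ennreal_mult simp del: ennreal_plus)
    finally show "ennreal (\<bar>t\<bar> powr r * f t)
        \<le> ennreal (1 - q) * ennreal (f t) + ennreal (q) * ennreal (\<bar>t\<bar> powr p * f t)" .
  qed
  also have "\<dots> = ennreal (1 - q) * (\<integral>\<^sup>+t. f t \<partial>lborel) + ennreal (q) * abs_moment p f"
    unfolding abs_moment_def by (subst nn_integral_add) (auto simp: nn_integral_cmult)
  also have "\<dots> \<le> ennreal (1 - q) * ennreal B + ennreal (q) * ennreal B"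
    using assms by (intro add_mono mult_left_mono) (auto simp: f1)
  also have "\<dots> = ennreal B"
    using q assms by (simp add: distrib_right[symmetric] flip: ennreal_plus)
  finally show ?thesis .
qed

text \<open>Fatou's lemma along the orders p / (n + 1), which tend to 0: the powers of |t| tend to 1
  except at t = 0, a null set where they are 0.\<close>

lemma moment_class_ge_1:
  assumes "f \<in> moment_class p B" "p > 0"
  shows "1 \<le> B"
proof -
  have [measurable]: "f \<in> borel_measurable borel" and f0: "\<And>x. 0 \<le> f x"
    and f1: "(\<integral>\<^sup>+x. f x \<partial>lborel) = 1"
    using assms by (auto simp: moment_class_def prob_density_def)
  define r where "r n = p / real (Suc n)" for n
  have r: "r n \<in> {0<..p}" for n using assms(2) by (auto simp: r_def field_simps)
  have "(SUP r\<in>{0<..p}. abs_moment r f) \<le> ennreal B"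
    using assms(1) by (simp add: moment_class_def)
  then have le: "abs_moment (r n) f \<le> ennreal B" for n
    using r[of n] by (meson SUP_upper order_trans)
  have "r \<longlonglongrightarrow> 0"
    unfolding r_def by (rule LIMSEQ_Suc[OF lim_const_over_n])
  have "(\<integral>\<^sup>+t. f t \<partial>lborel) = (\<integral>\<^sup>+t. liminf (\<lambda>n. ennreal (\<bar>t\<bar> powr r n * f t)) \<partial>lborel)"
  proof (rule nn_integral_cong_AE)
    have "AE t in lborel. t \<noteq> (0::real)" by (rule AE_lborel_singleton)
    then show "AE t in lborel. ennreal (f t) = liminf (\<lambda>n. ennreal (\<bar>t\<bar> powr r n * f t))"
    proof eventually_elim
      case (elim t)
      have "(\<lambda>n. \<bar>t\<bar> powr r n * f t) \<longlonglongrightarrow> \<bar>t\<bar> powr 0 * f t"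
        using elim by (intro tendsto_intros \<open>r \<longlonglongrightarrow> 0\<close>) auto
      then have "(\<lambda>n. ennreal (\<bar>t\<bar> powr r n * f t)) \<longlonglongrightarrow> ennreal (f t)"
        using elim by (intro tendsto_ennrealI) auto
      then show ?case by (intro lim_imp_Liminf[symmetric]) auto
    qed
  qed
  also have "\<dots> \<le> liminf (\<lambda>n. abs_moment (r n) f)"
    unfolding abs_moment_def by (rule nn_integral_liminf) measurable
  also have "\<dots> \<le> liminf (\<lambda>n. ennreal B)" by (intro Liminf_mono always_eventually allI le)
  also have "\<dots> = ennreal B" by (simp add: Liminf_const)
  finally have "ennreal 1 \<le> ennreal B" using f1 by simp
  then show ?thesis by (simp add: ennreal_le_iff2)
qed

lemma moment_classI:
  assumes "prob_density f" "AE x in lborel. f x \<le> B" "abs_moment p f \<le> ennreal B" "1 \<le> B" "p > 0"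
  shows "f \<in> moment_class p B"
proof -
  have f: "f \<in> borel_measurable borel" "\<And>x. 0 \<le> f x" using assms(1) by (auto simp: prob_density_def)
  have "AE x in lborel. ennreal \<bar>f x\<bar> \<le> ennreal B"
    using assms(2) by eventually_elim (simp add: f(2) ennreal_leI)
  then have "Linf_norm f \<le> ennreal B"
    unfolding Linf_norm_def using f(1) by (intro esssup_I) measurable
  moreover have "(SUP r\<in>{0<..p}. abs_moment r f) \<le> ennreal B"
  proof (rule SUP_least)
    fix r assume "r \<in> {0<..p}"
    then have "0 < r" "r \<le> p" by auto
    from abs_moment_le_of_le[OF assms(1) this assms(4,3)] show "abs_moment r f \<le> ennreal B" .
  qed
  ultimately show ?thesis using assms(1) by (simp add: moment_class_def)
qed

lemma moment_class_AE_le: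
  assumes "f \<in> moment_class p B" "B > 0"
  shows "AE x in lborel. f x \<le> B"
proof -
  have "AE x in lborel. ennreal \<bar>f x\<bar> \<le> Linf_norm f"
    unfolding Linf_norm_def by (rule esssup_AE)
  then show ?thesis
  proof eventually_elim
    case (elim x)
    also have "Linf_norm f \<le> ennreal B" using assms by (simp add: moment_class_def)
    finally show ?case using assms(2) by (subst (asm) ennreal_le_iff) auto
  qed
qed

text \<open>A probability density on (-s/2, s/2), written as a train with a single tooth so that the
  smoothness bounds for trains apply to it.\<close>

definition wide_bump :: "nat \<Rightarrow> real \<Rightarrow> real \<Rightarrow> real" where
  "wide_bump K s = bump_train K 0 s {()} (\<lambda>_. - s / 2) (\<lambda>_. 1 / (s * (\<integral>x. bump K 0 x \<partial>lborel)))"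

lemma bump_0_integral_pos: "0 < (\<integral>x. bump K 0 x \<partial>lborel)"
proof -
  have ind: "integrable lborel (indicat_real {1/4..3/4::real})"
  proof (rule integrable_real_indicator)
    have "emeasure lborel {1/4..3/4::real} = ennreal (1/2)" by (subst emeasure_lborel_Icc) auto
    then show "emeasure lborel {1/4..3/4::real} < \<infinity>"
      by (simp only: infinity_ennreal_def ennreal_less_top)
  qed simp
  have "0 < (3/16) ^ K * (1/2 :: real)" by simp
  also have "\<dots> = (\<integral>x. (3/16) ^ K * indicator {1/4..3/4::real} x \<partial>lborel)" by simp
  also have "\<dots> \<le> (\<integral>x. bump K 0 x \<partial>lborel)"
  proof (rule integral_mono[OF integrable_mult_right[OF ind] bump_integrable])
    show "(3/16) ^ K * indicator {1/4..3/4::real} x \<le> bump K 0 x" for x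
      using bump_0_lower[of x K] bump_0_nonneg[of K x] by (simp add: indicator_def)
  qed
  finally show ?thesis .
qed

lemma wide_bump_eq: "wide_bump K s x = bump K 0 ((x + s / 2) / s) / (s * (\<integral>x. bump K 0 x \<partial>lborel))"
  by (simp add: wide_bump_def bump_train_def)

lemma wide_bump_facts:
  assumes "0 < s"
  shows "0 \<le> wide_bump K s x" "wide_bump K s \<in> borel_measurable borel"
    "(\<integral>\<^sup>+x. wide_bump K s x \<partial>lborel) = 1"
    "s / 2 \<le> \<bar>x\<bar> \<Longrightarrow> wide_bump K s x = 0"
    "\<bar>x\<bar> \<le> s / 4 \<Longrightarrow> (3/16) ^ K / (\<integral>x. bump K 0 x \<partial>lborel) / s \<le> wide_bump K s x"
proof -
  define I where "I = (\<integral>x. bump K 0 x \<partial>lborel)"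
  have I: "0 < I" using bump_0_integral_pos by (simp add: I_def)
  show "0 \<le> wide_bump K s x"
    using bump_0_nonneg I assms by (simp add: wide_bump_eq I_def[symmetric])
  show [measurable]: "wide_bump K s \<in> borel_measurable borel" unfolding wide_bump_def by measurable
  have "(\<integral>\<^sup>+x. wide_bump K s x \<partial>lborel)
      = ennreal s * (\<integral>\<^sup>+x. wide_bump K s (- s / 2 + s * x) \<partial>lborel)"
    using nn_integral_real_affine[of "\<lambda>x. ennreal (wide_bump K s x)" s "- s / 2"] assms by simp
  also have "(\<lambda>x. ennreal (wide_bump K s (- s / 2 + s * x))) = (\<lambda>x. ennreal (1 / (s * I)) * ennreal (bump K 0 x))"
    using assms I bump_0_nonneg by (auto simp: wide_bump_eq I_def[symmetric] simp flip: ennreal_mult)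
  also have "ennreal s * (\<integral>\<^sup>+x. ennreal (1 / (s * I)) * ennreal (bump K 0 x) \<partial>lborel)
      = ennreal s * (ennreal (1 / (s * I)) * ennreal I)"
    using bump_0_nonneg by (simp add: nn_integral_cmult nn_integral_eq_integral[OF bump_integrable] I_def)
  also have "\<dots> = 1" using assms I by (simp flip: ennreal_mult)
  finally show "(\<integral>\<^sup>+x. wide_bump K s x \<partial>lborel) = 1" .
  show "wide_bump K s x = 0" if "s / 2 \<le> \<bar>x\<bar>"
  proof -
    have "\<not> (0 < (x + s / 2) / s \<and> (x + s / 2) / s < 1)"
      using that assms by (auto simp: zero_less_divide_iff divide_less_eq)
    then show ?thesis by (simp add: wide_bump_eq bump_eq_0)
  qed
  assume x: "\<bar>x\<bar> \<le> s / 4"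
  have "(3/16) ^ K \<le> bump K 0 ((x + s / 2) / s)"
    using x assms by (intro bump_0_lower) (auto simp: field_simps)
  then show "(3/16) ^ K / (\<integral>x. bump K 0 x \<partial>lborel) / s \<le> wide_bump K s x"
    using assms I by (simp add: wide_bump_eq I_def[symmetric] divide_right_mono field_simps)
qed

lemma wide_bump_moment:
  assumes "0 < s" "0 < p"
  shows "abs_moment p (wide_bump K s) \<le> ennreal (s powr p)"
proof -
  note [measurable] = wide_bump_facts(2)[OF assms(1)]
  have "abs_moment p (wide_bump K s) \<le> (\<integral>\<^sup>+t. ennreal (s powr p) * ennreal (wide_bump K s t) \<partial>lborel)"
    unfolding abs_moment_def
  proof (rule nn_integral_mono)
    fix t
    have "\<bar>t\<bar> powr p * wide_bump K s t \<le> s powr p * wide_bump K s t"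
    proof (cases "s / 2 \<le> \<bar>t\<bar>")
      case False
      then show ?thesis using assms wide_bump_facts(1)[OF assms(1)]
        by (intro mult_right_mono powr_mono2) auto
    qed (use wide_bump_facts(4)[OF assms(1)] in auto)
    then show "ennreal (\<bar>t\<bar> powr p * wide_bump K s t) \<le> ennreal (s powr p) * ennreal (wide_bump K s t)"
      using wide_bump_facts(1)[OF assms(1)] by (simp flip: ennreal_mult add: ennreal_leI)
  qed
  also have "\<dots> = ennreal (s powr p)"
    by (simp add: nn_integral_cmult wide_bump_facts(3)[OF assms(1)])
  finally show ?thesis .
qed

lemma separated_singleton: "0 < s \<Longrightarrow> separated s {i} z"
  by (simp add: separated_def)

lemma wide_bump_le:
  assumes "a > 0"
  shows "\<exists>s\<^sub>1\<ge>1. \<forall>s\<ge>s\<^sub>1. \<forall>x. wide_bump K s x \<le> a"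
proof -
  obtain C where C: "\<And>x. \<bar>bump K 0 x\<bar> \<le> C" using bump_bounded by blast
  define I where "I = (\<integral>x. bump K 0 x \<partial>lborel)"
  have I: "0 < I" using bump_0_integral_pos by (simp add: I_def)
  have "wide_bump K s x \<le> a" if s: "s \<ge> max 1 (C / (I * a))" for s x
  proof -
    have "bump K 0 ((x + s / 2) / s) \<le> C" using C abs_le_D1 by blast
    also have "C \<le> a * (s * I)" using s I assms by (auto simp: field_simps)
    finally show ?thesis using s I by (simp add: wide_bump_eq I_def[symmetric] divide_le_eq)
  qed
  then show ?thesis by (intro exI[of _ "max 1 (C / (I * a))"]) auto
qed

text \<open>Stretching flattens: the Holder constant is of order s^(-1-alpha), the Sobolev constant
  of order s^(-1/2-alpha). A far-stretched component of a mixture thus costs little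
  smoothness.\<close>

lemma wide_bump_smooth:
  assumes "\<alpha> > 0" "strict_floor \<alpha> + 2 \<le> K" "a > 0"
  shows "\<exists>s\<^sub>1\<ge>1. \<forall>s\<ge>s\<^sub>1. holder_smooth \<alpha> a (wide_bump K s) \<and>
    (\<alpha> > 1/2 \<longrightarrow> sobolev_smooth \<alpha> a (wide_bump K s))"
proof -
  define k where "k = strict_floor \<alpha>"
  have "0 < \<alpha> - real k" "\<alpha> - real k \<le> 1" "k + 2 \<le> K"
    using strict_floor_bounds[OF assms(1)] assms(2) by (auto simp: k_def)
  from bump_holder_upto[OF this] obtain C where C0: "C > 0"
    and "\<forall>l\<le>k. (\<forall>x. \<bar>bump K l x\<bar> \<le> C) \<and>
      (\<forall>x y. \<bar>bump K l x - bump K l y\<bar> \<le> C * \<bar>x - y\<bar> powr (\<alpha> - real k))"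
    by (elim exE conjE)
  then have C: "\<bar>bump K k x - bump K k y\<bar> \<le> C * \<bar>x - y\<bar> powr (\<alpha> - real k)" for x y
    by simp
  define I where "I = (\<integral>x. bump K 0 x \<partial>lborel)"
  have I: "0 < I" using bump_0_integral_pos by (simp add: I_def)
  have "holder_smooth \<alpha> a (wide_bump K s) \<and> (\<alpha> > 1/2 \<longrightarrow> sobolev_smooth \<alpha> a (wide_bump K s))"
    if s: "s \<ge> max 1 (2 * C / (I * a))" for s
  proof (intro conjI impI)
    have s1: "s \<ge> 1" using s by simp
    have b: "2 * (1 / (s * I)) * C \<le> a" using s s1 I assms C0 by (auto simp: field_simps)
    have "s powr - \<alpha> \<le> s powr 0" using s1 assms by (intro powr_mono) auto
    then have "2 * (1 / (s * I)) * C * s powr - \<alpha> \<le> a * 1"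
      using s1 I C0 b assms by (intro mult_mono) auto
    then show "holder_smooth \<alpha> a (wide_bump K s)"
      unfolding wide_bump_def I_def[symmetric]
      by (intro holder_smooth_mono[OF bump_train_holder_smooth[where k = k and C = C and b = "1 / (s * I)"]])
        (use s1 I C C0 assms in \<open>auto simp: k_def separated_singleton\<close>)
    assume "\<alpha> > 1/2"
    have "sqrt s * s powr - \<alpha> = s powr (1/2 - \<alpha>)"
      using s1 by (simp add: powr_half_sqrt[symmetric] powr_add[symmetric])
    also have "\<dots> \<le> s powr 0" using s1 \<open>\<alpha> > 1/2\<close> by (intro powr_mono) auto
    finally have "2 * (1 / (s * I)) * C * (sqrt s * s powr - \<alpha>) \<le> a * 1"
      using s1 I C0 b assms by (intro mult_mono) auto
    then show "sobolev_smooth \<alpha> a (wide_bump K s)"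
      unfolding wide_bump_def I_def[symmetric]
      by (intro sobolev_smooth_mono[OF bump_train_sobolev_smooth[where k = k and C = C and b = "1 / (s * I)"]])
        (use s1 I C C0 assms in \<open>auto simp: k_def separated_singleton mult.assoc\<close>)
  qed
  then show ?thesis by (intro exI[of _ "max 1 (2 * C / (I * a))"]) auto
qed

text \<open>\<open>A'\<close> and \<open>c\<close> are parameters because they must not depend on
  \<open>s\<close>. The base density and the admissible height \<open>\<eta>\<close> may: in the end
  \<open>s\<close> is fixed and only the height of the comb tends to 0 with the sample size.\<close>

definition perturbable ::
  "(real \<Rightarrow> (real \<Rightarrow> real) \<Rightarrow> bool) \<Rightarrow> (real \<Rightarrow> real) set \<Rightarrow> real \<Rightarrow> real \<Rightarrow> real \<Rightarrow> real \<Rightarrow> bool" where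
  "perturbable H \<F> p A' c s \<longleftrightarrow> (\<exists>f\<^sub>0. \<exists>\<eta>>0. \<forall>v.
    v \<in> borel_measurable borel \<longrightarrow> (\<forall>x. \<bar>v x\<bar> \<le> \<eta>) \<longrightarrow> (\<forall>x. s / 4 < \<bar>x\<bar> \<longrightarrow> v x = 0) \<longrightarrow>
    integrable lborel v \<longrightarrow> (\<integral>x. v x \<partial>lborel) = 0 \<longrightarrow> H A' v \<longrightarrow>
      (\<lambda>x. f\<^sub>0 x + v x) \<in> \<F> \<and> (\<forall>x. \<bar>x\<bar> \<le> s / 4 \<longrightarrow> c * s powr (- p - 1) \<le> f\<^sub>0 x + v x))"

text \<open>The far-out mass \<open>e * s powr - p\<close> costs only \<open>e\<close> in the \<open>p\<close>-th moment, but keeps the density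
  above a multiple of \<open>s powr (- p - 1)\<close> on an interval of length of order \<open>s\<close>.\<close>

lemma base_density_exists:
  fixes H :: "real \<Rightarrow> (real \<Rightarrow> real) \<Rightarrow> bool" and A B p :: real
  defines "\<F> \<equiv> {f. prob_density f \<and> H A f} \<inter> moment_class p B"
  assumes mono: "\<And>a b f. H a f \<Longrightarrow> a \<le> b \<Longrightarrow> H b f"
    and linear: "\<And>a b c d f g. H a f \<Longrightarrow> H b g \<Longrightarrow> 0 < a \<Longrightarrow> 0 < b \<Longrightarrow> 0 < c \<Longrightarrow> 0 < d \<Longrightarrow>
      H (c * a + d * b) (\<lambda>x. c * f x + d * g x)"
    and wide: "\<And>a. a > 0 \<Longrightarrow> \<exists>s\<^sub>1\<ge>1. \<forall>s\<ge>s\<^sub>1. H a (wide_bump K s)"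
    and slack: "moment_slack p B \<F>" and pos: "A > 0" "B > 0" "p > 0"
  shows "\<exists>A'>0. \<exists>c>0. \<exists>s\<^sub>0\<ge>1. \<forall>s\<ge>s\<^sub>0. perturbable H \<F> p A' c s"
proof -
  obtain f where f: "prob_density f" "H A f" "f \<in> moment_class p B" "abs_moment p f < ennreal B"
    using slack by (auto simp: moment_slack_def \<F>_def)
  have [measurable]: "f \<in> borel_measurable borel" and f0: "\<And>x. 0 \<le> f x"
    and f1: "(\<integral>\<^sup>+x. f x \<partial>lborel) = 1"
    using f by (auto simp: prob_density_def)
  have B1: "1 \<le> B" using moment_class_ge_1[OF f(3) pos(3)] .
  obtain \<mu> where \<mu>: "abs_moment p f = ennreal \<mu>" "0 \<le> \<mu>" "\<mu> < B"
    using f(4) pos by (cases "abs_moment p f") (auto simp: ennreal_less_iff)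
  define g where "g = B - \<mu>"
  have g: "0 < g" using \<mu> by (simp add: g_def)
  obtain s1 where s1: "1 \<le> s1" "\<And>s. s \<ge> s1 \<Longrightarrow> H (A / 2) (wide_bump K s)"
    "\<And>s x. s \<ge> s1 \<Longrightarrow> wide_bump K s x \<le> B / 2"
  proof -
    obtain a where a: "1 \<le> a" "\<forall>s\<ge>a. H (A / 2) (wide_bump K s)" using wide[of "A / 2"] pos by auto
    obtain b where b: "1 \<le> b" "\<forall>s\<ge>b. \<forall>x. wide_bump K s x \<le> B / 2" using wide_bump_le[of "B / 2" K] pos by auto
    show thesis by (rule that[of "max a b"]) (use a b in auto)
  qed
  define r0 where "r0 = (3/16) ^ K / (\<integral>x. bump K 0 x \<partial>lborel)"
  have r0: "0 < r0" using bump_0_integral_pos[of K] by (simp add: r0_def)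
  \<comment> \<open>Two mixture weights with different purposes. \<open>e0\<close>, at the fixed
    scale \<open>s1\<close>, frees smoothness \<open>A'\<close> and height for the perturbation,
    uniformly in \<open>s\<close>; \<open>e1\<close>, later multiplied by s^(-p), carries the
    far-out mass. The moment slack \<open>g\<close> is split into thirds for \<open>e0\<close>,
    \<open>e1\<close> and the perturbation.\<close>
  define e0 where "e0 = min (1/4) (g / (3 * s1 powr p))"
  define e1 where "e1 = min (1/4) (g / 3)"
  have e0: "0 < e0" "e0 \<le> 1/4" "e0 * s1 powr p \<le> g / 3"
  proof -
    have "e0 * s1 powr p \<le> g / (3 * s1 powr p) * s1 powr p"
      unfolding e0_def by (intro mult_right_mono) auto
    then show "e0 * s1 powr p \<le> g / 3" using s1(1) by simp
  qed (use g s1(1) in \<open>auto simp: e0_def\<close>)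
  have e1: "0 < e1" "e1 \<le> 1/4" "e1 \<le> g / 3" using g by (auto simp: e1_def)
  define A' where "A' = e0 * A / 2"
  define c where "c = e1 * r0 / 2"
  have main: "perturbable H \<F> p A' c s"
    if s: "s \<ge> s1" for s
  proof -
    have s_pos: "0 < s" "0 < s1" "1 \<le> s" using s s1(1) by auto
    note w1 = wide_bump_facts[OF s_pos(2), where K = K] and w2 = wide_bump_facts[OF s_pos(1), where K = K]
    note [measurable] = w1(2) w2(2)
    define e where "e = e1 * s powr - p"
    have "s powr - p \<le> s powr 0" using s_pos pos by (intro powr_mono) auto
    then have "e \<le> e1 * 1" unfolding e_def using e1 s_pos by (intro mult_left_mono) auto
    then have e: "0 < e" "e \<le> 1/4" using e1 s_pos by (simp add: e_def, linarith)
    have es: "e * s powr p = e1" using s_pos by (simp add: e_def powr_minus)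
    define f0 where "f0 x = (1 - e0 - e) * f x + (e0 * wide_bump K s1 x + e * wide_bump K s x)" for x
    have c1: "0 < 1 - e0 - e" "1 - e0 - e \<le> 1" using e0 e by auto
    have f0_nonneg: "0 \<le> f0 x" for x
      unfolding f0_def using c1 e0 e w1(1) w2(1) f0 by (intro add_nonneg_nonneg mult_nonneg_nonneg) auto
    have [measurable]: "f0 \<in> borel_measurable borel" unfolding f0_def by measurable
    have f0_ennreal: "ennreal (f0 x) = ennreal (1 - e0 - e) * ennreal (f x)
        + (ennreal e0 * ennreal (wide_bump K s1 x) + ennreal e * ennreal (wide_bump K s x))" for x
      unfolding f0_def using c1 e0 e w1(1) w2(1) f0
      by (simp add: ennreal_plus[symmetric] ennreal_mult[symmetric] del: ennreal_plus)
    have "(\<integral>\<^sup>+x. f0 x \<partial>lborel) = ennreal (1 - e0 - e) + (ennreal e0 + ennreal e)"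
      unfolding f0_ennreal by (simp add: nn_integral_add nn_integral_cmult f1 w1(3) w2(3))
    also have "\<dots> = 1" using c1 e0 e by (simp add: ennreal_plus[symmetric] del: ennreal_plus)
    finally have f0_dens: "prob_density f0" using f0_nonneg by (simp add: prob_density_def)
    have H0: "H (A - A') f0"
    proof (rule mono)
      show "H ((1 - e0 - e) * A + 1 * (e0 * (A / 2) + e * (A / 2))) f0"
        using linear[OF f(2) linear[OF s1(2)[OF order_refl] s1(2)[OF s], of e0 e], of "1 - e0 - e" 1]
          pos e0 e c1 by (simp add: f0_def[abs_def] add_pos_pos)
      \<comment> \<open>Mass e0 + e has moved from smoothness bound A to A / 2, which leaves at
        least e0 A / 2 = A' to the perturbation.\<close>
      show "(1 - e0 - e) * A + 1 * (e0 * (A / 2) + e * (A / 2)) \<le> A - A'"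
        using pos e unfolding A'_def by (simp add: algebra_simps)
    qed
    \<comment> \<open>In this order, the three bounds keep the supremum below B, the moment of the
      perturbation on [-s, s] below g / 3, and the density above its floor.\<close>
    define \<eta> where "\<eta> = Min {e0 * B / 2, g / (6 * s powr (p + 1)), c * s powr (- p - 1)}"
    have c: "0 < c" using e1 r0 by (simp add: c_def)
    have \<eta>: "0 < \<eta>" "\<eta> \<le> e0 * B / 2" "\<eta> \<le> g / (6 * s powr (p + 1))" "\<eta> \<le> c * s powr (- p - 1)"
      using e0 pos g s_pos c by (auto simp: \<eta>_def)
    have good: "(\<lambda>x. f0 x + v x) \<in> \<F> \<and> (\<forall>x. \<bar>x\<bar> \<le> s / 4 \<longrightarrow> c * s powr (- p - 1) \<le> f0 x + v x)"
      if v [measurable]: "v \<in> borel_measurable borel" and v_le: "\<And>x. \<bar>v x\<bar> \<le> \<eta>"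
        and v_supp: "\<And>x. s / 4 < \<bar>x\<bar> \<Longrightarrow> v x = 0"
        and v_int: "integrable lborel v" "(\<integral>x. v x \<partial>lborel) = 0" and Hv: "H A' v" for v
    proof -
      have lower: "c * s powr (- p - 1) \<le> f0 x + v x" if "\<bar>x\<bar> \<le> s / 4" for x
      proof -
        \<comment> \<open>The base density is at least twice the claimed floor, and the perturbation
          takes away at most half of that.\<close>
        have "2 * (c * s powr (- p - 1)) = e * (r0 / s)"
          using s_pos by (simp add: c_def e_def powr_diff field_simps)
        also have "\<dots> \<le> e * wide_bump K s x" 
          using e by (intro mult_left_mono w2(5)[OF that, folded r0_def]) simp
        also have "\<dots> \<le> f0 x"
          unfolding f0_def using c1 e0 w1(1) f0 by simp
        finally show ?thesis using v_le[of x] \<eta>(4) by linarith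
      qed
      have nonneg: "0 \<le> f0 x + v x" for x
      proof (cases "\<bar>x\<bar> \<le> s / 4")
        case True
        have "0 \<le> c * s powr (- p - 1)" using c by simp
        then show ?thesis using lower[OF True] by linarith
      qed (use v_supp[of x] f0_nonneg[of x] in auto)
      have dens: "prob_density (\<lambda>x. f0 x + v x)"
        by (rule prob_density_perturb[OF f0_dens v nonneg v_int])
      have "H (1 * (A - A') + 1 * A') (\<lambda>x. 1 * f0 x + 1 * v x)"
        using pos e0 by (intro linear H0 Hv) (auto simp: A'_def)
      then have HA: "H A (\<lambda>x. f0 x + v x)" by simp
      have le_B: "AE x in lborel. f0 x + v x \<le> B"
        using moment_class_AE_le[OF f(3) pos(2)]
      proof eventually_elim
        case (elim x)
        have "f0 x \<le> (1 - e0 - e) * B + (e0 * (B / 2) + e * (B / 2))"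
          unfolding f0_def using elim c1 e0 e s1(3) s by (intro add_mono mult_left_mono) auto
        also have "\<dots> \<le> B - e0 * B / 2" using e pos by (simp add: algebra_simps)
        finally show ?case using v_le[of x] \<eta>(2) by linarith
      qed
      let ?m = "\<lambda>t. (\<bar>t\<bar> powr p * f t
          + e0 * (\<bar>t\<bar> powr p * wide_bump K s1 t))
          + (e * (\<bar>t\<bar> powr p * wide_bump K s t) + \<eta> * s powr p * indicator {-s..s} t)"
      let ?M = "\<lambda>t. (ennreal (\<bar>t\<bar> powr p * f t)
          + ennreal e0 * ennreal (\<bar>t\<bar> powr p * wide_bump K s1 t))
          + (ennreal e * ennreal (\<bar>t\<bar> powr p * wide_bump K s t)
          + ennreal (\<eta> * s powr p) * indicator {-s..s} t)"
      have "abs_moment p (\<lambda>x. f0 x + v x) \<le> (\<integral>\<^sup>+t. ?M t \<partial>lborel)"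
        unfolding abs_moment_def
      proof (rule nn_integral_mono)
        fix t
        have "\<bar>t\<bar> powr p * v t \<le> \<eta> * s powr p * indicator {-s..s} t"
        proof (cases "s / 4 < \<bar>t\<bar>")
          case False
          have "v t \<le> \<eta>" using v_le[of t] by linarith
          then have "\<bar>t\<bar> powr p * v t \<le> \<bar>t\<bar> powr p * \<eta>" by (rule mult_left_mono) simp
          also have "\<dots> \<le> s powr p * \<eta>"
            using False s_pos pos \<eta>(1) by (intro mult_right_mono powr_mono2) auto
          finally have "\<bar>t\<bar> powr p * v t \<le> \<eta> * s powr p" by (simp add: mult.commute)
          moreover have "t \<in> {-s..s}" using False s_pos by auto
          ultimately show ?thesis by simp
        qed (use v_supp \<eta> in simp)
        moreover have "\<bar>t\<bar> powr p * ((1 - e0 - e) * f t) \<le> \<bar>t\<bar> powr p * (1 * f t)"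
          using c1 f0 by (intro mult_left_mono mult_right_mono) auto
        ultimately have "\<bar>t\<bar> powr p * (f0 t + v t) \<le> ?m t"
          unfolding f0_def by (simp add: algebra_simps)
        then have "ennreal (\<bar>t\<bar> powr p * (f0 t + v t)) \<le> ennreal (?m t)"
          by (rule ennreal_leI)
        also have "\<dots> = ?M t"
        proof -
          have i: "ennreal (\<eta> * s powr p) * indicator {-s..s} t = ennreal (\<eta> * s powr p * indicator {-s..s} t)"
            by (simp add: indicator_def)
          show ?thesis unfolding i
            using w1(1)[of t] w2(1)[of t] f0[of t] e0 e \<eta>(1)
            by (simp add: ennreal_mult'[symmetric] ennreal_plus[symmetric] del: ennreal_plus)
        qed
        finally show "ennreal (\<bar>t\<bar> powr p * (f0 t + v t)) \<le> ?M t" .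
      qed
      also have "\<dots> = (abs_moment p f + ennreal e0 * abs_moment p (wide_bump K s1))
          + (ennreal e * abs_moment p (wide_bump K s) + ennreal (\<eta> * s powr p) * ennreal (2 * s))"
        unfolding abs_moment_def using s_pos
        by (simp add: nn_integral_add nn_integral_cmult nn_integral_cmult_indicator)
      also have "\<dots> \<le> (ennreal \<mu> + ennreal e0 * ennreal (s1 powr p))
          + (ennreal e * ennreal (s powr p) + ennreal (\<eta> * s powr p) * ennreal (2 * s))"
        using \<mu> s_pos pos by (intro add_mono mult_left_mono wide_bump_moment) auto
      also have "\<dots> = ennreal ((\<mu> + e0 * s1 powr p) + (e * s powr p + \<eta> * s powr p * (2 * s)))"
        using \<mu> e0 e \<eta> s_pos by (simp add: ennreal_mult[symmetric] ennreal_plus[symmetric] del: ennreal_plus)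
      also have "\<dots> \<le> ennreal B"
      proof (rule ennreal_leI)
        have "\<eta> * s powr p * (2 * s) = 2 * (\<eta> * s powr (p + 1))" using s_pos by (simp add: powr_add)
        also have "\<eta> * s powr (p + 1) \<le> g / (6 * s powr (p + 1)) * s powr (p + 1)"
          using \<eta>(3) by (intro mult_right_mono) auto
        also have "\<dots> = g / 6" using s_pos by simp
        finally show "(\<mu> + e0 * s1 powr p) + (e * s powr p + \<eta> * s powr p * (2 * s)) \<le> B"
          unfolding es using e0(3) e1(3) by (simp add: g_def)
      qed
      finally have "(\<lambda>x. f0 x + v x) \<in> moment_class p B"
        using moment_classI[OF dens le_B _ B1 pos(3)] by simp
      then show ?thesis using dens HA lower by (simp add: \<F>_def)
    qed
    show ?thesis unfolding perturbable_def
      by (rule exI[of _ f0], rule exI[of _ \<eta>], rule conjI[OF \<eta>(1)], intro allI impI, rule good) simp_all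
  qed
  have "0 < A'" "0 < c" using e0 e1 r0 pos by (auto simp: A'_def c_def)
  then show ?thesis using main s1(1) by blast
qed

section \<open>Combs: perturbations that the error distribution almost annihilates\<close>

text \<open>Normalised so that the weights lie in [0, 1] and have mean 1 / (m + 1) over the (m + 1)
  N teeth: the typical tooth has height of order 1.\<close>

definition comb_coeff :: "nat \<Rightarrow> nat \<Rightarrow> nat \<Rightarrow> real" where
  "comb_coeff m N j = coeff (geom_poly N ^ Suc m) j / real N ^ m"

definition comb :: "real \<Rightarrow> nat \<Rightarrow> nat \<Rightarrow> real \<Rightarrow> nat \<Rightarrow> real \<Rightarrow> real \<Rightarrow> real \<Rightarrow> real" where
  "comb \<theta> m K h N z b = bump_train K m h {..<Suc m * N} (\<lambda>j. z + 2 * \<theta> * real j)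
     (\<lambda>j. b * comb_coeff m N j)"

lemma separated_progression:
  assumes "0 < h" "h \<le> d"
  shows "separated h {..<M} (\<lambda>i. z + d * real i)"
proof -
  have "h \<le> \<bar>z + d * real i - (z + d * real j)\<bar>" if "i \<noteq> j" for i j
  proof -
    have "1 \<le> \<bar>real i - real j\<bar>" using that by linarith
    then have "d * 1 \<le> d * \<bar>real i - real j\<bar>" using assms by (intro mult_left_mono) auto
    also have "\<dots> = \<bar>z + d * real i - (z + d * real j)\<bar>"
      using assms by (simp add: abs_mult right_diff_distrib[symmetric])
    finally show ?thesis using assms by simp
  qed
  then show ?thesis using assms by (simp add: separated_def)
qed

text \<open>\<open>L\<close> consecutive shifts by \<open>h\<close> fit into one period
  \<open>d\<close>, so the teeth of all shifted combs interlace without overlap.\<close>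

lemma separated_double_progression:
  assumes "0 < h" "real L * h \<le> d"
  shows "separated h ({..<L} \<times> {..<M}) (\<lambda>(k, j). z + real k * h + d * real j)"
proof -
  have "h \<le> \<bar>(z + real k * h + d * real j) - (z + real k' * h + d * real j')\<bar>"
    if k: "k < L" "k' < L" and ne: "(k, j) \<noteq> (k', j')" for k j k' j'
  proof -
    have "0 < real L * h" using assms(1) k(1) by simp
    then have d: "0 < d" using assms(2) by linarith
    have kk: "\<bar>real k - real k'\<bar> \<le> real L - 1" using k by linarith
    have "\<bar>real k * h - real k' * h\<bar> = \<bar>real k - real k'\<bar> * h"
      using assms(1) by (simp add: abs_mult left_diff_distrib[symmetric])
    show ?thesis
    proof (cases "j = j'")
      case True
      then have "1 \<le> \<bar>real k - real k'\<bar>" using ne by auto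
      then have "1 * h \<le> \<bar>real k - real k'\<bar> * h" using assms(1) by (intro mult_right_mono) auto
      then show ?thesis using \<open>_ = \<bar>real k - real k'\<bar> * h\<close> True by simp
    next
      case False
      then have "1 \<le> \<bar>real j - real j'\<bar>" by linarith
      then have "d * 1 \<le> d * \<bar>real j - real j'\<bar>" using d by (intro mult_left_mono) auto
      also have "\<dots> = \<bar>d * real j - d * real j'\<bar>" using d by (simp add: abs_mult right_diff_distrib[symmetric])
      finally have 1: "d \<le> \<bar>d * real j - d * real j'\<bar>" by simp
      have "\<bar>real k - real k'\<bar> * h \<le> (real L - 1) * h" using kk assms(1) by (intro mult_right_mono) auto
      also have "\<dots> \<le> d - h" using assms(2) by (simp add: algebra_simps)
      finally show ?thesis using 1 \<open>_ = \<bar>real k - real k'\<bar> * h\<close> by linarith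
    qed
  qed
  then show ?thesis using assms(1) by (auto simp: separated_def)
qed

text \<open>Any subfamily of the shifted combs is a single train, so class membership of all
  vertices of the hypercube is one argument.\<close>

lemma sum_comb:
  assumes "finite S"
  shows "(\<Sum>k\<in>S. comb \<theta> m K h N (z + real k * h) b x)
    = bump_train K m h (S \<times> {..<Suc m * N}) (\<lambda>(k, j). z + real k * h + 2 * \<theta> * real j)
        (\<lambda>(k, j). b * comb_coeff m N j) x"
  using assms unfolding comb_def bump_train_def
  by (subst sum.cartesian_product) (auto simp: case_prod_beta)

lemma comb_coeff_bounds:
  assumes "N \<ge> 1"
  shows "0 \<le> comb_coeff m N j" "comb_coeff m N j \<le> 1"
  using coeff_geom_power[of N m j] assms by (auto simp: comb_coeff_def divide_le_eq simp del: power_Suc)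

lemma sum_comb_coeff:
  assumes "N \<ge> 1"
  shows "(\<Sum>j<Suc m * N. comb_coeff m N j) = real N"
  unfolding comb_coeff_def sum_divide_distrib[symmetric] sum_coeff_geom_power[OF assms] using assms by simp

text \<open>Some weight reaches the mean weight.\<close>

lemma comb_coeff_large:
  assumes "N \<ge> 1"
  shows "\<exists>j<Suc m * N. 1 / real (Suc m) \<le> comb_coeff m N j"
proof (rule ccontr)
  let ?c = "comb_coeff m N"
  assume "\<not> ?thesis"
  then have "(\<Sum>j<Suc m * N. ?c j) < (\<Sum>j<Suc m * N. 1 / real (Suc m))"
    using assms by (intro sum_strict_mono) (auto simp: not_le lessThan_empty_iff simp del: power_Suc)
  also have "\<dots> = real N" 
    by (simp add: field_simps del: of_nat_Suc) (simp add: algebra_simps)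
  finally show False using sum_comb_coeff[OF assms, of m] by simp
qed

text \<open>Cauchy-Schwarz in the form of a tangent line: c^2 >= 2 t c - t^2, with t the mean
  weight.\<close>

lemma sum_comb_coeff_square:
  assumes "N \<ge> 1"
  shows "real N / real (Suc m) \<le> (\<Sum>j<Suc m * N. (comb_coeff m N j)\<^sup>2)"
proof -
  let ?c = "comb_coeff m N"
  define t where "t = 1 / real (Suc m)"
  have "(\<Sum>j<Suc m * N. 2 * t * ?c j - t\<^sup>2) \<le> (\<Sum>j<Suc m * N. (?c j)\<^sup>2)"
  proof (rule sum_mono)
    fix j
    show "2 * t * ?c j - t\<^sup>2 \<le> (?c j)\<^sup>2"
      using zero_le_power2[of "?c j - t"] by (simp add: power2_diff mult.commute mult.left_commute del: power_Suc)
  qed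
  moreover have "(\<Sum>j<Suc m * N. 2 * t * ?c j - t\<^sup>2) = 2 * t * real N - real (Suc m * N) * t\<^sup>2"
    unfolding sum_subtractf sum_distrib_left[symmetric] sum_comb_coeff[OF assms] by simp
  moreover have "\<dots> = real N / real (Suc m)"
    by (simp add: t_def power2_eq_square field_simps del: of_nat_Suc) (simp add: algebra_simps)
  ultimately show ?thesis by linarith
qed

lemma abs_comb_coeff_le:
  assumes "N \<ge> 1" "b \<ge> 0"
  shows "\<bar>b * comb_coeff m N j\<bar> \<le> b"
proof -
  have "\<bar>b * g\<bar> \<le> b" if "0 \<le> g" "g \<le> 1" for g
    using that assms(2) by (simp add: abs_mult mult_left_le)
  then show ?thesis using comb_coeff_bounds[OF assms(1)] by blast
qed

locale sinc_error =
  fixes \<theta> :: real and m :: nat and G :: "real measure"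
  assumes theta_pos: "\<theta> > 0" and m_pos: "m \<ge> 1" and G: "real_distribution G"
    and char_G: "\<And>\<omega>. char G \<omega> = complex_of_real (sinc (\<theta> * \<omega>) ^ m)"
begin

text \<open>The factor \<open>(1 - X) ^ m\<close> that convolution with the error produces telescopes against the
  coefficients of the comb, so the result loses a factor \<open>N ^ m\<close>.\<close>

lemma conv_density_comb:
  assumes K: "Suc m < K" and h: "0 < h" and N: "N \<ge> 1"
  shows "conv_density G (comb \<theta> m K h N z b) y
    = bump_train K 0 h {..<Suc m * N} (\<lambda>i. (z - real m * \<theta>) + 2 * \<theta> * real i)
        (\<lambda>i. b * (h / (2 * \<theta>)) ^ m / real N ^ m * coeff ([:1, -1:] ^ m * geom_poly N ^ Suc m) i) y"
proof -
  interpret real_distribution G by (rule G)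
  let ?P = "geom_poly N ^ Suc m" and ?D = "[:1, -1:] ^ m :: real poly"
  \<comment> \<open>The power of h compensates the chain rule, so that \<open>F (Suc l)\<close> is
    exactly the derivative of \<open>F l\<close>.\<close>
  define F where "F l x = h ^ (m - l) * bump K l ((x - z) / h)" for l x
  obtain C where C: "\<forall>l\<le>m. \<forall>x. \<bar>bump K l x\<bar> \<le> C" using bump_bounded_upto[of m K] by blast
  have [measurable]: "F l \<in> borel_measurable borel" for l unfolding F_def by measurable
  define C' where "C' = (\<Sum>l\<le>m. h ^ (m - l)) * C"
  have "0 \<le> C" using C[rule_format, of 0 0] by simp
  have FC: "\<bar>F l x\<bar> \<le> C'" if "l \<le> m" for l x
  proof -
    have "\<bar>F l x\<bar> = h ^ (m - l) * \<bar>bump K l ((x - z) / h)\<bar>" using h by (simp add: F_def abs_mult)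
    also have "\<dots> \<le> (\<Sum>l\<le>m. h ^ (m - l)) * C"
      using C that h \<open>0 \<le> C\<close> by (intro mult_mono member_le_sum sum_nonneg) auto
    finally show ?thesis by (simp add: C'_def)
  qed
  have conv: "(\<integral>t. F m (y - t) \<partial>G) = shift_action (2 * \<theta>) ?D (F 0) (y + real m * \<theta>) / (2 * \<theta>) ^ m" for y
  proof (rule sinc_power_convolution_derivative[OF theta_pos G char_G _ _ FC])
    fix l x assume l: "l < m"
    have "((\<lambda>x. h ^ (m - l) * bump K l ((x - z) / h)) has_real_derivative
        h ^ (m - l) * (bump K (Suc l) ((x - z) / h) * (1 / h))) (at x)"
      by (intro DERIV_cmult DERIV_chain2[OF bump_DERIV])
        (use l K h in \<open>auto intro!: derivative_eq_intros\<close>)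
    moreover have "h ^ (m - l) = h * h ^ (m - Suc l)"
      using l by (metis Suc_diff_Suc power_Suc)
    ultimately show "(F l has_real_derivative F (Suc l) x) (at x)"
      using h by (simp add: F_def[abs_def] mult.assoc mult.commute mult.left_commute)
  next
    fix l assume "l \<le> m"
    then show "continuous_on UNIV (F l)"
      unfolding F_def using K h
      by (intro continuous_intros continuous_on_compose2[OF bump_continuous]) auto
  qed
  have int: "integrable G (\<lambda>t. F m (x - t))" for x
    by (rule integrable_const_bound[of _ C']) (auto simp: FC)
  have combF: "comb \<theta> m K h N z b x = b / real N ^ m * (\<Sum>j<Suc m * N. coeff ?P j * F m (x - 2 * \<theta> * real j))" for x
    unfolding comb_def comb_coeff_def bump_train_def F_def sum_distrib_left
    by (intro sum.cong refl) (simp add: algebra_simps del: power_Suc)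
  have "conv_density G (comb \<theta> m K h N z b) y
      = b / real N ^ m * (\<Sum>j<Suc m * N. coeff ?P j * (\<integral>t. F m ((y - 2 * \<theta> * real j) - t) \<partial>G))"
  proof -
    have "comb \<theta> m K h N z b (y - t)
        = b / real N ^ m * (\<Sum>j<Suc m * N. coeff ?P j * F m ((y - 2 * \<theta> * real j) - t))" for t
      unfolding combF by (simp add: algebra_simps del: power_Suc)
    then show ?thesis unfolding conv_density_def by (simp add: int del: power_Suc)
  qed
  also have "\<dots> = b / real N ^ m * (\<Sum>j<Suc m * N. coeff ?P j *
      (shift_action (2 * \<theta>) ?D (F 0) ((y + real m * \<theta>) - 2 * \<theta> * real j) / (2 * \<theta>) ^ m))"
    unfolding conv by (simp add: algebra_simps del: power_Suc)
  also have "\<dots> = b / real N ^ m / (2 * \<theta>) ^ m * shift_action (2 * \<theta>) ?P (shift_action (2 * \<theta>) ?D (F 0)) (y + real m * \<theta>)"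
    by (subst shift_action_eq[where P = ?P, OF coeff_geom_power_eq_0[OF N]], assumption)
      (simp add: sum_divide_distrib[symmetric] del: power_Suc)
  \<comment> \<open>Difference operators commute, so the weights of the comb and the differences
    from the error meet in one polynomial product.\<close>
  also have "shift_action (2 * \<theta>) ?P (shift_action (2 * \<theta>) ?D (F 0)) = shift_action (2 * \<theta>) (?D * ?P) (F 0)"
    by (rule ext) (simp only: shift_action_mult[symmetric] mult.commute)
  also have "shift_action (2 * \<theta>) (?D * ?P) (F 0) (y + real m * \<theta>)
      = (\<Sum>i<Suc m * N. coeff (?D * ?P) i * F 0 (y + real m * \<theta> - 2 * \<theta> * real i))"
    by (rule shift_action_eq) (rule coeff_diff_geom_poly_eq_0[OF N])
  also have "b / real N ^ m / (2 * \<theta>) ^ m * \<dots>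
      = bump_train K 0 h {..<Suc m * N} (\<lambda>i. (z - real m * \<theta>) + 2 * \<theta> * real i)
        (\<lambda>i. b * (h / (2 * \<theta>)) ^ m / real N ^ m * coeff (?D * ?P) i) y"
    unfolding bump_train_def F_def sum_distrib_left
    by (intro sum.cong refl) (simp add: algebra_simps power_divide del: power_Suc)
  finally show ?thesis .
qed

text \<open>The bound 2^m on the telescoped coefficients cancels against the 2^m in (2 theta)^m.
  Order N teeth of relative size N^(-m) leave N^(1-2m) in the square.\<close>

lemma conv_density_comb_square:
  assumes K: "Suc m < K" and h: "0 < h" "h \<le> 2 * \<theta>" and N: "N \<ge> 1" and C: "\<And>x. \<bar>bump K 0 x\<bar> \<le> C"
    and b: "b \<ge> 0"
  shows "(\<integral>\<^sup>+y. ennreal ((conv_density G (comb \<theta> m K h N z b) y)\<^sup>2) \<partial>lborel)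
    \<le> ennreal (h * (real (Suc m * N) * (b * (h / \<theta>) ^ m / real N ^ m)\<^sup>2) * C\<^sup>2)"
proof -
  let ?d = "\<lambda>i. coeff ([:1, -1:] ^ m * geom_poly N ^ Suc m) i"
  let ?a = "\<lambda>i. b * (h / (2 * \<theta>)) ^ m / real N ^ m * ?d i"
  have a: "(?a i)\<^sup>2 \<le> (b * (h / \<theta>) ^ m / real N ^ m)\<^sup>2" for i
  proof -
    have "\<bar>?a i\<bar> = b * (h / (2 * \<theta>)) ^ m / real N ^ m * \<bar>?d i\<bar>"
      using b h theta_pos by (simp add: abs_mult abs_divide)
    also have "\<dots> \<le> b * (h / (2 * \<theta>)) ^ m / real N ^ m * 2 ^ m"
      using b h theta_pos by (intro mult_left_mono coeff_diff_geom_poly) auto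
    also have "\<dots> = b * (h / \<theta>) ^ m / real N ^ m" by (simp add: power_divide power_mult_distrib)
    finally have "\<bar>?a i\<bar> \<le> b * (h / \<theta>) ^ m / real N ^ m" .
    then have "\<bar>?a i\<bar>\<^sup>2 \<le> (b * (h / \<theta>) ^ m / real N ^ m)\<^sup>2" by (intro power_mono) auto
    then show ?thesis by (simp only: power2_abs)
  qed
  have "(\<integral>\<^sup>+x. ennreal ((bump K 0 x)\<^sup>2) \<partial>lborel) \<le> (\<integral>\<^sup>+x. ennreal (C\<^sup>2) * indicator {0..1::real} x \<partial>lborel)"
  proof (rule nn_integral_mono)
    fix x
    have "(bump K 0 x)\<^sup>2 \<le> C\<^sup>2" using power_mono[OF C[of x] abs_ge_zero, of 2] by simp
    then show "ennreal ((bump K 0 x)\<^sup>2) \<le> ennreal (C\<^sup>2) * indicator {0..1} x"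
      using bump_eq_0[of x K 0] by (cases "0 < x \<and> x < 1") (auto intro: ennreal_leI)
  qed
  also have "\<dots> = ennreal (C\<^sup>2)" by (simp add: nn_integral_cmult_indicator)
  finally have J: "(\<integral>\<^sup>+x. ennreal ((bump K 0 x)\<^sup>2) \<partial>lborel) \<le> ennreal (C\<^sup>2)" .
  have "(\<integral>\<^sup>+y. ennreal ((conv_density G (comb \<theta> m K h N z b) y)\<^sup>2) \<partial>lborel)
      = ennreal (h * (\<Sum>i<Suc m * N. (?a i)\<^sup>2)) * (\<integral>\<^sup>+x. ennreal ((bump K 0 x)\<^sup>2) \<partial>lborel)"
    unfolding conv_density_comb[OF K h(1) N]
    by (rule nn_integral_bump_train_square[OF separated_progression[OF h]])
  also have "\<dots> \<le> ennreal (h * (\<Sum>i<Suc m * N. (b * (h / \<theta>) ^ m / real N ^ m)\<^sup>2)) * ennreal (C\<^sup>2)"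
    using h a by (intro mult_mono J ennreal_leI mult_left_mono sum_mono) auto
  also have "\<dots> = ennreal (h * (real (Suc m * N) * (b * (h / \<theta>) ^ m / real N ^ m)\<^sup>2) * C\<^sup>2)"
    using h by (simp add: ennreal_mult del: of_nat_Suc of_nat_mult)
  finally show ?thesis .
qed

end

section \<open>Choice of the parameters\<close>

lemma separated_subset: "separated h I z \<Longrightarrow> I' \<subseteq> I \<Longrightarrow> separated h I' z"
  by (auto simp: separated_def intro: finite_subset)

lemma real_distribution_half_interval:
  assumes "real_distribution G"
  shows "\<exists>r\<ge>0. 1 / 2 \<le> measure G {-r..r}"
proof -
  interpret real_distribution G by fact
  have "(\<lambda>n. measure G {- real n..real n}) \<longlonglongrightarrow> measure G (\<Union>n. {- real n..real n})"
    by (rule finite_Lim_measure_incseq) (auto simp: incseq_def)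
  moreover have "(\<Union>n. {- real n..real n}) = UNIV"
  proof -
    have "\<exists>n. x \<in> {- real n..real n}" for x :: real
    proof -
      obtain n where "\<bar>x\<bar> \<le> real n" using real_arch_simple by blast
      then show ?thesis by (intro exI[of _ n]) auto
    qed
    then show ?thesis by blast
  qed
  ultimately have "(\<lambda>n. measure G {- real n..real n}) \<longlonglongrightarrow> 1" using prob_space by simp
  then have "\<forall>\<^sub>F n in sequentially. 1 / 2 < measure G {- real n..real n}"
    by (rule order_tendstoD) simp
  then obtain n where "1 / 2 < measure G {- real n..real n}"
    by (auto simp: eventually_sequentially)
  then show ?thesis by (intro exI[of _ "real n"]) simp
qed

text \<open>What Le Cam's and Assouad's bounds have in common: a hypercube of densities in the
  class, a floor \<open>\<kappa>\<close> near the observed perturbations, and a chi-square bound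
  \<open>\<eta>\<close> per observation that n observations add up to at most 1/2. Le Cam's bound is
  the case \<open>L = 1\<close>.\<close>

definition two_point_ready ::
  "real measure \<Rightarrow> nat \<Rightarrow> (real \<Rightarrow> real) set \<Rightarrow> nat \<Rightarrow> (nat \<Rightarrow> real \<Rightarrow> real) \<Rightarrow> bool" where
  "two_point_ready G n \<F> L v \<longleftrightarrow> (\<exists>f\<^sub>0 r \<kappa> \<eta> C. 0 < \<kappa> \<and> 0 \<le> \<eta> \<and> real n * \<eta> \<le> 1 / 2 \<and>
     1 / 2 \<le> measure G {-r..r} \<and> (\<forall>k x. \<bar>v k x\<bar> \<le> C) \<and>
     (\<forall>S\<subseteq>{..<L}. (\<lambda>x. f\<^sub>0 x + (\<Sum>k\<in>S. v k x)) \<in> \<F>) \<and>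
     (\<forall>S\<subseteq>{..<L}. \<forall>k<L. \<forall>x y. conv_density G (v k) y \<noteq> 0 \<longrightarrow> \<bar>x - y\<bar> \<le> r \<longrightarrow>
        \<kappa> \<le> f\<^sub>0 x + (\<Sum>k\<in>S. v k x)) \<and>
     (\<forall>k<L. (\<integral>\<^sup>+y. ennreal ((conv_density G (v k) y)\<^sup>2) \<partial>lborel) \<le> ennreal (\<kappa> / 2 * \<eta>)))"

lemma minimax_point_two_point:
  assumes G: "real_distribution G" and dens: "\<And>h. h \<in> \<F> \<Longrightarrow> prob_density h"
    and [measurable]: "\<And>k. v k \<in> borel_measurable borel"
    and ready: "two_point_ready G n \<F> 1 v"
  shows "ennreal (\<bar>v 0 x\<^sub>0\<bar> / 3) \<le> minimax_point G n \<F> x\<^sub>0"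
proof -
  obtain f0 r \<kappa> \<eta> C where *: "0 < \<kappa>" "0 \<le> \<eta>" "real n * \<eta> \<le> 1 / 2" "1 / 2 \<le> measure G {-r..r}"
    and C: "\<forall>k x. \<bar>v k x\<bar> \<le> C"
    and cls: "\<forall>S\<subseteq>{..<1}. (\<lambda>x. f0 x + (\<Sum>k\<in>S. v k x)) \<in> \<F>"
    and lower: "\<forall>S\<subseteq>{..<1}. \<forall>k<1. \<forall>x y. conv_density G (v k) y \<noteq> 0 \<longrightarrow> \<bar>x - y\<bar> \<le> r \<longrightarrow>
        \<kappa> \<le> f0 x + (\<Sum>k\<in>S. v k x)"
    and chi: "\<forall>k<1. (\<integral>\<^sup>+y. ennreal ((conv_density G (v k) y)\<^sup>2) \<partial>lborel) \<le> ennreal (\<kappa> / 2 * \<eta>)"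
    using ready unfolding two_point_ready_def by (elim exE conjE) (rule that; assumption)
  note C = C[rule_format] and cls = cls[rule_format] and lower = lower[rule_format] and chi = chi[rule_format]
  have f: "f0 \<in> \<F>" and g: "(\<lambda>x. f0 x + v 0 x) \<in> \<F>"
    using cls[of "{}"] cls[of "{0}"] by auto
  define c where "c = (v 0 x\<^sub>0)\<^sup>2 / 2"
  have "esqrt (ennreal (c / 4)) \<le> minimax_point G n \<F> x\<^sub>0"
  proof (rule minimax_point_ge)
    fix T assume "T \<in> estimators n"
    note [measurable] = estimators_measurable[OF this]
    let ?R = "\<lambda>f. \<integral>\<^sup>+y. ennreal (\<bar>T y x\<^sub>0 - f x\<^sub>0\<bar>\<^sup>2) \<partial>obs_law G n f"
    have "ennreal c / 2 \<le> ?R f0 + ?R (\<lambda>x. f0 x + v 0 x)"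
    proof (rule deconvolution_two_point[OF G dens[OF f] dens[OF g] _ C *(4,1) _ chi *(2,3)])
      show "\<kappa> \<le> f0 x" if "conv_density G (v 0) y \<noteq> 0" "\<bar>x - y\<bar> \<le> r" for x y
        using lower[of "{}" 0 y x] that by simp
      fix y
      have "c \<le> (T y x\<^sub>0 - f0 x\<^sub>0)\<^sup>2 + (T y x\<^sub>0 - (f0 x\<^sub>0 + v 0 x\<^sub>0))\<^sup>2"
        using zero_le_power2[of "2 * (T y x\<^sub>0 - f0 x\<^sub>0) - v 0 x\<^sub>0"]
        by (simp add: c_def power2_eq_square algebra_simps)
      then show "ennreal c \<le> ennreal (\<bar>T y x\<^sub>0 - f0 x\<^sub>0\<bar>\<^sup>2) + ennreal (\<bar>T y x\<^sub>0 - (f0 x\<^sub>0 + v 0 x\<^sub>0)\<bar>\<^sup>2)"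
        by (simp add: ennreal_plus[symmetric] ennreal_leI del: ennreal_plus)
    qed auto
    moreover have "ennreal c / 2 = ennreal (c / 4) + ennreal (c / 4)"
      using divide_ennreal[of c 2] by (simp add: c_def ennreal_plus[symmetric] del: ennreal_plus)
    ultimately have "ennreal (c / 4) + ennreal (c / 4) \<le> ?R f0 + ?R (\<lambda>x. f0 x + v 0 x)"
      by (simp only:)
    then have "ennreal (c / 4) \<le> ?R f0 \<or> ennreal (c / 4) \<le> ?R (\<lambda>x. f0 x + v 0 x)"
      by (rule ennreal_half_cancel)
    then show "\<exists>f\<in>\<F>. ennreal (c / 4) \<le> ?R f" using f g by auto
  qed
  moreover have "ennreal (\<bar>v 0 x\<^sub>0\<bar> / 3) \<le> esqrt (ennreal (c / 4))"
  proof -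
    \<comment> \<open>The loss v^2 / 2 is halved by the two-point bound and again by choosing the
      worse of the two densities; the root of v^2 / 8 exceeds |v| / 3.\<close>
    have "(\<bar>v 0 x\<^sub>0\<bar> / 3)\<^sup>2 \<le> c / 4" by (simp add: c_def power_divide)
    then have "\<bar>v 0 x\<^sub>0\<bar> / 3 \<le> sqrt (c / 4)" by (rule real_le_rsqrt)
    then show ?thesis by (simp add: esqrt_ennreal c_def ennreal_leI)
  qed
  ultimately show ?thesis by (rule order_trans[rotated])
qed

lemma minimax_L2_assouad:
  assumes G: "real_distribution G" and dens: "\<And>h. h \<in> \<F> \<Longrightarrow> prob_density h"
    and vm: "\<And>k. v k \<in> borel_measurable borel"
    and ready: "two_point_ready G n \<F> L v"
    and disj: "\<And>k l x. k < L \<Longrightarrow> l < L \<Longrightarrow> k \<noteq> l \<Longrightarrow> v k x = 0 \<or> v l x = 0"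
    and \<delta>: "\<And>k. k < L \<Longrightarrow> ennreal \<delta> \<le> (\<integral>\<^sup>+x. ennreal ((v k x)\<^sup>2) \<partial>lborel)" "\<delta> \<ge> 0"
  shows "ennreal (sqrt (real L * \<delta> / 8)) \<le> minimax_L2 G n \<F>"
proof -
  obtain f0 r \<kappa> \<eta> C where *: "0 < \<kappa>" "0 \<le> \<eta>" "real n * \<eta> \<le> 1 / 2" "1 / 2 \<le> measure G {-r..r}"
    and C: "\<forall>k x. \<bar>v k x\<bar> \<le> C"
    and cls: "\<forall>S\<subseteq>{..<L}. (\<lambda>x. f0 x + (\<Sum>k\<in>S. v k x)) \<in> \<F>"
    and lower: "\<forall>S\<subseteq>{..<L}. \<forall>k<L. \<forall>x y. conv_density G (v k) y \<noteq> 0 \<longrightarrow> \<bar>x - y\<bar> \<le> r \<longrightarrow>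
        \<kappa> \<le> f0 x + (\<Sum>k\<in>S. v k x)"
    and chi: "\<forall>k<L. (\<integral>\<^sup>+y. ennreal ((conv_density G (v k) y)\<^sup>2) \<partial>lborel) \<le> ennreal (\<kappa> / 2 * \<eta>)"
    using ready unfolding two_point_ready_def by (elim exE conjE) (rule that; assumption)
  note C = C[rule_format] and cls = cls[rule_format] and lower = lower[rule_format] and chi = chi[rule_format]
  show ?thesis
    by (rule assouad_deconvolution_L2[OF G cls dens vm C disj *(4,1) lower chi *(2,3) \<delta>])
qed

text \<open>The squared L2 norm of an observed comb in terms of h: tooth width h, height h^alpha,
  and h^m from m integrations. Its exponent is the denominator in the rate.\<close>

lemma powr_collect:
  assumes "0 < (h::real)"
  shows "h * ((h powr \<alpha>)\<^sup>2 * (h ^ m)\<^sup>2) = h powr (2 * \<alpha> + 2 * real m + 1)"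
proof -
  have "h powr (2 * \<alpha> + 2 * real m + 1) = h powr \<alpha> * h powr \<alpha> * (h powr real m * h powr real m) * h powr 1"
    unfolding powr_add[symmetric] by (simp add: algebra_simps)
  then show ?thesis using assms by (simp add: powr_realpow power2_eq_square)
qed

context sinc_error
begin

lemma comb_measurable: "comb \<theta> m K h N z b \<in> borel_measurable borel"
  unfolding comb_def by (rule bump_train_measurable)

text \<open>The comb extends over a distance linear in N; 4 theta covers the shift k h and the tooth
  width, each at most 2 theta.\<close>

lemma comb_position_bound:
  assumes "0 < h" "h \<le> 2 * \<theta>" "real L * h \<le> 2 * \<theta>" "k < L" "j < Suc m * N" "1 \<le> N" "\<bar>z\<bar> \<le> Z * real N"
    and x: "z + real k * h + 2 * \<theta> * real j < x" "x < z + real k * h + 2 * \<theta> * real j + h"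
  shows "\<bar>x\<bar> \<le> real N * (Z + 4 * \<theta> + 2 * \<theta> * real (Suc m))"
proof -
  have "real k * h \<le> real L * h" using assms by (intro mult_right_mono) auto
  then have 1: "0 \<le> real k * h" "real k * h \<le> 2 * \<theta>" using assms(1,3) by (simp, linarith)
  have "real j \<le> real (Suc m * N)" using assms by linarith
  then have 2: "2 * \<theta> * real j \<le> 2 * \<theta> * (real (Suc m) * real N)" "0 \<le> 2 * \<theta> * real j"
    using theta_pos by (auto intro!: mult_left_mono simp del: of_nat_Suc simp flip: of_nat_mult)
  have "4 * \<theta> * 1 \<le> 4 * \<theta> * real N" using theta_pos assms(6) by (intro mult_left_mono) auto
  then have "\<bar>x\<bar> \<le> Z * real N + 4 * \<theta> * real N + 2 * \<theta> * (real (Suc m) * real N)"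
    using assms 1 2 by linarith
  then show ?thesis by (simp add: algebra_simps)
qed

text \<open>The main choice: the comb has a fixed number of teeth, large in terms of the target constant
  \<open>D\<close>, while its scale \<open>h\<close> tends to 0 with \<open>n\<close>. The exponent \<open>\<tau>\<close> is 0 for the pointwise risk
  and 1/2 for the integrated risk.\<close>

lemma comb_two_point_ready:
  fixes \<alpha> \<tau> p D Z \<beta> C c s\<^sub>0 A' :: real and H \<F>
  assumes base: "\<And>s. s \<ge> s\<^sub>0 \<Longrightarrow> perturbable H \<F> p A' c s" and c: "c > 0"
    and K: "Suc m < K" and C: "\<And>l x. l \<le> m \<Longrightarrow> \<bar>bump K l x\<bar> \<le> C" "C > 0"
    and \<alpha>: "\<alpha> > 0" and \<beta>: "\<beta> > 0" and D: "D > 0" and Z: "Z \<ge> 0"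
    and rate: "p < 2 * \<tau> + 2 * real m - 2"
    and smooth: "\<And>N h L S z. N \<ge> 1 \<Longrightarrow> 0 < h \<Longrightarrow> real L * h \<le> 2 * \<theta> \<Longrightarrow> S \<subseteq> {..<L} \<Longrightarrow>
      H A' (\<lambda>x. \<Sum>k\<in>S. comb \<theta> m K h N (z + real k * h) (\<beta> * real N powr - \<tau> * h powr \<alpha>) x)"
  defines "h \<equiv> \<lambda>n. D * real n powr (- 1 / (2 * \<alpha> + 2 * real m + 1))"
  shows "\<exists>N\<ge>1. \<forall>\<^sub>F n in sequentially. 0 < h n \<and> h n \<le> \<theta> \<and>
    (\<forall>L z. real L * h n \<le> 2 * \<theta> \<longrightarrow> \<bar>z\<bar> \<le> Z * real N \<longrightarrow>
      two_point_ready G n \<F> L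
        (\<lambda>k. comb \<theta> m K (h n) N (z + real k * h n) (\<beta> * real N powr - \<tau> * h n powr \<alpha>)))"
proof -
  define E where "E = 2 * \<alpha> + 2 * real m + 1"
  have E: "E > 0" using \<alpha> by (simp add: E_def)
  obtain r where r: "0 \<le> r" "1 / 2 \<le> measure G {-r..r}" using real_distribution_half_interval[OF G] by blast
  \<comment> \<open>\<open>W * real N\<close> will be s / 4. It bounds all points where the floor is
    needed: the comb, its translation by m theta under convolution, and the error radius r around
    that.\<close>
  define W where "W = Z + 4 * \<theta> + real m * \<theta> + 2 * \<theta> * real (Suc m) + r"
  have W: "0 < W" unfolding W_def using Z theta_pos r(1) by (intro add_pos_nonneg add_nonneg_pos) auto
  \<comment> \<open>\<open>M * real N powr - \<gamma>\<close> is n times the chi-square bound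
    \<open>2 * X / \<kappa>\<close> below, free of n by the choice of h. In \<open>\<gamma>\<close>
    the comb contributes 2 tau + 2m - 1, and the floor kappa takes back p + 1; \<open>rate\<close>
    makes the difference positive.\<close>
  define M where "M = 2 * real (Suc m) * \<beta>\<^sup>2 * C\<^sup>2 * (1 / \<theta> ^ m)\<^sup>2 * (4 * W) powr (p + 1) / c * D powr E"
  define \<gamma> where "\<gamma> = 2 * \<tau> + 2 * real m - 2 - p"
  have "((\<lambda>N. M * real N powr - \<gamma>) \<longlongrightarrow> M * 0) sequentially"
    using rate by (intro tendsto_mult tendsto_const tendsto_neg_powr filterlim_real_sequentially) (simp add: \<gamma>_def)
  then have "\<forall>\<^sub>F N in sequentially. M * real N powr - \<gamma> < 1 / 2" by (rule order_tendstoD) simp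
  moreover have "\<forall>\<^sub>F N in sequentially. s\<^sub>0 / (4 * W) \<le> real N"
    using filterlim_real_sequentially unfolding filterlim_at_top by blast
  moreover have "\<forall>\<^sub>F N in sequentially. 1 \<le> (N::nat)" by (rule eventually_ge_at_top)
  ultimately have "\<forall>\<^sub>F N in sequentially. M * real N powr - \<gamma> < 1 / 2 \<and> s\<^sub>0 / (4 * W) \<le> real N \<and> 1 \<le> N"
    by eventually_elim auto
  then obtain N where N: "M * real N powr - \<gamma> < 1 / 2" "s\<^sub>0 / (4 * W) \<le> real N" "1 \<le> N"
    by (auto simp: eventually_sequentially)
  define s where "s = 4 * W * real N"
  have s: "s \<ge> s\<^sub>0" "0 < s" using N W by (auto simp: s_def field_simps)
  obtain f0 \<eta> where \<eta>: "0 < \<eta>" and f0: "\<forall>v. v \<in> borel_measurable borel \<longrightarrow> (\<forall>x. \<bar>v x\<bar> \<le> \<eta>) \<longrightarrow>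
      (\<forall>x. s / 4 < \<bar>x\<bar> \<longrightarrow> v x = 0) \<longrightarrow> integrable lborel v \<longrightarrow> (\<integral>x. v x \<partial>lborel) = 0 \<longrightarrow> H A' v \<longrightarrow>
      (\<lambda>x. f0 x + v x) \<in> \<F> \<and> (\<forall>x. \<bar>x\<bar> \<le> s / 4 \<longrightarrow> c * s powr (- p - 1) \<le> f0 x + v x)"
    using base[OF s(1)] unfolding perturbable_def by (elim exE conjE) (rule that; assumption)
  note f0 = f0[THEN spec, THEN mp, THEN mp, THEN mp, THEN mp, THEN mp, THEN mp, OF _ allI allI[OF impI]]
  have h0: "(h \<longlongrightarrow> D * 0) sequentially"
    unfolding h_def E_def[symmetric] using E
    by (intro tendsto_mult tendsto_const tendsto_neg_powr filterlim_real_sequentially) (simp add: divide_neg_pos)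
  then have e1: "\<forall>\<^sub>F n in sequentially. h n < \<theta>" using theta_pos by (intro order_tendstoD(2)) auto
  \<comment> \<open>The admissible height eta belongs to the N already chosen; the height of the
    comb falls below it as n grows.\<close>
  have "((\<lambda>n. \<beta> * real N powr - \<tau> * h n powr \<alpha> * C) \<longlongrightarrow> \<beta> * real N powr - \<tau> * 0 powr \<alpha> * C) sequentially"
    using h0 \<alpha> D by (intro tendsto_mult tendsto_const tendsto_powr') (auto simp: h_def)
  then have e2: "\<forall>\<^sub>F n in sequentially. \<beta> * real N powr - \<tau> * h n powr \<alpha> * C < \<eta>"
    using \<eta> by (intro order_tendstoD(2)) auto
  have "\<forall>\<^sub>F n in sequentially. 0 < h n \<and> h n \<le> \<theta> \<and>
    (\<forall>L z. real L * h n \<le> 2 * \<theta> \<longrightarrow> \<bar>z\<bar> \<le> Z * real N \<longrightarrow>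
      two_point_ready G n \<F> L
        (\<lambda>k. comb \<theta> m K (h n) N (z + real k * h n) (\<beta> * real N powr - \<tau> * h n powr \<alpha>)))"
    using e1 e2 eventually_gt_at_top[of "0::nat"]
  proof eventually_elim
    case (elim n)
    define t where "t = h n"
    define b where "b = \<beta> * real N powr - \<tau> * t powr \<alpha>"
    have t: "0 < t" "t \<le> \<theta>" "t \<le> 2 * \<theta>" using elim D theta_pos by (auto simp: t_def h_def)
    have b: "0 \<le> b" "b * C \<le> \<eta>" using \<beta> elim by (auto simp: b_def t_def)
    have tE: "t powr E = D powr E / real n"
    proof -
      have "(real n powr (- 1 / E)) powr E = 1 / real n"
        using E elim by (simp only: powr_powr) (simp add: powr_minus_divide)
      then show ?thesis using D unfolding t_def h_def E_def[symmetric] by (simp add: powr_mult)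
    qed
    have "two_point_ready G n \<F> L (\<lambda>k. comb \<theta> m K t N (z + real k * t) b)"
      if L: "real L * t \<le> 2 * \<theta>" and z: "\<bar>z\<bar> \<le> Z * real N" for L z
    proof -
      let ?v = "\<lambda>k. comb \<theta> m K t N (z + real k * t) b"
      define X where "X = t * (real (Suc m * N) * (b * (t / \<theta>) ^ m / real N ^ m)\<^sup>2) * C\<^sup>2"
      define \<kappa> where "\<kappa> = c * s powr (- p - 1)"
      have \<kappa>: "0 < \<kappa>" using c s by (simp add: \<kappa>_def)
      note coeff = abs_comb_coeff_le[OF N(3) b(1)]
      have sep: "separated t (S \<times> {..<Suc m * N}) (\<lambda>(k, j). z + real k * t + 2 * \<theta> * real j)"
        if "S \<subseteq> {..<L}" for S
        by (rule separated_subset[OF separated_double_progression[OF t(1) L]]) (use that in auto)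
      have X0: "0 \<le> X" using t by (simp add: X_def)
      have nX: "real n * (2 * X / \<kappa>) \<le> 1 / 2"
      proof -
        have N0: "0 < real N" using N(3) by simp
        have "X = real (Suc m) * \<beta>\<^sup>2 * C\<^sup>2 * (1 / \<theta> ^ m)\<^sup>2 * (t * ((t powr \<alpha>)\<^sup>2 * (t ^ m)\<^sup>2))
            * (real N * (real N powr - \<tau>)\<^sup>2 / (real N ^ m)\<^sup>2)"
          by (simp add: X_def b_def power_mult_distrib power_divide del: of_nat_Suc) (simp add: algebra_simps)
        also have "t * ((t powr \<alpha>)\<^sup>2 * (t ^ m)\<^sup>2) = D powr E / real n"
          using powr_collect[OF t(1)] tE by (simp add: E_def)
        also have "real N * (real N powr - \<tau>)\<^sup>2 / (real N ^ m)\<^sup>2 = real N powr (1 - 2 * \<tau> - 2 * real m)"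
        proof -
          have "real N powr (1 - 2 * \<tau> - 2 * real m)
              = real N powr 1 * (real N powr - \<tau> * real N powr - \<tau>) / (real N powr real m * real N powr real m)"
            unfolding powr_add[symmetric] powr_diff[symmetric] by (simp add: algebra_simps)
          then show ?thesis using N0 by (simp add: powr_realpow power2_eq_square)
        qed
        finally have X: "X = real (Suc m) * \<beta>\<^sup>2 * C\<^sup>2 * (1 / \<theta> ^ m)\<^sup>2 * (D powr E / real n)
            * real N powr (1 - 2 * \<tau> - 2 * real m)" .
        have "1 / \<kappa> = (4 * W) powr (p + 1) * real N powr (p + 1) / c"
        proof -
          have "s powr (- p - 1) = 1 / s powr (p + 1)" using powr_minus_divide[of s "p + 1"] by simp
          moreover have "s powr (p + 1) = (4 * W) powr (p + 1) * real N powr (p + 1)"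
            using W N0 by (simp only: s_def) (rule powr_mult; simp)
          ultimately show ?thesis by (simp add: \<kappa>_def)
        qed
        then have "real n * (2 * X / \<kappa>) = real n * (2 * X) * ((4 * W) powr (p + 1) * real N powr (p + 1) / c)"
          by (metis times_divide_eq_right mult.right_neutral)
        also have "\<dots> = M * (real N powr (1 - 2 * \<tau> - 2 * real m) * real N powr (p + 1))"
          unfolding X M_def using elim by (simp add: field_simps del: of_nat_Suc)
        also have "real N powr (1 - 2 * \<tau> - 2 * real m) * real N powr (p + 1) = real N powr - \<gamma>"
          unfolding powr_add[symmetric] by (simp add: \<gamma>_def algebra_simps)
        finally show ?thesis using N(1) by simp
      qed
      have chi: "(\<integral>\<^sup>+y. ennreal ((conv_density G (?v k) y)\<^sup>2) \<partial>lborel) \<le> ennreal (\<kappa> / 2 * (2 * X / \<kappa>))" for k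
      proof -
        have "\<kappa> / 2 * (2 * X / \<kappa>) = X" using \<kappa> by simp
        then show ?thesis
          using conv_density_comb_square[OF K t(1,3) N(3) C(1)[OF le0] b(1), of "z + real k * t"]
          by (simp only: X_def)
      qed
      have vC: "\<bar>?v k x\<bar> \<le> b * C" for k x
        unfolding comb_def
        by (rule bump_train_bound[OF separated_progression[OF t(1,3)] _ C(1) b(1)]) (use coeff in auto)
      have fam: "(\<lambda>x. f0 x + (\<Sum>k\<in>S. ?v k x)) \<in> \<F> \<and>
          (\<forall>x. \<bar>x\<bar> \<le> s / 4 \<longrightarrow> \<kappa> \<le> f0 x + (\<Sum>k\<in>S. ?v k x))" if S: "S \<subseteq> {..<L}" for S
        unfolding \<kappa>_def
      proof (rule f0)
        have finS: "finite S" using S finite_subset by blast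
        note tr = sum_comb[OF finS, of \<theta> m K t N z b]
        show "(\<lambda>x. \<Sum>k\<in>S. ?v k x) \<in> borel_measurable borel" unfolding tr by (rule bump_train_measurable)
        show "\<bar>\<Sum>k\<in>S. ?v k x\<bar> \<le> \<eta>" for x
          unfolding tr
          by (rule order_trans[OF bump_train_bound[OF sep[OF S] _ C(1) b(1)] b(2)]) (use coeff in auto)
        show "(\<Sum>k\<in>S. ?v k x) = 0" if x: "s / 4 < \<bar>x\<bar>" for x
        proof (rule ccontr)
          assume "(\<Sum>k\<in>S. ?v k x) \<noteq> 0"
          then obtain k j where "k \<in> S" "j < Suc m * N" "z + real k * t + 2 * \<theta> * real j < x"
            "x < z + real k * t + 2 * \<theta> * real j + t"
            unfolding tr using bump_train_support[OF t(1)] by fastforce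
          then have "\<bar>x\<bar> \<le> real N * (Z + 4 * \<theta> + 2 * \<theta> * real (Suc m))"
            using S by (intro comb_position_bound[OF t(1,3) L _ _ N(3) z]) auto
          also have "\<dots> \<le> s / 4"
          proof -
            have "0 \<le> real N * (real m * \<theta> + r)" using r(1) theta_pos by simp
            moreover have "s / 4 = real N * (Z + 4 * \<theta> + 2 * \<theta> * real (Suc m)) + real N * (real m * \<theta> + r)"
              by (simp add: s_def W_def algebra_simps)
            ultimately show ?thesis by linarith
          qed
          finally show False using x by simp
        qed
        \<comment> \<open>As m >= 1, the teeth are derivatives of a bump, and the comb has mean
          0.\<close>
        obtain l where l: "m = Suc l" using m_pos by (cases m) auto
        have int: "integrable lborel (bump_train K m t I z' a')" "(\<integral>x. bump_train K m t I z' a' x \<partial>lborel) = 0"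
          if "finite I" for I :: "(nat \<times> nat) set" and z' a'
          using bump_train_integral[of l K t I z' a'] K t(1) that by (simp_all add: l)
        show "integrable lborel (\<lambda>x. \<Sum>k\<in>S. ?v k x)" "(\<integral>x. (\<Sum>k\<in>S. ?v k x) \<partial>lborel) = 0"
          unfolding tr by (rule int; use finS in simp)+
        show "H A' (\<lambda>x. \<Sum>k\<in>S. ?v k x)" unfolding b_def by (rule smooth[OF N(3) t(1) L S])
      qed
      have lower: "\<kappa> \<le> f0 x + (\<Sum>k\<in>S. ?v k x)"
        if a: "S \<subseteq> {..<L}" "k < L" "conv_density G (?v k) y \<noteq> 0" "\<bar>x - y\<bar> \<le> r" for S k x y
      proof -
        have "bump_train K 0 t {..<Suc m * N} (\<lambda>i. (z + real k * t - real m * \<theta>) + 2 * \<theta> * real i)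
            (\<lambda>i. b * (t / (2 * \<theta>)) ^ m / real N ^ m * coeff ([:1, -1:] ^ m * geom_poly N ^ Suc m) i) y \<noteq> 0"
          using a(3) unfolding conv_density_comb[OF K t(1) N(3)] .
        from bump_train_support[OF t(1) this]
        obtain i where i: "i < Suc m * N" "(z + real k * t - real m * \<theta>) + 2 * \<theta> * real i < y"
          "y < (z + real k * t - real m * \<theta>) + 2 * \<theta> * real i + t"
          by (elim bexE conjE) (rule that; simp)
        \<comment> \<open>After convolution the teeth start m theta further to the left; undoing
          this returns y to the range of the original comb.\<close>
        then have "\<bar>y + real m * \<theta>\<bar> \<le> real N * (Z + 4 * \<theta> + 2 * \<theta> * real (Suc m))"
          by (intro comb_position_bound[OF t(1,3) L a(2) i(1) N(3) z]) auto
        moreover have "real m * \<theta> * 1 \<le> real m * \<theta> * real N" "r * 1 \<le> r * real N"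
          using N(3) theta_pos r(1) by (intro mult_left_mono; simp)+
        moreover have "0 \<le> real m * \<theta>" using theta_pos by simp
        ultimately have "\<bar>x\<bar> \<le> real N * (Z + 4 * \<theta> + 2 * \<theta> * real (Suc m)) + real m * \<theta> * real N + r * real N"
          using a(4) by linarith
        also have "\<dots> = s / 4" by (simp add: s_def W_def algebra_simps)
        finally show ?thesis using fam[OF a(1)] by blast
      qed
      show ?thesis
        unfolding two_point_ready_def
      proof (rule exI[of _ f0], rule exI[of _ r], rule exI[of _ \<kappa>], rule exI[of _ "2 * X / \<kappa>"],
          rule exI[of _ "b * C"], intro conjI allI impI)
        show "0 \<le> 2 * X / \<kappa>" using X0 \<kappa> by simp
        show "(\<lambda>x. f0 x + (\<Sum>k\<in>S. ?v k x)) \<in> \<F>" if "S \<subseteq> {..<L}" for S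
          using fam[OF that] by (rule conjunct1)
      qed (fact \<kappa> nX r(2) vC | rule chi | rule lower; assumption)+
    qed
    then show ?case using t by (auto simp: t_def b_def)
  qed
  then show ?thesis using N(3) by blast
qed

end

section \<open>Divergence of the normalised risks\<close>

lemma liminf_eq_infinityI:
  assumes "\<And>R. R > 0 \<Longrightarrow> \<forall>\<^sub>F n in sequentially. ennreal R \<le> X n"
  shows "liminf X = (\<infinity>::ennreal)"
proof (rule ccontr)
  assume "liminf X \<noteq> \<infinity>"
  then obtain l where l: "liminf X = ennreal l" "0 \<le> l" by (cases "liminf X") auto
  have "ennreal (l + 1) \<le> liminf X"
    using assms[of "l + 1"] l(2) by (intro Liminf_bounded) simp
  then show False using l by (simp add: ennreal_le_iff del: ennreal_plus)
qed

lemma bump_square_integral_pos: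
  assumes "Suc m < K"
  shows "\<exists>J>0. ennreal J \<le> (\<integral>\<^sup>+x. ennreal ((bump K m x)\<^sup>2) \<partial>lborel)"
proof -
  obtain t where t: "bump K m t \<noteq> 0" using bump_nonzero[of m K] assms by auto
  define q where "q = \<bar>bump K m t\<bar> / 2"
  have q: "q > 0" using t by (simp add: q_def)
  have "isCont (bump K m) t"
    using bump_continuous[OF assms] by (simp add: continuous_on_eq_continuous_at)
  then obtain d where d: "d > 0" "\<And>x. dist x t < d \<Longrightarrow> dist (bump K m x) (bump K m t) < q"
    using q unfolding continuous_at_eps_delta by blast
  have "ennreal (q\<^sup>2 * d) = (\<integral>\<^sup>+x. ennreal (q\<^sup>2) * indicator {t - d/2..t + d/2} x \<partial>lborel)"
    using d(1) by (simp add: nn_integral_cmult_indicator ennreal_mult)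
  also have "\<dots> \<le> (\<integral>\<^sup>+x. ennreal ((bump K m x)\<^sup>2) \<partial>lborel)"
  proof (rule nn_integral_mono)
    fix x
    show "ennreal (q\<^sup>2) * indicator {t - d/2..t + d/2} x \<le> ennreal ((bump K m x)\<^sup>2)"
    proof (cases "x \<in> {t - d/2..t + d/2}")
      case True
      then have "dist x t < d" using d(1) by (auto simp: dist_real_def)
      then have "q \<le> \<bar>bump K m x\<bar>" using d(2)[of x] unfolding dist_real_def q_def by linarith
      then have "q\<^sup>2 \<le> \<bar>bump K m x\<bar>\<^sup>2" using q by (intro power_mono) auto
      then show ?thesis using True by (simp add: ennreal_leI)
    qed simp
  qed
  finally show ?thesis using q d(1) by (intro exI[of _ "q\<^sup>2 * d"]) auto
qed

lemma bump_holder_bound_exists: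
  assumes "\<alpha> > 0" "k = strict_floor \<alpha>" "m + k + 2 \<le> K"
  obtains C where "C > 0" "\<And>l x. l \<le> m + k \<Longrightarrow> \<bar>bump K l x\<bar> \<le> C"
    "\<And>l x y. l \<le> m + k \<Longrightarrow> \<bar>bump K l x - bump K l y\<bar> \<le> C * \<bar>x - y\<bar> powr (\<alpha> - real k)"
proof -
  have "0 < \<alpha> - real k" "\<alpha> - real k \<le> 1"
    using strict_floor_bounds[OF assms(1)] assms(2) by auto
  from bump_holder_upto[OF this assms(3)] obtain C where C: "C > 0"
    "\<forall>l\<le>m + k. (\<forall>x. \<bar>bump K l x\<bar> \<le> C) \<and>
      (\<forall>x y. \<bar>bump K l x - bump K l y\<bar> \<le> C * \<bar>x - y\<bar> powr (\<alpha> - real k))"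
    by (elim exE conjE)
  show thesis by (rule that[OF C(1)]) (use C(2) in simp_all)
qed

lemma bump_train_nonzeroE:
  assumes "bump_train K l h I z a x \<noteq> 0"
  obtains i where "i \<in> I" "bump K l ((x - z i) / h) \<noteq> 0"
proof -
  obtain i where "i \<in> I" "a i * bump K l ((x - z i) / h) \<noteq> 0"
    using assms unfolding bump_train_def by (rule sum.not_neutral_contains_not_neutral)
  then show thesis by (intro that[of i]) auto
qed

text \<open>With h = D n^(-1/E), a risk of order h^alpha becomes of order D^alpha after
  normalisation, so an arbitrary D gives divergence.\<close>

lemma rate_cancel:
  assumes "D > 0" "\<alpha> > 0" "E > 0" "n > 0"
  shows "real n powr (\<alpha> / E) * (D * real n powr (- 1 / E)) powr \<alpha> = D powr \<alpha>"
proof -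
  have "(D * real n powr (- 1 / E)) powr \<alpha> = D powr \<alpha> * real n powr - (\<alpha> / E)"
    using assms by (subst powr_mult) (simp_all add: powr_powr)
  moreover have "real n powr (\<alpha> / E) * real n powr - (\<alpha> / E) = 1"
    using assms by (simp add: powr_add[symmetric])
  ultimately show ?thesis by (simp add: mult.left_commute)
qed

context sinc_error
begin

lemma pointwise_risk_diverges:
  assumes "A > 0" "B > 0" and \<alpha>: "\<alpha> > 0" and p: "0 < p" "p < 2 * real m - 2"
    and slack: "moment_slack p B (F_class \<alpha> p A B)"
  shows "liminf (\<lambda>n. ennreal (real n powr (\<alpha> / (2 * \<alpha> + 2 * real m + 1)))
    * minimax_point G n (F_class \<alpha> p A B) x\<^sub>0) = \<infinity>"
proof (rule liminf_eq_infinityI)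
  fix R :: real assume R: "R > 0"
  define k where "k = strict_floor \<alpha>"
  define K where "K = m + k + 2"
  define E where "E = 2 * \<alpha> + 2 * real m + 1"
  have E: "E > 0" using \<alpha> by (simp add: E_def)
  have K: "Suc m < K" by (simp add: K_def)
  obtain C where C: "C > 0" "\<And>l x. l \<le> m + k \<Longrightarrow> \<bar>bump K l x\<bar> \<le> C"
    "\<And>l x y. l \<le> m + k \<Longrightarrow> \<bar>bump K l x - bump K l y\<bar> \<le> C * \<bar>x - y\<bar> powr (\<alpha> - real k)"
    using bump_holder_bound_exists[OF \<alpha> k_def, of m K] unfolding K_def by blast
  have wide: "\<exists>s\<^sub>1\<ge>1. \<forall>s\<ge>s\<^sub>1. holder_smooth \<alpha> a (wide_bump K s)" if "a > 0" for a
    using wide_bump_smooth[OF \<alpha> _ that, of K] by (force simp: K_def k_def)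
  obtain A' c s0 where A': "A' > 0" "c > 0"
    and base: "\<And>s. s \<ge> s0 \<Longrightarrow> perturbable (holder_smooth \<alpha>) (F_class \<alpha> p A B) p A' c s"
  proof -
    have "\<exists>A'>0. \<exists>c>0. \<exists>s\<^sub>0\<ge>1. \<forall>s\<ge>s\<^sub>0. perturbable (holder_smooth \<alpha>) (F_class \<alpha> p A B) p A' c s"
      unfolding F_class_eq
    proof (rule base_density_exists[where K = K])
      show "holder_smooth \<alpha> b f" if "holder_smooth \<alpha> a f" "a \<le> b" for a b f
        using that by (rule holder_smooth_mono)
      show "holder_smooth \<alpha> (c * a + d * b) (\<lambda>x. c * f x + d * g x)"
        if "holder_smooth \<alpha> a f" "holder_smooth \<alpha> b g" "0 < a" "0 < b" "0 < c" "0 < d" for a b c d f g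
        by (rule holder_smooth_linear) (rule that)+
    qed (use wide slack assms(1,2) p(1) in \<open>auto simp: F_class_eq\<close>)
    then obtain A' c s0 where *: "A' > 0" "c > 0"
      "\<forall>s\<ge>s0. perturbable (holder_smooth \<alpha>) (F_class \<alpha> p A B) p A' c s"
      by (elim exE conjE) (rule that; assumption)
    show thesis by (rule that[of A' c s0, OF *(1,2)]) (use *(3) in simp)
  qed
  obtain t0 where t0: "0 < t0" "t0 < 1" "bump K m t0 \<noteq> 0" using bump_nonzero[of m K] K by auto
  define q where "q = \<bar>bump K m t0\<bar> / real (Suc m)"
  have q: "q > 0" using t0(3) by (simp add: q_def)
  \<comment> \<open>Turns the Holder constant 2 b C h^(-alpha) of the comb into exactly
    \<open>A'\<close>.\<close>
  define \<beta> where "\<beta> = A' / (2 * C)"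
  have \<beta>: "\<beta> > 0" using A' C(1) by (simp add: \<beta>_def)
  \<comment> \<open>Solves n^(alpha/E) beta q h^alpha / 3 = R; the 3 comes from the two-point
    bound.\<close>
  define D where "D = (3 * R / (\<beta> * q)) powr (1 / \<alpha>)"
  have D: "D > 0" "D powr \<alpha> = 3 * R / (\<beta> * q)"
    using R \<beta> q \<alpha> by (auto simp: D_def powr_powr)
  define Z where "Z = \<bar>x\<^sub>0\<bar> + \<theta> + 2 * \<theta> * real (Suc m)"
  have Z: "Z \<ge> 0" using theta_pos by (simp add: Z_def)
  define h where "h = (\<lambda>n. D * real n powr (- 1 / E))"
  have smooth: "holder_smooth \<alpha> A' (\<lambda>x. \<Sum>k\<in>S. comb \<theta> m K h N (z + real k * h) (\<beta> * real N powr - 0 * h powr \<alpha>) x)"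
    if N: "N \<ge> 1" and h: "0 < h" and L: "real L * h \<le> 2 * \<theta>" and S: "S \<subseteq> {..<L}" for N h L S z
  proof -
    define b where "b = \<beta> * real N powr - 0 * h powr \<alpha>"
    have b: "b \<ge> 0" "b = \<beta> * h powr \<alpha>" using \<beta> N by (auto simp: b_def)
    have finS: "finite S" using S finite_subset by blast
    have sep: "separated h (S \<times> {..<Suc m * N}) (\<lambda>(k, j). z + real k * h + 2 * \<theta> * real j)"
      by (rule separated_subset[OF separated_double_progression[OF h L]]) (use S in auto)
    have "holder_smooth \<alpha> (2 * b * C * h powr - \<alpha>) (bump_train K m h (S \<times> {..<Suc m * N})
        (\<lambda>(k, j). z + real k * h + 2 * \<theta> * real j)
        (\<lambda>(k, j). b * comb_coeff m N j))"
      by (rule bump_train_holder_smooth[OF \<alpha> k_def _ sep _ b(1) C(3)])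
        (use abs_comb_coeff_le[OF N b(1)] C(1) in \<open>auto simp: K_def simp del: power_Suc\<close>)
    moreover have "2 * b * C * h powr - \<alpha> = A'"
      using C(1) h by (simp add: b(2) \<beta>_def powr_minus)
    ultimately show ?thesis
      unfolding b_def[symmetric] sum_comb[OF finS, of \<theta> m K h N z b, abs_def] by simp
  qed
  obtain N where N: "N \<ge> 1" and ev: "\<forall>\<^sub>F n in sequentially. 0 < h n \<and> h n \<le> \<theta> \<and>
    (\<forall>L z. real L * h n \<le> 2 * \<theta> \<longrightarrow> \<bar>z\<bar> \<le> Z * real N \<longrightarrow>
      two_point_ready G n (F_class \<alpha> p A B) L
        (\<lambda>k. comb \<theta> m K (h n) N (z + real k * h n) (\<beta> * real N powr - 0 * h n powr \<alpha>)))"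
  proof -
    have Cm: "\<bar>bump K l x\<bar> \<le> C" if "l \<le> m" for l x using C(2) that by simp
    have "\<exists>N\<ge>1. \<forall>\<^sub>F n in sequentially. 0 < h n \<and> h n \<le> \<theta> \<and>
      (\<forall>L z. real L * h n \<le> 2 * \<theta> \<longrightarrow> \<bar>z\<bar> \<le> Z * real N \<longrightarrow>
        two_point_ready G n (F_class \<alpha> p A B) L
          (\<lambda>k. comb \<theta> m K (h n) N (z + real k * h n) (\<beta> * real N powr - 0 * h n powr \<alpha>)))"
      unfolding h_def E_def
      by (rule comb_two_point_ready[OF base A'(2) K Cm C(1) \<alpha> \<beta> D(1) Z _ smooth]) (use p(2) in simp_all)
    then show thesis by (elim exE conjE) (rule that; assumption)
  qed
  obtain j where j: "j < Suc m * N" "1 / real (Suc m) \<le> comb_coeff m N j"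
    using comb_coeff_large[OF N] by blast
  show "\<forall>\<^sub>F n in sequentially. ennreal R \<le> ennreal (real n powr (\<alpha> / (2 * \<alpha> + 2 * real m + 1)))
      * minimax_point G n (F_class \<alpha> p A B) x\<^sub>0"
    using ev eventually_gt_at_top[of "0::nat"]
  proof eventually_elim
    case (elim n)
    define t where "t = h n"
    define b where "b = \<beta> * t powr \<alpha>"
    \<comment> \<open>Tooth j, which carries at least the mean weight, gets its nonvanishing point
      \<open>t0\<close> placed at \<open>x\<^sub>0\<close>.\<close>
    define z where "z = x\<^sub>0 - t * t0 - 2 * \<theta> * real j"
    define v where "v k = comb \<theta> m K t N (z + real k * t) b" for k :: nat
    have t: "0 < t" "t \<le> \<theta>" "t \<le> 2 * \<theta>" using elim theta_pos by (auto simp: t_def)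
    have b: "b \<ge> 0" using \<beta> by (simp add: b_def)
    have "\<bar>z\<bar> \<le> Z * real N"
    proof -
      have "t * t0 \<le> \<theta> * 1" using t t0 theta_pos by (intro mult_mono) auto
      moreover have "0 \<le> t * t0" using t t0 by simp
      moreover have "real j \<le> real (Suc m * N)" using j by linarith
      then have "2 * \<theta> * real j \<le> 2 * \<theta> * (real (Suc m) * real N)" "0 \<le> 2 * \<theta> * real j"
        using theta_pos by (auto intro!: mult_left_mono simp del: of_nat_Suc simp flip: of_nat_mult)
      moreover have "\<bar>x\<^sub>0\<bar> * 1 \<le> \<bar>x\<^sub>0\<bar> * real N" "\<theta> * 1 \<le> \<theta> * real N"
        using N theta_pos mult_left_mono[of 1 "real N" "\<bar>x\<^sub>0\<bar>"] mult_left_mono[of 1 "real N" \<theta>] by auto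
      ultimately have "\<bar>z\<bar> \<le> \<bar>x\<^sub>0\<bar> * real N + \<theta> * real N + 2 * \<theta> * (real (Suc m) * real N)"
        unfolding z_def by linarith
      then show ?thesis by (simp add: Z_def algebra_simps)
    qed
    then have "two_point_ready G n (F_class \<alpha> p A B) 1
        (\<lambda>k. comb \<theta> m K (h n) N (z + real k * h n) (\<beta> * real N powr - 0 * h n powr \<alpha>))"
      using elim t(3) by (auto simp: t_def)
    then have ready: "two_point_ready G n (F_class \<alpha> p A B) 1 v"
      using N by (simp add: v_def[abs_def] t_def b_def)
    have le: "ennreal (\<bar>v 0 x\<^sub>0\<bar> / 3) \<le> minimax_point G n (F_class \<alpha> p A B) x\<^sub>0"
      by (rule minimax_point_two_point[OF G _ _ ready]) (auto simp: F_class_eq v_def comb_measurable)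
    have "v 0 x\<^sub>0 = b * comb_coeff m N j * bump K m t0"
    proof -
      let ?z = "\<lambda>j. z + 2 * \<theta> * real j"
      have x: "(x\<^sub>0 - ?z j) / t = t0" using t by (simp add: z_def)
      have "bump K m ((x\<^sub>0 - ?z i) / t) = 0" if "i \<in> {..<Suc m * N} - {j}" for i
        using separated_unique[OF separated_progression[OF t(1,3)], of i "Suc m * N" j K m x\<^sub>0 z K m] that j(1) x t0(3)
        by auto
      then show ?thesis
        unfolding v_def comb_def bump_train_def using j(1)
        by (subst sum.remove[of _ j]) (auto simp: x simp del: power_Suc)
    qed
    then have "\<bar>v 0 x\<^sub>0\<bar> = b * comb_coeff m N j * \<bar>bump K m t0\<bar>"
      by (simp only: abs_mult abs_of_nonneg[OF b] abs_of_nonneg[OF comb_coeff_bounds(1)[OF N]])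
    also have "\<dots> \<ge> b * (1 / real (Suc m)) * \<bar>bump K m t0\<bar>"
      using b j(2) by (intro mult_right_mono mult_left_mono) auto
    finally have v: "b * q \<le> \<bar>v 0 x\<^sub>0\<bar>" by (simp add: q_def)
    have "R = real n powr (\<alpha> / E) * (b * q / 3)"
      using rate_cancel[OF D(1) \<alpha> E elim(2)] D(2) \<beta> q by (simp add: b_def t_def h_def field_simps)
    also have "\<dots> \<le> real n powr (\<alpha> / E) * (\<bar>v 0 x\<^sub>0\<bar> / 3)"
      using v by (intro mult_left_mono) auto
    finally have "ennreal R \<le> ennreal (real n powr (\<alpha> / E)) * ennreal (\<bar>v 0 x\<^sub>0\<bar> / 3)"
      by (simp add: ennreal_leI flip: ennreal_mult)
    also have "\<dots> \<le> ennreal (real n powr (\<alpha> / E)) * minimax_point G n (F_class \<alpha> p A B) x\<^sub>0"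
      by (intro mult_left_mono le) simp
    finally show ?case by (simp add: E_def)
  qed
qed

lemma integrated_risk_diverges:
  assumes "A > 0" "B > 0" and \<alpha>: "\<alpha> > 1 / 2" and p: "0 < p" "p < 2 * real m - 1"
    and slack: "moment_slack p B (G_class \<alpha> p A B)"
  shows "liminf (\<lambda>n. ennreal (real n powr (\<alpha> / (2 * \<alpha> + 2 * real m + 1)))
    * minimax_L2 G n (G_class \<alpha> p A B)) = \<infinity>"
proof (rule liminf_eq_infinityI)
  fix R :: real assume R: "R > 0"
  have \<alpha>0: "\<alpha> > 0" using \<alpha> by simp
  define k where "k = strict_floor \<alpha>"
  define K where "K = m + k + 2"
  define E where "E = 2 * \<alpha> + 2 * real m + 1"
  have E: "E > 0" using \<alpha> by (simp add: E_def)
  have K: "Suc m < K" by (simp add: K_def)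
  obtain C where C: "C > 0" "\<And>l x. l \<le> m + k \<Longrightarrow> \<bar>bump K l x\<bar> \<le> C"
    "\<And>l x y. l \<le> m + k \<Longrightarrow> \<bar>bump K l x - bump K l y\<bar> \<le> C * \<bar>x - y\<bar> powr (\<alpha> - real k)"
    using bump_holder_bound_exists[OF \<alpha>0 k_def, of m K] unfolding K_def by blast
  have wide: "\<exists>s\<^sub>1\<ge>1. \<forall>s\<ge>s\<^sub>1. sobolev_smooth \<alpha> a (wide_bump K s)" if "a > 0" for a
    using wide_bump_smooth[OF \<alpha>0 _ that, of K] \<alpha> by (force simp: K_def k_def)
  obtain A' c s0 where A': "A' > 0" "c > 0"
    and base: "\<And>s. s \<ge> s0 \<Longrightarrow> perturbable (sobolev_smooth \<alpha>) (G_class \<alpha> p A B) p A' c s"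
  proof -
    have "\<exists>A'>0. \<exists>c>0. \<exists>s\<^sub>0\<ge>1. \<forall>s\<ge>s\<^sub>0. perturbable (sobolev_smooth \<alpha>) (G_class \<alpha> p A B) p A' c s"
      unfolding G_class_eq
    proof (rule base_density_exists[where K = K])
      show "sobolev_smooth \<alpha> b f" if "sobolev_smooth \<alpha> a f" "a \<le> b" for a b f
        using that by (rule sobolev_smooth_mono)
      show "sobolev_smooth \<alpha> (c * a + d * b) (\<lambda>x. c * f x + d * g x)"
        if "sobolev_smooth \<alpha> a f" "sobolev_smooth \<alpha> b g" "0 < a" "0 < b" "0 < c" "0 < d" for a b c d f g
        by (rule sobolev_smooth_linear) (rule that)+
    qed (use wide slack assms(1,2) p(1) in \<open>auto simp: G_class_eq\<close>)
    then obtain A' c s0 where *: "A' > 0" "c > 0"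
      "\<forall>s\<ge>s0. perturbable (sobolev_smooth \<alpha>) (G_class \<alpha> p A B) p A' c s"
      by (elim exE conjE) (rule that; assumption)
    show thesis by (rule that[of A' c s0, OF *(1,2)]) (use *(3) in simp)
  qed
  obtain J where J: "J > 0" "ennreal J \<le> (\<integral>\<^sup>+x. ennreal ((bump K m x)\<^sup>2) \<partial>lborel)"
    using bump_square_integral_pos[OF K] by blast
  \<comment> \<open>Collects the constants of Assouad's bound: theta from the number of shifts, at
    least theta / h; J / (m + 1) from the L2 norm of one comb; 8 from the averaging.\<close>
  define q where "q = sqrt (\<theta> * J / (8 * real (Suc m)))"
  have q: "q > 0" using J theta_pos by (simp add: q_def)
  \<comment> \<open>All combs together have at most (2 theta / h) (m + 1) N teeth of width h, so the
    root in the Sobolev bound is at most V sqrt N. The factor N^(-1/2) in the height cancels sqrt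
    N.\<close>
  define V where "V = sqrt (2 * \<theta> * real (Suc m))"
  have V: "V > 0" using theta_pos by (simp add: V_def)
  define \<beta> where "\<beta> = A' / (2 * C * V)"
  have \<beta>: "\<beta> > 0" using A' C(1) V by (simp add: \<beta>_def)
  define D where "D = (R / (\<beta> * q)) powr (1 / \<alpha>)"
  have D: "D > 0" "D powr \<alpha> = R / (\<beta> * q)"
    using R \<beta> q \<alpha> by (auto simp: D_def powr_powr)
  define h where "h = (\<lambda>n. D * real n powr (- 1 / E))"
  have smooth: "sobolev_smooth \<alpha> A' (\<lambda>x. \<Sum>k\<in>S. comb \<theta> m K h N (z + real k * h) (\<beta> * real N powr - (1/2) * h powr \<alpha>) x)"
    if N: "N \<ge> 1" and h: "0 < h" and L: "real L * h \<le> 2 * \<theta>" and S: "S \<subseteq> {..<L}" for N h L S z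
  proof -
    define b where "b = \<beta> * real N powr - (1/2) * h powr \<alpha>"
    have b: "b \<ge> 0" using \<beta> by (simp add: b_def)
    have finS: "finite S" using S finite_subset by blast
    let ?I = "S \<times> {..<Suc m * N}"
    have sep: "separated h ?I (\<lambda>(k, j). z + real k * h + 2 * \<theta> * real j)"
      by (rule separated_subset[OF separated_double_progression[OF h L]]) (use S in auto)
    have "sobolev_smooth \<alpha> (2 * b * C * sqrt (real (card ?I) * h) * h powr - \<alpha>) (bump_train K m h ?I
        (\<lambda>(k, j). z + real k * h + 2 * \<theta> * real j)
        (\<lambda>(k, j). b * comb_coeff m N j))"
      by (rule bump_train_sobolev_smooth[OF \<alpha>0 k_def _ sep _ b C(3)])
        (use abs_comb_coeff_le[OF N b] C(1) in \<open>auto simp: K_def simp del: power_Suc\<close>)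
    moreover have "2 * b * C * sqrt (real (card ?I) * h) * h powr - \<alpha> \<le> A'"
    proof -
      have "card S \<le> L" using card_mono[OF _ S] by simp
      then have "real (card S) * h \<le> real L * h" using h by (intro mult_right_mono) auto
      then have "real (card S) * h * real (Suc m * N) \<le> 2 * \<theta> * real (Suc m * N)"
        using L by (intro mult_right_mono) auto
      then have "real (card ?I) * h \<le> 2 * \<theta> * real (Suc m) * real N"
        by (simp add: card_cartesian_product algebra_simps)
      then have "sqrt (real (card ?I) * h) \<le> V * sqrt (real N)"
        unfolding V_def real_sqrt_mult[symmetric] by (rule real_sqrt_le_mono)
      then have "2 * b * C * sqrt (real (card ?I) * h) * h powr - \<alpha> \<le> 2 * b * C * (V * sqrt (real N)) * h powr - \<alpha>"
        using b C(1) by (intro mult_right_mono mult_left_mono) auto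
      also have "\<dots> = A'"
      proof -
        have "sqrt (real N) \<noteq> 0" "h powr \<alpha> \<noteq> 0" using N h by auto
        then show ?thesis using C(1) V by (simp add: b_def \<beta>_def powr_minus powr_half_sqrt field_simps)
      qed
      finally show ?thesis .
    qed
    ultimately show ?thesis
      unfolding b_def[symmetric] sum_comb[OF finS, of \<theta> m K h N z b, abs_def] by (rule sobolev_smooth_mono)
  qed
  obtain N where N: "N \<ge> 1" and ev: "\<forall>\<^sub>F n in sequentially. 0 < h n \<and> h n \<le> \<theta> \<and>
    (\<forall>L z. real L * h n \<le> 2 * \<theta> \<longrightarrow> \<bar>z\<bar> \<le> 0 * real N \<longrightarrow>
      two_point_ready G n (G_class \<alpha> p A B) L
        (\<lambda>k. comb \<theta> m K (h n) N (z + real k * h n) (\<beta> * real N powr - (1/2) * h n powr \<alpha>)))"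
  proof -
    have Cm: "\<bar>bump K l x\<bar> \<le> C" if "l \<le> m" for l x using C(2) that by simp
    have "\<exists>N\<ge>1. \<forall>\<^sub>F n in sequentially. 0 < h n \<and> h n \<le> \<theta> \<and>
      (\<forall>L z. real L * h n \<le> 2 * \<theta> \<longrightarrow> \<bar>z\<bar> \<le> 0 * real N \<longrightarrow>
        two_point_ready G n (G_class \<alpha> p A B) L
          (\<lambda>k. comb \<theta> m K (h n) N (z + real k * h n) (\<beta> * real N powr - (1/2) * h n powr \<alpha>)))"
      unfolding h_def E_def
      by (rule comb_two_point_ready[OF base A'(2) K Cm C(1) \<alpha>0 \<beta> D(1) order_refl _ smooth]) (use p(2) in simp_all)
    then show thesis by (elim exE conjE) (rule that; assumption)
  qed
  show "\<forall>\<^sub>F n in sequentially. ennreal R \<le> ennreal (real n powr (\<alpha> / (2 * \<alpha> + 2 * real m + 1)))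
      * minimax_L2 G n (G_class \<alpha> p A B)"
    using ev eventually_gt_at_top[of "0::nat"]
  proof eventually_elim
    case (elim n)
    define t where "t = h n"
    define b where "b = \<beta> * real N powr - (1/2) * t powr \<alpha>"
    \<comment> \<open>One period 2 theta has room for this many shifts by t. As theta / t >= 1,
      rounding down still leaves at least theta / t.\<close>
    define L where "L = nat \<lfloor>2 * \<theta> / t\<rfloor>"
    define v where "v k = comb \<theta> m K t N (0 + real k * t) b" for k :: nat
    have t: "0 < t" "t \<le> \<theta>" "t \<le> 2 * \<theta>" using elim theta_pos by (auto simp: t_def)
    have "1 \<le> \<theta> / t" using t by simp
    then have L: "real L \<le> 2 * \<theta> / t" "\<theta> / t \<le> real L"
      unfolding L_def using floor_correct[of "2 * \<theta> / t"] by (simp, linarith)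
    then have Lt: "real L * t \<le> 2 * \<theta>" using t by (simp add: pos_le_divide_eq)
    have ready: "two_point_ready G n (G_class \<alpha> p A B) L v"
      using elim Lt by (auto simp: v_def[abs_def] t_def b_def)
    define \<delta> where "\<delta> = t * (b\<^sup>2 * (real N / real (Suc m))) * J"
    have sepk: "separated t {..<Suc m * N} (\<lambda>j. 0 + real k * t + 2 * \<theta> * real j)" for k
      by (rule separated_progression[OF t(1,3)])
    have \<delta>: "ennreal \<delta> \<le> (\<integral>\<^sup>+x. ennreal ((v k x)\<^sup>2) \<partial>lborel)" for k
    proof -
      have "b\<^sup>2 * (real N / real (Suc m))
          \<le> (\<Sum>j<Suc m * N. (b * comb_coeff m N j)\<^sup>2)"
      proof -
        have "(\<Sum>j<Suc m * N. (b * comb_coeff m N j)\<^sup>2)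
            = b\<^sup>2 * (\<Sum>j<Suc m * N. (comb_coeff m N j)\<^sup>2)"
          by (simp only: power_mult_distrib sum_distrib_left)
        then show ?thesis using mult_left_mono[OF sum_comb_coeff_square[OF N, of m], of "b\<^sup>2"] by (simp only: zero_le_power2 simp_thms)
      qed
      then have le: "t * (b\<^sup>2 * (real N / real (Suc m)))
          \<le> t * (\<Sum>j<Suc m * N. (b * comb_coeff m N j)\<^sup>2)"
        using t by (intro mult_left_mono) auto
      have "ennreal (t * (b\<^sup>2 * (real N / real (Suc m)))) * ennreal J
          \<le> ennreal (t * (\<Sum>j<Suc m * N. (b * comb_coeff m N j)\<^sup>2))
            * (\<integral>\<^sup>+x. ennreal ((bump K m x)\<^sup>2) \<partial>lborel)"
        by (rule mult_mono[OF ennreal_leI[OF le] J(2)]) auto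
      also have "\<dots> = (\<integral>\<^sup>+x. ennreal ((v k x)\<^sup>2) \<partial>lborel)"
        unfolding v_def comb_def by (rule nn_integral_bump_train_square[OF sepk, symmetric])
      finally show ?thesis
        unfolding \<delta>_def using t J(1) by (subst ennreal_mult) auto
    qed
    have disj: "v k x = 0 \<or> v l x = 0" if kl: "k < L" "l < L" "k \<noteq> l" for k l x
    proof (rule ccontr)
      assume "\<not> ?thesis"
      then have "v k x \<noteq> 0" "v l x \<noteq> 0" by auto
      from \<open>v k x \<noteq> 0\<close> obtain i where i: "i \<in> {..<Suc m * N}"
        "bump K m ((x - (0 + real k * t + 2 * \<theta> * real i)) / t) \<noteq> 0"
        unfolding v_def comb_def by (rule bump_train_nonzeroE)
      from \<open>v l x \<noteq> 0\<close> obtain j where j: "j \<in> {..<Suc m * N}"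
        "bump K m ((x - (0 + real l * t + 2 * \<theta> * real j)) / t) \<noteq> 0"
        unfolding v_def comb_def by (rule bump_train_nonzeroE)
      let ?z = "\<lambda>(k, j). 0 + real k * t + 2 * \<theta> * real j"
      have "(k, i) = (l, j)"
      proof (rule separated_unique[OF separated_double_progression[OF t(1) Lt, where z = 0 and M = "Suc m * N"]])
        show "(k, i) \<in> {..<L} \<times> {..<Suc m * N}" "(l, j) \<in> {..<L} \<times> {..<Suc m * N}"
          using kl i(1) j(1) by (simp_all only: mem_Sigma_iff lessThan_iff simp_thms)
        show "bump K m ((x - ?z (k, i)) / t) \<noteq> 0" "bump K m ((x - ?z (l, j)) / t) \<noteq> 0"
          using i(2) j(2) by (simp_all only: case_prod_conv not_False_eq_True)
      qed
      then show False using kl(3) by simp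
    qed
    have le: "ennreal (sqrt (real L * \<delta> / 8)) \<le> minimax_L2 G n (G_class \<alpha> p A B)"
    proof (rule minimax_L2_assouad[OF G _ _ ready disj \<delta>])
      show "prob_density g" if "g \<in> G_class \<alpha> p A B" for g using that by (simp add: G_class_eq)
      show "v k \<in> borel_measurable borel" for k unfolding v_def by (rule comb_measurable)
      show "0 \<le> \<delta>" using t J(1) by (simp add: \<delta>_def)
    qed
    \<comment> \<open>N drops out: order N teeth meet the squared height factor 1/N, so D can be
      chosen before N.\<close>
    have "\<theta> / t * \<delta> / 8 = (\<beta> * t powr \<alpha> * q)\<^sup>2"
    proof -
      have "real N powr - (1/2) = 1 / sqrt (real N)"
        using powr_minus_divide[of "real N" "1/2"] by (simp only: powr_half_sqrt of_nat_0_le_iff)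
      then have "(real N powr - (1/2))\<^sup>2 = 1 / real N" by (simp add: power_divide)
      then have bN: "b\<^sup>2 * real N = \<beta>\<^sup>2 * (t powr \<alpha>)\<^sup>2"
        using N by (simp add: b_def power_mult_distrib)
      have q2: "q\<^sup>2 = \<theta> * J / (8 * real (Suc m))"
        unfolding q_def by (rule real_sqrt_pow2) (use theta_pos J(1) in simp)
      have "\<theta> / t * \<delta> / 8 = \<theta> * J / (8 * real (Suc m)) * (b\<^sup>2 * real N)"
        using t(1) by (simp add: \<delta>_def mult.commute mult.left_commute del: of_nat_Suc)
      also have "\<dots> = (\<beta> * t powr \<alpha> * q)\<^sup>2"
        unfolding bN q2[symmetric] by (simp add: power_mult_distrib)
      finally show ?thesis .
    qed
    moreover have "\<theta> / t * \<delta> / 8 \<le> real L * \<delta> / 8"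
      using L(2) t J(1) by (intro divide_right_mono mult_right_mono) (auto simp: \<delta>_def)
    ultimately have "\<beta> * t powr \<alpha> * q \<le> sqrt (real L * \<delta> / 8)"
      by (intro real_le_rsqrt) simp
    moreover have "R = real n powr (\<alpha> / E) * (\<beta> * t powr \<alpha> * q)"
      using rate_cancel[OF D(1) \<alpha>0 E elim(2)] D(2) \<beta> q by (simp add: t_def h_def field_simps)
    ultimately have "R \<le> real n powr (\<alpha> / E) * sqrt (real L * \<delta> / 8)"
      by (simp add: mult_left_mono)
    then have "ennreal R \<le> ennreal (real n powr (\<alpha> / E)) * ennreal (sqrt (real L * \<delta> / 8))"
      using t J(1) by (simp add: ennreal_leI \<delta>_def flip: ennreal_mult)
    also have "\<dots> \<le> ennreal (real n powr (\<alpha> / E)) * minimax_L2 G n (G_class \<alpha> p A B)"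
      by (intro mult_left_mono le) simp
    finally show ?case by (simp add: E_def)
  qed
qed

end

theorem theorem4:
  fixes \<theta> A B :: real and m :: nat and G :: "real measure"
  assumes "\<theta> > 0" and "m \<ge> 1"
    and "real_distribution G"
    and "\<forall>\<omega>. char G (- \<omega>) = complex_of_real (sinc (\<theta> * \<omega>) ^ m)"
    and "A > 0" and "B > 0"
  shows "(\<forall>\<alpha> p x\<^sub>0 :: real.
            \<alpha> > 0 \<longrightarrow> 0 < p \<longrightarrow> p < 2 * real m - 2 \<longrightarrow> moment_slack p B (F_class \<alpha> p A B) \<longrightarrow>
            liminf (\<lambda>n. ennreal (real n powr (\<alpha> / (2 * \<alpha> + 2 * real m + 1)))
                        * minimax_point G n (F_class \<alpha> p A B) x\<^sub>0) = \<infinity>)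
       \<and> (\<forall>\<alpha> p :: real.
            \<alpha> > 1 / 2 \<longrightarrow> 0 < p \<longrightarrow> p < 2 * real m - 1 \<longrightarrow> moment_slack p B (G_class \<alpha> p A B) \<longrightarrow>
            liminf (\<lambda>n. ennreal (real n powr (\<alpha> / (2 * \<alpha> + 2 * real m + 1)))
                        * minimax_L2 G n (G_class \<alpha> p A B)) = \<infinity>)"
proof -
  \<comment> \<open>The transform with exp(-i w t) is \<open>char\<close> at -w; sinc is
    even.\<close>
  have char: "char G \<omega> = complex_of_real (sinc (\<theta> * \<omega>) ^ m)" for \<omega>
    using assms(4)[rule_format, of "- \<omega>"] by simp
  interpret sinc_error \<theta> m G
    by (intro sinc_error.intro assms(1-3) char)
  show ?thesis
  proof (intro conjI allI impI)
    fix \<alpha> p x\<^sub>0 :: real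
    assume "\<alpha> > 0" "0 < p" "p < 2 * real m - 2" "moment_slack p B (F_class \<alpha> p A B)"
    then show "liminf (\<lambda>n. ennreal (real n powr (\<alpha> / (2 * \<alpha> + 2 * real m + 1)))
        * minimax_point G n (F_class \<alpha> p A B) x\<^sub>0) = \<infinity>"
      by (rule pointwise_risk_diverges[OF assms(5,6)])
  next
    fix \<alpha> p :: real
    assume "\<alpha> > 1 / 2" "0 < p" "p < 2 * real m - 1" "moment_slack p B (G_class \<alpha> p A B)"
    then show "liminf (\<lambda>n. ennreal (real n powr (\<alpha> / (2 * \<alpha> + 2 * real m + 1)))
        * minimax_L2 G n (G_class \<alpha> p A B)) = \<infinity>"
      by (rule integrated_risk_diverges[OF assms(5,6)])
  qed
qed

end
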